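(* Let $X,Y$ be Banach spaces, $F:D(F)\subseteq X\to Y$ a weakly sequentially continuous (nonlinear) operator whose domain $D(F)$ is closed and convex, and let $y\in Y$ be such that $F(x)=y$ has a unique solution $x^\dagger\in D(F)$. Let $V$ be a Banach space continuously embedded in $X$, with strictly finer topology, such that sub-level sets of $\|\cdot\|_V^m$ are weakly sequentially pre-compact in $X$. Fix $\nu,m\ge 1$, $\delta_{\max}>0$ (sufficiently small) and $C_{DP}>1$. For $\delta\in(0,\delta_{\max}]$ and $y^\delta\in Y$ with $\|y^\delta-y\|_Y\le\delta$, consider minimizers over $D(F)\cap V$ of $$T^\delta_\kappa(x)=\|F(x)-y^\delta\|_Y^\nu+\kappa\|x\|_V^m ,$$ and assume that for every such $\delta,y^\delta$ there are $\kappa_{DP}=\kappa_{DP}(\delta,y^\delta)>0$ and a minimizer $x^\delta_{\kappa_{DP}}$ of $T^\delta_{\kappa_{DP}}$ with $\|F(x^\delta_{\kappa_{DP}})-y^\delta\|_Y=C_{DP}\delta$. Suppose that $A:D(A)\subset X\to X$ is an invertible $\omega$-sectorial operator for some $0\le\omega<\pi$ with $D(A)=V$ and $\|\cdot\|_V\sim\|A\cdot\|_X$ (equivalent norms on $V$). Let $a\ge 0$ and $U=X_A^{-a}$, and assume that there are constants $0<c_U\le C_U<\infty$ with $$c_U\|x-x^\dagger\|_U\le\|F(x)-F(x^\dagger)\|_Y\le C_U\|x-x^\dagger\|_U\quad\forall x\in D(F),$$ and a neighborhood $B^\dagger\subset X$ of $x^\dagger$ such that $F$ is continuous on $B^\dagger\cap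 D(F)$. Assume there exists $f\in\mathcal E(S_\varphi)$ for some $\varphi\in(\omega,\pi)$ such that for every $s\in(0,1)$ the functions $z\mapsto z^{-(a+s)}(f(z)-1)$ and $z\mapsto z^sf(z)$ belong to $\mathcal E(S_\varphi)$. Suppose $x^\dagger\in D(A^\theta)$ with $\|A^\theta x^\dagger\|_X\le E$ for some $0<\theta<1$ and $E>0$, and that either $x^\dagger$ is an interior point of $D(F)$ (in $X$), or there exists $t_0\in(0,\infty)$ with $f(tA)x^\dagger\in D(F)$ for all $0<t\le t_0$. Then there is a constant $c>0$, independent of $\delta$, such that $$\|x^\delta_{\kappa_{DP}}-x^\dagger\|_X\le c\,\delta^{\frac{\theta}{a+\theta}}$$ for all sufficiently small $\delta>0$.
   Context: For $\omega\in(0,\pi)$, $S_\omega=\{z\in\mathbb C\setminus\{0\}:|\arg z|<\omega\}$, and $S_0=(0,\infty)$. A linear closed operator $A:D(A)\subset X\to X$ is $\omega$-sectorial ($\omega\in(0,\pi)$) if $\sigma(A)\subset\overline{S_\omega}$, the range of $A$ is dense in $X$, and for every $\varphi\in(\omega,\pi)$ there is $C_\varphi$ with $\|\lambda(\lambda\,\mathrm{id}-A)^{-1}\|_{X\to X}\le C_\varphi$ for all $\lambda\in\mathbb C\setminus\overline{S_\varphi}$; it is $0$-sectorial if it is $\omega$-sectorial for all $\omega\in(0,\pi)$. Invertible means $A:D(A)\to X$ is bijective with bounded inverse. $\mathcal H(S_\varphi)$ is the set of holomorphic $\psi:S_\varphi\to\mathbb C$ with $|\psi(z)|\le C\min\{|z|^\beta,|z|^{-\beta}\}$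 for some $C,\beta>0$, and $\mathcal E(S_\varphi)=\mathcal H(S_\varphi)\oplus\mathrm{span}\{1\}\oplus\mathrm{span}\{(1+z)^{-1}\}$. For $f=\psi+c_1+c_2(1+z)^{-1}\in\mathcal E(S_\varphi)$ with $\varphi>\omega$, $f(A)=\psi(A)+c_1\mathrm{id}+c_2(\mathrm{id}+A)^{-1}\in B(X)$, where $\psi(A)=\frac1{2\pi i}\int_{\partial S_{\omega'}}\psi(z)(z\,\mathrm{id}-A)^{-1}dz$ with $\omega'\in(\omega,\varphi)$ and counterclockwise orientation; $f(tA)$ for $t>0$ is defined analogously with $tA$. The fractional powers $A^s$, $s\in\mathbb R$, are defined by the extended holomorphic functional calculus; for invertible $A$ and $s\ge0$, $A^s$ is invertible with inverse $A^{-s}\in B(X)$, and $D(A^s)$ carries the norm $\|A^s\cdot\|_X$. For $a\ge0$, $X_A^{-a}$ denotes the completion of $X$ under the norm $\|A^{-a}\cdot\|_X$. *)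

theory Defs
  imports "HOL-Analysis.Analysis"
begin

class scaleC = scaleR +
  fixes scaleC :: "complex \<Rightarrow> 'a \<Rightarrow> 'a" (infixr "*\<^sub>C" 75)
  assumes scaleR_scaleC: "scaleR r = scaleC (complex_of_real r)"

class complex_vector = scaleC + ab_group_add +
  assumes scaleC_add_right: "a *\<^sub>C (x + y) = a *\<^sub>C x + a *\<^sub>C y"
    and scaleC_add_left: "(a + b) *\<^sub>C x = a *\<^sub>C x + b *\<^sub>C x"
    and scaleC_scaleC: "a *\<^sub>C (b *\<^sub>C x) = (a * b) *\<^sub>C x"
    and scaleC_one: "1 *\<^sub>C x = x"

class complex_normed_vector = complex_vector + real_normed_vector +
  assumes norm_scaleC: "norm (a *\<^sub>C x) = cmod a * norm x"

text \<open>Weak convergence of a sequence in a normed space: convergence against every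
  bounded linear functional (real-valued functionals; for complex spaces this gives the same
  weak topology as complex-valued ones).\<close>
definition weak_conv :: "(nat \<Rightarrow> 'a::real_normed_vector) \<Rightarrow> 'a \<Rightarrow> bool" where
  "weak_conv xs x \<longleftrightarrow>
     (\<forall>g :: 'a \<Rightarrow> real. bounded_linear g \<longrightarrow> (\<lambda>n. g (xs n)) \<longlonglongrightarrow> g x)"

definition weakly_seq_continuous_on ::
    "'a::real_normed_vector set \<Rightarrow> ('a \<Rightarrow> 'b::real_normed_vector) \<Rightarrow> bool" where
  "weakly_seq_continuous_on D F \<longleftrightarrow>
     (\<forall>xs x. (\<forall>n. xs n \<in> D) \<and> x \<in> D \<and> weak_conv xs x \<longrightarrow> weak_conv (\<lambda>n. F (xs n)) (F x))"

definition sector :: "real \<Rightarrow> complex set" where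
  "sector \<omega> = (if \<omega> = 0 then complex_of_real ` {0<..} else {z. z \<noteq> 0 \<and> \<bar>Arg z\<bar> < \<omega>})"

definition holo_H :: "real \<Rightarrow> (complex \<Rightarrow> complex) \<Rightarrow> bool" where
  "holo_H \<phi> \<psi> \<longleftrightarrow> \<psi> holomorphic_on sector \<phi> \<and>
     (\<exists>C \<beta>. C > 0 \<and> \<beta> > 0 \<and>
        (\<forall>z\<in>sector \<phi>. cmod (\<psi> z) \<le> C * min (cmod z powr \<beta>) (cmod z powr (-\<beta>))))"

definition holo_E :: "real \<Rightarrow> (complex \<Rightarrow> complex) \<Rightarrow> bool" where
  "holo_E \<phi> f \<longleftrightarrow> (\<exists>\<psi> c1 c2. holo_H \<phi> \<psi> \<and> (\<forall>z\<in>sector \<phi>. f z = \<psi> z + c1 + c2 / (1 + z)))"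

definition complex_subspace :: "'x::complex_normed_vector set \<Rightarrow> bool" where
  "complex_subspace D \<longleftrightarrow> 0 \<in> D \<and> (\<forall>x\<in>D. \<forall>y\<in>D. x + y \<in> D) \<and> (\<forall>c. \<forall>x\<in>D. c *\<^sub>C x \<in> D)"

definition linear_closed_op :: "('x::complex_normed_vector \<Rightarrow> 'x) \<Rightarrow> 'x set \<Rightarrow> bool" where
  "linear_closed_op A D \<longleftrightarrow> complex_subspace D \<and>
     (\<forall>x\<in>D. \<forall>y\<in>D. A (x + y) = A x + A y) \<and> (\<forall>c. \<forall>x\<in>D. A (c *\<^sub>C x) = c *\<^sub>C A x) \<and>
     (\<forall>xs x y. (\<forall>n. xs n \<in> D) \<and> xs \<longlonglongrightarrow> x \<and> (\<lambda>n. A (xs n)) \<longlonglongrightarrow> y \<longrightarrow> x \<in> D \<and> A x = y)"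

definition resolvent_set :: "('x::complex_normed_vector \<Rightarrow> 'x) \<Rightarrow> 'x set \<Rightarrow> complex set" where
  "resolvent_set A D = {l. bij_betw (\<lambda>x. l *\<^sub>C x - A x) D UNIV \<and>
                            (\<exists>C. \<forall>x\<in>D. norm x \<le> C * norm (l *\<^sub>C x - A x))}"

definition spectrum_op :: "('x::complex_normed_vector \<Rightarrow> 'x) \<Rightarrow> 'x set \<Rightarrow> complex set" where
  "spectrum_op A D = UNIV - resolvent_set A D"

definition resolvent :: "('x::complex_normed_vector \<Rightarrow> 'x) \<Rightarrow> 'x set \<Rightarrow> complex \<Rightarrow> 'x \<Rightarrow> 'x" where
  "resolvent A D l y = (THE x. x \<in> D \<and> l *\<^sub>C x - A x = y)"

definition inv_id_plus :: "('x::complex_normed_vector \<Rightarrow> 'x) \<Rightarrow> 'x set \<Rightarrow> 'x \<Rightarrow> 'x" where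
  "inv_id_plus A D y = (THE x. x \<in> D \<and> x + A x = y)"

definition sectorial_pos :: "real \<Rightarrow> ('x::complex_normed_vector \<Rightarrow> 'x) \<Rightarrow> 'x set \<Rightarrow> bool" where
  "sectorial_pos \<omega> A D \<longleftrightarrow> linear_closed_op A D \<and>
     spectrum_op A D \<subseteq> closure (sector \<omega>) \<and>
     closure (A ` D) = UNIV \<and>
     (\<forall>\<phi>\<in>{\<omega><..<pi}. \<exists>C. \<forall>l. l \<notin> closure (sector \<phi>) \<longrightarrow>
         (\<forall>y. norm (l *\<^sub>C resolvent A D l y) \<le> C * norm y))"

definition sectorial :: "real \<Rightarrow> ('x::complex_normed_vector \<Rightarrow> 'x) \<Rightarrow> 'x set \<Rightarrow> bool" where
  "sectorial \<omega> A D \<longleftrightarrow>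
     (if \<omega> = 0 then (\<forall>\<omega>'\<in>{0<..<pi}. sectorial_pos \<omega>' A D) else sectorial_pos \<omega> A D)"

definition invertible_op :: "('x::complex_normed_vector \<Rightarrow> 'x) \<Rightarrow> 'x set \<Rightarrow> bool" where
  "invertible_op A D \<longleftrightarrow> bij_betw A D UNIV \<and> (\<exists>C. \<forall>x\<in>D. norm x \<le> C * norm (A x))"

text \<open>\<open>\<psi>(A) x = (2\<pi>i)^{-1} \<integral>_{\<partial>S_{\<omega>'}} \<psi>(z) (z - A)^{-1} x dz\<close>, with \<open>\<omega>' = (\<omega>+\<phi>)/2\<close>,
  boundary oriented counterclockwise (from \<open>\<infinity> e^{i\<omega>'}\<close> to 0 to \<open>\<infinity> e^{-i\<omega>'}\<close>).\<close>
definition calc_H :: "real \<Rightarrow> real \<Rightarrow> ('x::{complex_normed_vector,banach} \<Rightarrow> 'x) \<Rightarrow> 'x set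
      \<Rightarrow> (complex \<Rightarrow> complex) \<Rightarrow> 'x \<Rightarrow> 'x" where
  "calc_H \<omega> \<phi> A D \<psi> x =
     (let w = cis ((\<omega> + \<phi>) / 2); wc = cis (- ((\<omega> + \<phi>) / 2)) in
      (1 / (2 * complex_of_real pi * \<i>)) *\<^sub>C
        (integral {0..} (\<lambda>r::real. (\<psi> (complex_of_real r * wc) * wc) *\<^sub>C resolvent A D (complex_of_real r * wc) x)
         - integral {0..} (\<lambda>r::real. (\<psi> (complex_of_real r * w) * w) *\<^sub>C resolvent A D (complex_of_real r * w) x)))"

definition calc_E :: "real \<Rightarrow> real \<Rightarrow> ('x::{complex_normed_vector,banach} \<Rightarrow> 'x) \<Rightarrow> 'x set
      \<Rightarrow> (complex \<Rightarrow> complex) \<Rightarrow> 'x \<Rightarrow> 'x" where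
  "calc_E \<omega> \<phi> A D f x = (THE y. \<exists>\<psi> c1 c2. holo_H \<phi> \<psi> \<and>
       (\<forall>z\<in>sector \<phi>. f z = \<psi> z + c1 + c2 / (1 + z)) \<and>
       y = calc_H \<omega> \<phi> A D \<psi> x + c1 *\<^sub>C x + c2 *\<^sub>C inv_id_plus A D x)"

text \<open>Fractional powers via the extended functional calculus: with the regulariser
  \<open>e_k(z) = (z/(1+z)^2)^k\<close>, \<open>k = \<lceil>|s|\<rceil> + 1\<close>, one has \<open>e_k, e_k z^s \<in> \<H>(S_\<pi>)\<close> and
  \<open>A^s = e_k(A)^{-1} (e_k z^s)(A)\<close>, \<open>D(A^s) = {x. (e_k z^s)(A) x \<in> ran e_k(A)}\<close>.\<close>
definition reg_k :: "real \<Rightarrow> nat" where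
  "reg_k s = nat \<lceil>\<bar>s\<bar>\<rceil> + 1"

definition reg_fun :: "nat \<Rightarrow> complex \<Rightarrow> complex" where
  "reg_fun k z = (z / (1 + z)^2) ^ k"

definition frac_pow_dom :: "real \<Rightarrow> ('x::{complex_normed_vector,banach} \<Rightarrow> 'x) \<Rightarrow> 'x set \<Rightarrow> real \<Rightarrow> 'x set" where
  "frac_pow_dom \<omega> A D s = {x. \<exists>y. calc_H \<omega> pi A D (reg_fun (reg_k s)) y =
        calc_H \<omega> pi A D (\<lambda>z. reg_fun (reg_k s) z * z powr complex_of_real s) x}"

definition frac_pow :: "real \<Rightarrow> ('x::{complex_normed_vector,banach} \<Rightarrow> 'x) \<Rightarrow> 'x set \<Rightarrow> real \<Rightarrow> 'x \<Rightarrow> 'x" where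
  "frac_pow \<omega> A D s x = (THE y. calc_H \<omega> pi A D (reg_fun (reg_k s)) y =
        calc_H \<omega> pi A D (\<lambda>z. reg_fun (reg_k s) z * z powr complex_of_real s) x)"

definition norm_on :: "'x::complex_normed_vector set \<Rightarrow> ('x \<Rightarrow> real) \<Rightarrow> bool" where
  "norm_on V nV \<longleftrightarrow> complex_subspace V \<and>
     (\<forall>x\<in>V. nV x \<ge> 0 \<and> (nV x = 0 \<longleftrightarrow> x = 0)) \<and>
     (\<forall>c. \<forall>x\<in>V. nV (c *\<^sub>C x) = cmod c * nV x) \<and>
     (\<forall>x\<in>V. \<forall>y\<in>V. nV (x + y) \<le> nV x + nV y)"

definition complete_on :: "'x::complex_normed_vector set \<Rightarrow> ('x \<Rightarrow> real) \<Rightarrow> bool" where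
  "complete_on V nV \<longleftrightarrow> (\<forall>xs. (\<forall>n. xs n \<in> V) \<and>
       (\<forall>e>0. \<exists>N. \<forall>m\<ge>N. \<forall>n\<ge>N. nV (xs m - xs n) < e) \<longrightarrow>
       (\<exists>x\<in>V. (\<lambda>n. nV (xs n - x)) \<longlonglongrightarrow> 0))"

definition open_in_norm :: "'x::complex_normed_vector set \<Rightarrow> ('x \<Rightarrow> real) \<Rightarrow> 'x set \<Rightarrow> bool" where
  "open_in_norm V nV W \<longleftrightarrow> W \<subseteq> V \<and> (\<forall>x\<in>W. \<exists>e>0. \<forall>z\<in>V. nV (z - x) < e \<longrightarrow> z \<in> W)"

end

theory Submission
  imports Defs "HOL-Complex_Analysis.Complex_Analysis" "HOL-Real_Asymp.Real_Asymp"
begin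

text \<open>Put \<open>x_t = f(tA) x\<^sup>\<dagger>\<close>. The source condition and the decay of \<open>z^{-(a+s)} (f(z) - 1)\<close> and \<open>z^s f(z)\<close>
  give \<open>\<parallel>A^{-a} (x_t - x\<^sup>\<dagger>)\<parallel> \<le> K t^{a+\<theta>}\<close>, \<open>\<parallel>A x_t\<parallel> \<le> K t^{\<theta>-1}\<close> and \<open>\<parallel>x_t - x\<^sup>\<dagger>\<parallel> \<le> K t^\<theta>\<close>. Choose
  \<open>t^{a+\<theta>}\<close> proportional to \<open>\<delta>\<close>, with a factor so small that the residual of \<open>x_t\<close> is at most
  \<open>C_DP \<delta>\<close>. Then minimality bounds \<open>\<parallel>A x^\<delta>\<parallel>\<close> by a multiple of \<open>\<parallel>A x_t\<parallel>\<close>, the discrepancy principle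
  bounds \<open>\<parallel>A^{-a} (x^\<delta> - x_t)\<parallel>\<close> by a multiple of \<open>\<delta>\<close>, and interpolation between these two norms
  estimates \<open>x^\<delta> - x_t\<close>.

  The functional calculus works on an arbitrary, possibly nonseparable Banach space. Contour
  integrals are improper Henstock-Kurzweil integrals along rays, and Cauchy's theorem takes the
  form that the ray may be rotated through a region of holomorphy; this needs neither Bochner
  integration nor the Hahn-Banach theorem.\<close>

subsection \<open>Improper integrals of Banach-valued functions\<close>

text \<open>As \<open>\<theta> < 1\<close>, \<open>xd\<close> need not lie in \<open>V\<close>, so
  the functional cannot be compared at the exact solution itself; its smoothed version stands in.
  With residual at most \<open>CDP * \<delta>\<close>, which is the residual of the minimiser, the
  data terms drop out of the minimality inequality and the positive parameter
  \<open>\<kappa>dp\<close> cancels, whatever its size. The factor is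
  \<open>(CDP - 1) / (CU * K)\<close>: the noise uses up one \<open>\<delta>\<close> of the budget,
  and \<open>CDP > 1\<close> leaves a positive rest. Interpolating at the same \<open>t\<close>
  balances the two terms, \<open>t * t^(\<theta>-1) = t^(-a) * t^(a+\<theta>) = t^\<theta>\<close>,
  and this power of \<open>\<delta>\<close> is the rate.

  On the operator side the difficulty is that the objects in the statement live on different
  contours and are given by \<open>THE\<close>: \<open>frac_pow\<close> as a quotient with
  half-angle \<open>(\<omega> + pi) / 2\<close>, \<open>calc_E\<close> through a decomposition of
  \<open>f\<close> and half-angle \<open>(\<omega> + \<phi>) / 2\<close>. Both are moved to one
  contour inside \<open>sector \<phi>\<close>. There \<open>\<phi> < pi\<close> keeps
  \<open>1 + z\<close> away from \<open>0\<close>, and products are computed in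
  \<open>holo_H\<close> alone.\<close>

lemma has_integral_Ioi_FTC:
  fixes F :: "real \<Rightarrow> 'a::banach"
  assumes F: "\<And>r. r > 0 \<Longrightarrow> (F has_vector_derivative f r) (at r)"
    and L0: "(F \<longlongrightarrow> L0) (at_right 0)" and L1: "(F \<longlongrightarrow> L1) at_top"
  shows "(f has_integral (L1 - L0)) {0<..}"
proof -
  \<comment> \<open>\<open>F\<close> is continued by its limit to the left of \<open>0\<close>, so
    that the integral from \<open>0\<close> is an ordinary one over a closed interval, with
    continuity at the end point.\<close>
  define G where "G r = (if r \<le> 0 then L0 else F r)" for r :: real
  have contF: "isCont F r" if "r > 0" for r
    using F[OF that] has_vector_derivative_continuous by blast
  have contG: "continuous_on {0..b} G" if "b > 0" for b
    unfolding continuous_on_def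
  proof
    fix x assume x: "x \<in> {0..b}"
    show "(G \<longlongrightarrow> G x) (at x within {0..b})"
    proof (cases "x = 0")
      case True
      have "(G \<longlongrightarrow> L0) (at_right 0)"
        by (rule tendsto_cong[THEN iffD1, OF _ L0])
           (auto simp: eventually_at_right_less G_def intro!: eventually_at_rightI[of 0 1])
      then have "(G \<longlongrightarrow> L0) (at 0 within {0..b})"
        using at_within_Icc_at_right[OF that] by simp
      then show ?thesis using True by (simp add: G_def)
    next
      case False
      then have "x > 0" using x by auto
      have "(F \<longlongrightarrow> F x) (at x)" using contF[OF \<open>x > 0\<close>] by (simp add: isCont_def)
      moreover have "eventually (\<lambda>y. F y = G y) (at x)"
        unfolding eventually_at by (rule exI[of _ x]) (use \<open>x > 0\<close> in \<open>auto simp: G_def dist_real_def\<close>)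
      ultimately have "(G \<longlongrightarrow> F x) (at x)" using tendsto_cong by fast
      then show ?thesis using \<open>x > 0\<close> by (auto simp: G_def intro: tendsto_within_subset)
    qed
  qed
  have int: "(f has_integral (F b - L0)) {0..b}" if "b > 0" for b
  proof -
    have "(f has_integral (G b - G 0)) {0..b}"
    proof (rule fundamental_theorem_of_calculus_interior[OF _ contG[OF that]])
      fix x assume "x \<in> {0<..<b}"
      then have "x > 0" by auto
      show "(G has_vector_derivative f x) (at x)"
        by (rule has_vector_derivative_transform_within_open[OF F[OF \<open>x > 0\<close>], of "{0<..}"])
           (use \<open>x > 0\<close> in \<open>auto simp: G_def\<close>)
    qed (use that in auto)
    then show ?thesis using that by (simp add: G_def)
  qed
  \<comment> \<open>For an unbounded domain the condition concerns all boxes that contain a large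
    ball. As the integrand is cut off at \<open>0\<close>, only the upper end \<open>b\<close> of
    the box matters.\<close>
  show ?thesis
    unfolding has_integral'[of f]
  proof (intro allI impI)
    fix e :: real assume "e > 0"
    then have "eventually (\<lambda>b. dist (F b) L1 < e) at_top" using L1 tendstoD by blast
    then obtain B0 where B0: "\<And>b. b \<ge> B0 \<Longrightarrow> dist (F b) L1 < e"
      by (auto simp: eventually_at_top_linorder)
    show "\<exists>B>0. \<forall>a b. ball 0 B \<subseteq> cbox a b \<longrightarrow>
      (\<exists>z. ((\<lambda>x. if x \<in> {0<..} then f x else 0) has_integral z) (cbox a b) \<and> norm (z - (L1 - L0)) < e)"
    proof (intro exI[of _ "max 1 B0"] conjI allI impI)
      fix a b :: real assume sub: "ball 0 (max 1 B0) \<subseteq> cbox a b"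
      then have "ball 0 (max 1 B0) \<subseteq> {a..b}" by simp
      then have "{- max 1 B0<..<max 1 B0} \<subseteq> {a..b}" by (simp add: ball_eq_greaterThanLessThan)
      then have ab: "a \<le> - max 1 B0" "max 1 B0 \<le> b"
        by (subst (asm) greaterThanLessThan_subseteq_atLeastAtMost_iff; simp)+
      then have b: "b > 0" "a \<le> 0" by auto
      have "((\<lambda>x. if x \<in> {0..b} then f x else 0) has_integral (F b - L0)) {a..b}"
        using int[OF b(1)] b by (subst has_integral_restrict) auto
      then have "((\<lambda>x. if x \<in> {0<..} then f x else 0) has_integral (F b - L0)) {a..b}"
        by (rule has_integral_spike_finite[of "{0}", rotated 2]) auto
      moreover have "norm (F b - L0 - (L1 - L0)) < e"
        using B0[of b] ab by (simp add: dist_norm)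
      ultimately show "\<exists>z. ((\<lambda>x. if x \<in> {0<..} then f x else 0) has_integral z) (cbox a b) \<and> norm (z - (L1 - L0)) < e"
        by auto
    qed auto
  qed
qed

text \<open>The majorant \<open>min (r^\<beta>) (r^{-\<beta>}) / r\<close> is below the derivative of \<open>(2/\<beta>) arctan (r^\<beta>)\<close>.\<close>

lemma min_powr_le:
  fixes s b :: real
  assumes "s > 0"
  shows "min (s powr b) (s powr - b) \<le> 2 * s powr b / (1 + (s powr b)\<^sup>2)"
proof -
  define u where "u = s powr b"
  have u: "u > 0" using assms by (simp add: u_def)
  have "min u (1/u) \<le> 2 * u / (1 + u\<^sup>2)"
  proof (cases "u \<le> 1")
    case True
    have "u * (1 + u\<^sup>2) \<le> u * 2" using u True by (intro mult_left_mono) (auto simp: power_le_one)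
    then have "u \<le> 2 * u / (1 + u\<^sup>2)" by (simp add: pos_le_divide_eq add_pos_nonneg mult.commute)
    then show ?thesis by linarith
  next
    case False
    then have "1 \<le> u\<^sup>2" by (simp add: one_le_power)
    then have "1 / u \<le> 2 * u / (1 + u\<^sup>2)" using u by (simp add: field_simps power2_eq_square add_pos_nonneg)
    then show ?thesis by linarith
  qed
  then show ?thesis by (simp add: u_def powr_minus_divide)
qed

lemma arctan_majorant:
  fixes b t :: real
  assumes "b > 0" "t > 0"
  defines "G \<equiv> \<lambda>r. (2 / b) * arctan ((t * r) powr b)"
  defines "g \<equiv> \<lambda>r. 2 * (t * r) powr b / (1 + ((t * r) powr b)\<^sup>2) / r"
  shows "\<And>r. r > 0 \<Longrightarrow> (G has_vector_derivative g r) (at r)"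
    and "(G \<longlongrightarrow> 0) (at_right 0)" and "(G \<longlongrightarrow> pi / b) at_top"
    and "(g has_integral pi / b) {0<..}"
proof -
  show 1: "(G has_vector_derivative g r) (at r)" if "r > 0" for r
  proof -
    define v where "v = (t * r) powr b"
    have "((\<lambda>r. (t * r) powr b) has_real_derivative b * v / r) (at r)"
      unfolding v_def using that assms(1,2)
      by (auto intro!: derivative_eq_intros simp: powr_diff field_simps)
    from DERIV_cmult[OF DERIV_chain2[OF DERIV_arctan this], of "2 / b"]
    have "(G has_real_derivative (2 / b) * (inverse (1 + v\<^sup>2) * (b * v / r))) (at r)"
      by (simp add: G_def v_def)
    moreover have "(2 / b) * (inverse (1 + v\<^sup>2) * (b * v / r)) = g r"
      using assms(1) by (simp add: g_def v_def field_simps)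
    ultimately show ?thesis by (simp add: has_real_derivative_iff_has_vector_derivative)
  qed
  show 2: "(G \<longlongrightarrow> 0) (at_right 0)" unfolding G_def using assms(1,2)
    by real_asymp
  show 3: "(G \<longlongrightarrow> pi / b) at_top" unfolding G_def using assms(1,2)
    by real_asymp
  show "(g has_integral pi / b) {0<..}"
    using has_integral_Ioi_FTC[OF 1 2 3] by simp
qed

text \<open>Differences of \<open>F\<close> are dominated by differences of \<open>K * G\<close>,
  with \<open>G\<close> the arctangent belonging to the majorant. As \<open>G\<close> has limits at
  both ends, \<open>F\<close> is Cauchy there and completeness supplies the limits. The scale
  \<open>t\<close> is carried along for bounds that are uniform in dilations.\<close>

lemma improper_antiderivative:
  fixes f :: "real \<Rightarrow> 'a::banach"
  assumes f: "continuous_on {0<..} f" and b: "b > 0" and t: "t > 0" and K: "K \<ge> 0"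
    and bound: "\<And>r. r > 0 \<Longrightarrow> norm (f r) \<le> K * min ((t * r) powr b) ((t * r) powr - b) / r"
  obtains F L0 L1 where "\<And>r. r > 0 \<Longrightarrow> (F has_vector_derivative f r) (at r)"
     "(F \<longlongrightarrow> L0) (at_right 0)" "(F \<longlongrightarrow> L1) at_top"
     "\<And>r s. 0 < r \<Longrightarrow> r \<le> s \<Longrightarrow> integral {r..s} f = F s - F r" 
proof -
  define G where "G = (\<lambda>r. (2 / b) * arctan ((t * r) powr b))"
  define g where "g = (\<lambda>r. 2 * (t * r) powr b / (1 + ((t * r) powr b)\<^sup>2) / r)"
  have G: "\<And>r. r > 0 \<Longrightarrow> (G has_vector_derivative g r) (at r)"
    "(G \<longlongrightarrow> 0) (at_right 0)" "(G \<longlongrightarrow> pi / b) at_top"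
    using arctan_majorant[OF b t] by (simp_all add: G_def g_def)
  have fg: "norm (f r) \<le> K * g r" if "r > 0" for r
  proof -
    have "norm (f r) \<le> K * min ((t * r) powr b) ((t * r) powr - b) / r" by (rule bound[OF that])
    also have "\<dots> \<le> K * (2 * (t * r) powr b / (1 + ((t * r) powr b)\<^sup>2)) / r"
      using min_powr_le[of "t * r" b] that t K by (intro divide_right_mono mult_left_mono) auto
    finally show ?thesis by (simp add: g_def)
  qed
  define F where "F x = (if x \<ge> 1 then integral {1..x} f else - integral {x..1} f)" for x
  have intf: "f integrable_on {r..s}" if "0 < r" for r s
    by (rule integrable_continuous_real[OF continuous_on_subset[OF f]]) (use that in auto)
  have Fdiff: "integral {r..s} f = F s - F r" if "0 < r" "r \<le> s" for r s
  proof -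
    have c: "integral {u..v} f + integral {v..w} f = integral {u..w} f" if "0 < u" "u \<le> v" "v \<le> w" for u v w
      using Henstock_Kurzweil_Integration.integral_combine[OF that(2,3) intf[OF that(1)]] .
    consider "1 \<le> r" | "r < 1" "1 \<le> s" | "s < 1" by linarith
    then show ?thesis
    proof cases
      case 1 then show ?thesis using c[of 1 r s] that by (auto simp: F_def algebra_simps)
    next
      case 2 then show ?thesis using c[of r 1 s] that by (auto simp: F_def algebra_simps)
    next
      case 3 then show ?thesis using c[of r s 1] that by (auto simp: F_def algebra_simps)
    qed
  qed
  have Fder: "(F has_vector_derivative f r) (at r)" if "r > 0" for r
  proof -
    have "((\<lambda>x. integral {r/2..x} f) has_vector_derivative f r) (at r within {r/2..r+1})"
      by (rule integral_has_vector_derivative[OF continuous_on_subset[OF f]]) (use that in auto)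
    then have "((\<lambda>x. integral {r/2..x} f) has_vector_derivative f r) (at r)"
      using that by (subst (asm) at_within_Icc_at) auto
    then have "((\<lambda>x. integral {r/2..x} f + F (r/2)) has_vector_derivative f r) (at r)"
      by (auto intro!: derivative_eq_intros)
    then show ?thesis
      by (rule has_vector_derivative_transform_within_open[of _ _ _ "{r/2<..}"])
         (use that Fdiff[of "r/2"] in auto)
  qed
  have FG: "norm (F s - F r) \<le> K * (G s - G r)" if "0 < r" "r \<le> s" for r s
  proof -
    have "(g has_integral G s - G r) {r..s}"
      by (rule fundamental_theorem_of_calculus[OF that(2)])
         (rule has_vector_derivative_at_within[OF G(1)], use that in auto)
    then have "((\<lambda>x. K * g x) has_integral K * (G s - G r)) {r..s}" by (rule has_integral_mult_right)
    moreover have "norm (integral {r..s} f) \<le> integral {r..s} (\<lambda>x. K * g x)"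
      by (rule integral_norm_bound_integral) (use calculation intf fg that in auto)
    ultimately show ?thesis using Fdiff[OF that] integral_unique by metis
  qed
  have FG': "dist (F s) (F r) \<le> K * dist (G s) (G r)" if "0 < r" "0 < s" for r s
  proof (cases "r \<le> s")
    case True then show ?thesis using FG[of r s] that K mult_left_mono[OF abs_ge_self, of K "G s - G r"] by (simp add: dist_norm dist_real_def) 
  next
    case False then show ?thesis using FG[of s r] that K mult_left_mono[OF abs_ge_self, of K "G r - G s"] 
      by (simp add: dist_norm norm_minus_commute[of "F s"] abs_minus_commute[of "G s"])
  qed
  have lim: "\<exists>L. (F \<longlongrightarrow> L) fl" if GL: "(G \<longlongrightarrow> l) fl" and pos: "eventually (\<lambda>r. r > 0) fl" and ne: "fl \<noteq> bot" for l fl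
  proof -
    have "cauchy_filter (filtermap F fl)"
      unfolding cauchy_filter_metric
    proof (intro allI impI)
      fix e :: real assume "e > 0"
      \<comment> \<open>\<open>K + 1\<close> instead of \<open>K\<close> covers \<open>K = 0\<close>
        and makes the final inequality strict.\<close>
      define d where "d = e / (2 * (K + 1))"
      have "d > 0" using \<open>e > 0\<close> K by (simp add: d_def)
      then have ev: "eventually (\<lambda>r. r > 0 \<and> dist (G r) l < d) fl" using tendstoD[OF GL] pos eventually_conj by blast
      have "dist (F s) (F r) < e" if "r > 0 \<and> dist (G r) l < d" "s > 0 \<and> dist (G s) l < d" for r s
      proof -
        have "dist (G s) (G r) \<le> 2 * d" using that dist_triangle3[of "G s" "G r" l] by (simp add: dist_commute)
        then have "dist (F s) (F r) \<le> K * (2 * d)"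
          using FG'[of r s] that K mult_left_mono by (meson order_trans)
        also have "\<dots> < (K + 1) * (2 * d)" using \<open>d > 0\<close> by simp
        also have "\<dots> = e" using K by (simp add: d_def divide_simps)
        finally show ?thesis .
      qed
      then show "\<exists>P. eventually P (filtermap F fl) \<and> (\<forall>x y. P x \<and> P y \<longrightarrow> dist x y < e)"
        using ev by (intro exI[of _ "\<lambda>x. \<exists>r. x = F r \<and> r > 0 \<and> dist (G r) l < d"])
          (auto simp: eventually_filtermap elim: eventually_mono)
    qed
    then have "convergent_filter (filtermap F fl)"
      using cauchy_filter_convergent ne by (metis filtermap_bot_iff)
    then show ?thesis by (auto simp: convergent_filter_iff filterlim_def)
  qed
  obtain L0 where "(F \<longlongrightarrow> L0) (at_right 0)"
    using lim[OF G(2)] eventually_at_right_less[of "0::real"] by auto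
  moreover obtain L1 where "(F \<longlongrightarrow> L1) at_top"
    using lim[OF G(3)] eventually_gt_at_top[of "0::real"] by auto
  ultimately show ?thesis using that Fder Fdiff by blast
qed

text \<open>The bound \<open>K * (pi / b)\<close> is free of \<open>t\<close>; every estimate for
  \<open>f(tA)\<close> that is uniform in \<open>t\<close> originates here. The reciprocal
  truncations serve the rotation of rays, the substitution rule the passage from \<open>tA\<close>
  to \<open>A\<close>.\<close>

lemma improper_integral:
  fixes f :: "real \<Rightarrow> 'a::banach"
  assumes f: "continuous_on {0<..} f" and b: "b > 0" and t: "t > 0" and K: "K \<ge> 0"
    and bound: "\<And>r. r > 0 \<Longrightarrow> norm (f r) \<le> K * min ((t * r) powr b) ((t * r) powr - b) / r"
  shows "f integrable_on {0<..}"
    and "norm (integral {0<..} f) \<le> K * (pi / b)"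
    and "(\<lambda>n. integral {1 / real (Suc n)..real (Suc n)} f) \<longlonglongrightarrow> integral {0<..} f"
    and "\<And>s. s > 0 \<Longrightarrow> integral {0<..} (\<lambda>r. s *\<^sub>R f (s * r)) = integral {0<..} f"
proof -
  obtain F L0 L1 where F: "\<And>r. r > 0 \<Longrightarrow> (F has_vector_derivative f r) (at r)"
     "(F \<longlongrightarrow> L0) (at_right 0)" "(F \<longlongrightarrow> L1) at_top"
     "\<And>r s. 0 < r \<Longrightarrow> r \<le> s \<Longrightarrow> integral {r..s} f = F s - F r" 
    using improper_antiderivative[OF assms] by metis
  have int: "(f has_integral (L1 - L0)) {0<..}" by (rule has_integral_Ioi_FTC[OF F(1,2,3)])
  then show "f integrable_on {0<..}" by blast
  have "((\<lambda>r. K * (2 * (t * r) powr b / (1 + ((t * r) powr b)\<^sup>2) / r)) has_integral K * (pi / b)) {0<..}"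
    by (rule has_integral_mult_right[OF arctan_majorant(4)[OF b t]])
  moreover have "norm (f r) \<le> K * (2 * (t * r) powr b / (1 + ((t * r) powr b)\<^sup>2) / r)" if "r > 0" for r
  proof -
    have "norm (f r) \<le> K * min ((t * r) powr b) ((t * r) powr - b) / r" by (rule bound[OF that])
    also have "\<dots> \<le> K * (2 * (t * r) powr b / (1 + ((t * r) powr b)\<^sup>2)) / r"
      using min_powr_le[of "t * r" b] that t K by (intro divide_right_mono mult_left_mono) auto
    finally show ?thesis by simp
  qed
  ultimately show "norm (integral {0<..} f) \<le> K * (pi / b)"
    using integral_norm_bound_integral[of f "{0<..}" "(\<lambda>r. K * (2 * (t * r) powr b / (1 + ((t * r) powr b)\<^sup>2) / r))"] int
    by (metis (no_types, lifting) greaterThan_iff has_integral_integrable integral_unique)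
  have "(\<lambda>n. F (real (Suc n)) - F (1 / real (Suc n))) \<longlonglongrightarrow> L1 - L0"
  proof (intro tendsto_diff)
    show "(\<lambda>n. F (real (Suc n))) \<longlonglongrightarrow> L1"
      by (rule filterlim_compose[OF F(3)]) (rule filterlim_compose[OF filterlim_real_sequentially filterlim_Suc])
    have "filterlim (\<lambda>n. 1 / real (Suc n)) (at_right 0) sequentially" by real_asymp
    then show "(\<lambda>n. F (1 / real (Suc n))) \<longlonglongrightarrow> L0" by (rule filterlim_compose[OF F(2)])
  qed
  moreover have "integral {1 / real (Suc n)..real (Suc n)} f = F (real (Suc n)) - F (1 / real (Suc n))" for n
    by (rule F(4)) (auto simp: field_simps)
  ultimately show "(\<lambda>n. integral {1 / real (Suc n)..real (Suc n)} f) \<longlonglongrightarrow> integral {0<..} f"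
    using integral_unique[OF int] by simp
  fix s :: real assume s: "s > 0"
  have "((\<lambda>r. s *\<^sub>R f (s * r)) has_integral (L1 - L0)) {0<..}"
  proof (rule has_integral_Ioi_FTC[of "\<lambda>r. F (s * r)"])
    fix r :: real assume "r > 0"
    have "((F \<circ> (\<lambda>r. s * r)) has_vector_derivative s *\<^sub>R f (s * r)) (at r)"
      by (rule vector_diff_chain_at) (use F(1)[of "s * r"] s \<open>r > 0\<close> in \<open>auto intro!: derivative_eq_intros\<close>)
    then show "((\<lambda>r. F (s * r)) has_vector_derivative s *\<^sub>R f (s * r)) (at r)" by (simp add: o_def)
  next
    have "filterlim (\<lambda>r. s * r) (at_right 0) (at_right 0)" using s by real_asymp
    then show "((\<lambda>r. F (s * r)) \<longlongrightarrow> L0) (at_right 0)" by (rule filterlim_compose[OF F(2)])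
    have "filterlim (\<lambda>r. s * r) at_top at_top" using s by real_asymp
    then show "((\<lambda>r. F (s * r)) \<longlongrightarrow> L1) at_top" by (rule filterlim_compose[OF F(3)])
  qed
  then show "integral {0<..} (\<lambda>r. s *\<^sub>R f (s * r)) = integral {0<..} f"
    using int integral_unique by metis
qed

subsection \<open>Vector-valued holomorphic functions and integrals along rays\<close>

lemma bounded_bilinear_scaleC:
  "bounded_bilinear (scaleC :: complex \<Rightarrow> 'x::complex_normed_vector \<Rightarrow> 'x)"
proof
  fix a b :: complex and x y :: 'x and r :: real
  show "(a + b) *\<^sub>C x = a *\<^sub>C x + b *\<^sub>C x" by (rule scaleC_add_left)
  show "a *\<^sub>C (x + y) = a *\<^sub>C x + a *\<^sub>C y" by (rule scaleC_add_right)
  show "(r *\<^sub>R a) *\<^sub>C x = r *\<^sub>R (a *\<^sub>C x)"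
    by (simp add: scaleR_scaleC scaleC_scaleC scaleR_conv_of_real)
  show "a *\<^sub>C (r *\<^sub>R x) = r *\<^sub>R (a *\<^sub>C x)"
    by (simp add: scaleR_scaleC scaleC_scaleC mult.commute)
  show "\<exists>K. \<forall>a (x::'x). norm (a *\<^sub>C x) \<le> norm a * norm x * K"
    by (rule exI[of _ 1]) (simp add: norm_scaleC)
qed

interpretation scaleC: bounded_bilinear "scaleC :: complex \<Rightarrow> 'x::complex_normed_vector \<Rightarrow> 'x"
  by (rule bounded_bilinear_scaleC)

lemmas scaleC_simps [simp] = scaleC.zero_left scaleC.zero_right scaleC_one
lemmas scaleC_algebra = scaleC_add_right scaleC_add_left scaleC.diff_right scaleC.diff_left
  scaleC.minus_right scaleC.minus_left scaleC_scaleC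

lemma scaleC_cancel_left:
  "c \<noteq> 0 \<Longrightarrow> c *\<^sub>C x = c *\<^sub>C (y::'x::complex_normed_vector) \<longleftrightarrow> x = y"
  by (metis scaleC_scaleC scaleC_one left_inverse)

text \<open>Continuity of the derivative is part of the definition instead of a consequence:
  rotating a ray differentiates under the integral sign, and the functions that occur (resolvents,
  Cauchy transforms, scalar multiples) have explicit derivatives. Complex differentiability appears
  as a real derivative that is multiplication of a vector by the complex increment.\<close>

definition vholo :: "complex set \<Rightarrow> (complex \<Rightarrow> 'x::complex_normed_vector) \<Rightarrow> bool" where
  "vholo S h \<longleftrightarrow> (\<exists>h'. continuous_on S h' \<and> (\<forall>z\<in>S. (h has_derivative (\<lambda>w. w *\<^sub>C h' z)) (at z)))"

lemma vholoI:
  assumes "continuous_on S h'" "\<And>z. z \<in> S \<Longrightarrow> (h has_derivative (\<lambda>w. w *\<^sub>C h' z)) (at z)"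
  shows "vholo S h"
  using assms by (auto simp: vholo_def)

lemma vholo_continuous: "vholo S h \<Longrightarrow> continuous_on S h"
  unfolding vholo_def
  by (meson continuous_at_imp_continuous_on has_derivative_continuous)

lemma vholo_subset: "vholo S h \<Longrightarrow> T \<subseteq> S \<Longrightarrow> vholo T h"
  unfolding vholo_def by (meson continuous_on_subset subsetD)

lemma vholo_const: "vholo S (\<lambda>z. x)"
  by (rule vholoI[of _ "\<lambda>_. 0"]) auto

lemma vholo_add:
  assumes "vholo S g" "vholo S h" shows "vholo S (\<lambda>z. g z + h z)"
proof -
  obtain g' h' where "continuous_on S g'" "\<And>z. z \<in> S \<Longrightarrow> (g has_derivative (\<lambda>w. w *\<^sub>C g' z)) (at z)"
    "continuous_on S h'" "\<And>z. z \<in> S \<Longrightarrow> (h has_derivative (\<lambda>w. w *\<^sub>C h' z)) (at z)"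
    using assms unfolding vholo_def by metis
  then show ?thesis
    by (intro vholoI[of _ "\<lambda>z. g' z + h' z"]) (auto intro!: continuous_intros derivative_eq_intros simp: scaleC_algebra)
qed

text \<open>The product rule; on an open set the derivative of a scalar holomorphic function is
  again holomorphic, which supplies the continuity demanded by \<open>vholo\<close>.\<close>

lemma vholo_scaleC:
  assumes "f holomorphic_on S" "open S" "vholo S h" shows "vholo S (\<lambda>z. f z *\<^sub>C h z)"
proof -
  obtain h' where h': "continuous_on S h'" "\<And>z. z \<in> S \<Longrightarrow> (h has_derivative (\<lambda>w. w *\<^sub>C h' z)) (at z)"
    using assms unfolding vholo_def by metis
  have f': "(f has_derivative (\<lambda>w. w * deriv f z)) (at z)" if "z \<in> S" for z
    using holomorphic_derivI[OF assms(1,2) that] by (simp add: has_field_derivative_def mult_commute_abs)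
  show ?thesis
  proof (rule vholoI[of _ "\<lambda>z. deriv f z *\<^sub>C h z + f z *\<^sub>C h' z"])
    show "continuous_on S (\<lambda>z. deriv f z *\<^sub>C h z + f z *\<^sub>C h' z)"
      using assms h' holomorphic_deriv[OF assms(1,2)] vholo_continuous[OF assms(3)]
      by (intro continuous_intros scaleC.continuous_on holomorphic_on_imp_continuous_on)
    show "((\<lambda>z. f z *\<^sub>C h z) has_derivative (\<lambda>w. w *\<^sub>C (deriv f z *\<^sub>C h z + f z *\<^sub>C h' z))) (at z)" if "z \<in> S" for z
      using scaleC.FDERIV[OF f'[OF that] h'(2)[OF that]]
      by (simp add: scaleC_algebra add.commute mult.commute)
  qed
qed

lemma vholo_uminus: "vholo S h \<Longrightarrow> open S \<Longrightarrow> vholo S (\<lambda>z. - h z)"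
  using vholo_scaleC[of "\<lambda>_. -1" S h] by (simp add: scaleC_algebra)

lemma vholo_diff: "vholo S g \<Longrightarrow> vholo S h \<Longrightarrow> open S \<Longrightarrow> vholo S (\<lambda>z. g z - h z)"
  using vholo_add[of S g "\<lambda>z. - h z"] vholo_uminus by auto

section \<open>Decay conditions on integrands\<close>

lemma min_powr_antimono:
  fixes r b c :: real
  assumes "r > 0" "0 \<le> b" "b \<le> c"
  shows "min (r powr c) (r powr - c) \<le> min (r powr b) (r powr - b)"
proof (cases "r \<le> 1")
  case True
  then have "r powr c \<le> r powr b" "r powr b \<le> r powr - b"
    using assms by (auto intro!: powr_mono')
  then show ?thesis by (auto simp: min_def)
next
  case False
  then have "r powr - c \<le> r powr - b" "r powr - b \<le> r powr b"
    using assms by (auto intro!: powr_mono)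
  then show ?thesis by (auto simp: min_def)
qed

text \<open>The quotient by \<open>cmod z\<close> is the size of a resolvent on a ray outside the
  sector, the numerator is the bound in \<open>holo_H\<close>. With respect to \<open>dr / r\<close>
  the majorant is a pure power at both ends, hence integrable along every ray.\<close>

definition decays :: "complex set \<Rightarrow> (complex \<Rightarrow> 'a::real_normed_vector) \<Rightarrow> bool" where
  "decays T h \<longleftrightarrow> (\<exists>K b. K \<ge> 0 \<and> b > 0 \<and>
     (\<forall>z\<in>T. norm (h z) \<le> K * min (cmod z powr b) (cmod z powr - b) / cmod z))"

lemma decaysI:
  assumes "b > 0" "\<And>z. z \<in> T \<Longrightarrow> norm (h z) \<le> K * min (cmod z powr b) (cmod z powr - b) / cmod z"
  shows "decays T h"
  unfolding decays_def
proof (rule exI[of _ "\<bar>K\<bar>"], rule exI[of _ b], intro conjI ballI)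
  fix z assume "z \<in> T"
  have "K * min (cmod z powr b) (cmod z powr - b) / cmod z \<le> \<bar>K\<bar> * min (cmod z powr b) (cmod z powr - b) / cmod z"
    by (intro divide_right_mono mult_right_mono) auto
  then show "norm (h z) \<le> \<bar>K\<bar> * min (cmod z powr b) (cmod z powr - b) / cmod z"
    using assms(2)[OF \<open>z \<in> T\<close>] by linarith
qed (use assms in auto)

lemma decays_subset: "decays T h \<Longrightarrow> T' \<subseteq> T \<Longrightarrow> decays T' h"
  unfolding decays_def by blast

lemma decays_bound:
  assumes "decays T h" "\<And>z. z \<in> T \<Longrightarrow> norm (g z) \<le> C * norm (h z)"
  shows "decays T g"
proof -
  obtain K b where Kb: "b > 0" "\<And>z. z \<in> T \<Longrightarrow> norm (h z) \<le> K * min (cmod z powr b) (cmod z powr - b) / cmod z"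
    using assms(1) unfolding decays_def by blast
  show ?thesis
  proof (rule decaysI[OF Kb(1), of _ _ "\<bar>C\<bar> * K"])
    fix z assume z: "z \<in> T"
    have "norm (g z) \<le> \<bar>C\<bar> * norm (h z)"
      using assms(2)[OF z] mult_right_mono[OF abs_ge_self, of "norm (h z)" C] by auto
    also have "\<dots> \<le> \<bar>C\<bar> * (K * min (cmod z powr b) (cmod z powr - b) / cmod z)"
      by (intro mult_left_mono Kb z) auto
    finally show "norm (g z) \<le> \<bar>C\<bar> * K * min (cmod z powr b) (cmod z powr - b) / cmod z" by simp
  qed
qed

lemma decays_add:
  fixes g h :: "complex \<Rightarrow> 'a::real_normed_vector"
  assumes "decays T g" "decays T h" "0 \<notin> T"
  shows "decays T (\<lambda>z. g z + h z)"
proof -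
  obtain K b where Kb: "K \<ge> 0" "b > 0" "\<And>z. z \<in> T \<Longrightarrow> norm (h z) \<le> K * min (cmod z powr b) (cmod z powr - b) / cmod z"
    using assms(2) unfolding decays_def by blast
  obtain L c where Lc: "L \<ge> 0" "c > 0" "\<And>z. z \<in> T \<Longrightarrow> norm (g z) \<le> L * min (cmod z powr c) (cmod z powr - c) / cmod z"
    using assms(1) unfolding decays_def by blast
  define d where "d = min b c"
  show ?thesis
  proof (rule decaysI[of d _ _ "K + L"])
    fix z assume z: "z \<in> T"
    then have "cmod z > 0" using assms(3) by auto
    then have "K * min (cmod z powr b) (cmod z powr - b) / cmod z \<le> K * min (cmod z powr d) (cmod z powr - d) / cmod z"
      "L * min (cmod z powr c) (cmod z powr - c) / cmod z \<le> L * min (cmod z powr d) (cmod z powr - d) / cmod z"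
      using Kb Lc by (intro divide_right_mono mult_left_mono min_powr_antimono; simp add: d_def)+
    then have "norm (h z) \<le> K * min (cmod z powr d) (cmod z powr - d) / cmod z"
      "norm (g z) \<le> L * min (cmod z powr d) (cmod z powr - d) / cmod z"
      using Kb(3)[OF z] Lc(3)[OF z] by linarith+
    then show "norm (g z + h z) \<le> (K + L) * min (cmod z powr d) (cmod z powr - d) / cmod z"
      using norm_triangle_ineq[of "g z" "h z"] by (simp add: distrib_right add_divide_distrib)
  qed (use Kb Lc in \<open>simp add: d_def\<close>)
qed

lemma decays_uminus: "decays T g \<Longrightarrow> decays T (\<lambda>z. - g z)"
  by (simp add: decays_def)

lemma decays_diff:
  fixes g h :: "complex \<Rightarrow> 'a::real_normed_vector"
  assumes "decays T g" "decays T h" "0 \<notin> T"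
  shows "decays T (\<lambda>z. g z - h z)"
  using decays_add[OF assms(1) decays_uminus[OF assms(2)] assms(3)] by simp

text \<open>Near \<open>0\<close> boundedness is enough, since \<open>1 <= r^(d-1)\<close> for
  \<open>r <= 1\<close> once \<open>d <= 1\<close>; hence \<open>d = min b 1\<close>. Between
  \<open>1\<close> and \<open>M\<close> the factor \<open>M^(1+d)\<close> inside \<open>K\<close>
  makes up for the smallness of \<open>r^(-d-1)\<close>.\<close>

lemma decays_from_bounds:
  assumes b: "b > 0" and C: "\<And>z. z \<in> T \<Longrightarrow> norm (h z) \<le> C"
    and N: "\<And>z. z \<in> T \<Longrightarrow> cmod z \<ge> N \<Longrightarrow> norm (h z) \<le> D * cmod z powr (- 1 - b)"
    and T: "0 \<notin> T"
  shows "decays T h"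
proof -
  define d where "d = min b 1"
  define M where "M = max N 1"
  define K where "K = max (\<bar>C\<bar> * M powr (1 + d)) \<bar>D\<bar>"
  show ?thesis
  proof (rule decaysI[of d _ _ K])
    fix z assume z: "z \<in> T"
    define r where "r = cmod z"
    have r: "r > 0" using z T by (auto simp: r_def)
    have d: "0 < d" "d \<le> 1" "d \<le> b" using b by (auto simp: d_def)
    have M: "M \<ge> 1" "M \<ge> N" by (auto simp: M_def)
    have K: "K \<ge> 0" "K \<ge> \<bar>D\<bar>" "K \<ge> \<bar>C\<bar> * M powr (1 + d)" by (auto simp: K_def)
    have M1: "M powr (1 + d) \<ge> 1" using M d by (simp add: ge_one_powr_ge_zero)
    have eq: "min (r powr d) (r powr - d) / r = (if r \<le> 1 then r powr (d - 1) else r powr (- d - 1))"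
    proof (cases "r \<le> 1")
      case True
      then have "r powr d \<le> r powr - d" using r d by (intro powr_mono') auto
      then show ?thesis using True r by (simp add: powr_diff)
    next
      case False
      then have "r powr - d \<le> r powr d" using r d by (intro powr_mono) auto
      then show ?thesis using False r by (simp add: powr_diff)
    qed
    have "norm (h z) \<le> K * (min (r powr d) (r powr - d) / r)"
    proof -
      consider "r \<le> 1" | "r > 1" "r \<ge> M" | "r > 1" "r < M" by linarith
      then show ?thesis
      proof cases
        case 1
        have "r powr (d - 1) \<ge> r powr 0" using 1 r d by (intro powr_mono') auto
        then have "1 \<le> r powr (d - 1)" using r by simp
        have "norm (h z) \<le> \<bar>C\<bar> * 1" using C[OF z] by simp
        also have "\<dots> \<le> \<bar>C\<bar> * M powr (1 + d)" by (intro mult_left_mono M1) auto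
        also have "\<dots> \<le> K * 1" using K by simp
        also have "\<dots> \<le> K * r powr (d - 1)" by (intro mult_left_mono K) fact
        finally show ?thesis using 1 eq by simp
      next
        case 2
        have "norm (h z) \<le> D * r powr (- 1 - b)" using N[OF z] 2 M by (simp add: r_def)
        also have "\<dots> \<le> \<bar>D\<bar> * r powr (- 1 - b)" by (intro mult_right_mono) auto
        also have "\<dots> \<le> K * r powr (- d - 1)" using 2 d K by (intro mult_mono powr_mono) auto
        finally show ?thesis using 2 eq by simp
      next
        case 3
        have "norm (h z) \<le> \<bar>C\<bar>" using C[OF z] by simp
        also have "\<dots> = \<bar>C\<bar> * M powr (1 + d) * M powr (- d - 1)" using M by (simp add: powr_diff powr_add powr_minus divide_simps)
        also have "\<dots> \<le> K * r powr (- d - 1)" using 3 d K by (intro mult_mono powr_mono2') auto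
        finally show ?thesis using 3 eq by simp
      qed
    qed
    then show "norm (h z) \<le> K * min (cmod z powr d) (cmod z powr - d) / cmod z" by (simp add: r_def)
  qed (use b in \<open>simp add: d_def\<close>)
qed

section \<open>Integrals along rays from the origin\<close>

definition rayset :: "real \<Rightarrow> complex set" where
  "rayset \<alpha> = (\<lambda>r. complex_of_real r * cis \<alpha>) ` {0<..}"

text \<open>The contour integral of \<open>h(z) dz\<close> from \<open>0\<close> outwards:
  \<open>cis \<alpha>\<close> is \<open>dz/dr\<close>. Up to the factor \<open>1 / (2 pi i)\<close>,
  \<open>calc_H\<close> is a difference of two of these.\<close>

definition ray :: "real \<Rightarrow> (complex \<Rightarrow> 'x::{complex_normed_vector,banach}) \<Rightarrow> 'x" where
  "ray \<alpha> h = integral {0<..} (\<lambda>r. cis \<alpha> *\<^sub>C h (complex_of_real r * cis \<alpha>))"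

lemma raysetI [simp, intro]: "r > 0 \<Longrightarrow> complex_of_real r * cis \<alpha> \<in> rayset \<alpha>"
  by (auto simp: rayset_def)

lemma zero_notin_rayset [simp]: "0 \<notin> rayset \<alpha>"
  by (auto simp: rayset_def)

lemma ray_cong:
  assumes "\<And>z. z \<in> rayset \<alpha> \<Longrightarrow> g z = h z" shows "ray \<alpha> g = ray \<alpha> h"
  unfolding ray_def by (rule integral_cong) (use assms in auto)

lemma ray_continuous:
  fixes h :: "complex \<Rightarrow> 'x::complex_normed_vector"
  assumes "continuous_on (rayset \<alpha>) h"
  shows "continuous_on {0<..} (\<lambda>r. cis \<alpha> *\<^sub>C h (complex_of_real r * cis \<alpha>))"
proof -
  have "continuous_on {0<..} (\<lambda>r. complex_of_real r * cis \<alpha>)" by (intro continuous_intros)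
  from continuous_on_compose2[OF assms this]
  have "continuous_on {0<..} (\<lambda>r. h (complex_of_real r * cis \<alpha>))" by auto
  then show ?thesis by (rule scaleC.continuous_on[OF continuous_on_const])
qed

lemma ray_bounds:
  fixes h :: "complex \<Rightarrow> 'x::{complex_normed_vector,banach}"
  assumes h: "continuous_on (rayset \<alpha>) h" "K \<ge> 0" "b > 0" "t > 0"
    "\<And>z. z \<in> rayset \<alpha> \<Longrightarrow> norm (h z) \<le> K * min ((t * cmod z) powr b) ((t * cmod z) powr - b) / cmod z"
  shows "norm (ray \<alpha> h) \<le> K * (pi / b)" 
    and "(\<lambda>r. cis \<alpha> *\<^sub>C h (complex_of_real r * cis \<alpha>)) integrable_on {0<..}"
    and "(\<lambda>n. integral {1 / real (Suc n)..real (Suc n)} (\<lambda>r. cis \<alpha> *\<^sub>C h (complex_of_real r * cis \<alpha>)))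
           \<longlonglongrightarrow> ray \<alpha> h"
    and "\<And>s. s > 0 \<Longrightarrow> ray \<alpha> (\<lambda>z. complex_of_real s *\<^sub>C h (complex_of_real s * z)) = ray \<alpha> h"
proof -
  have b: "norm (cis \<alpha> *\<^sub>C h (complex_of_real r * cis \<alpha>)) \<le> K * min ((t * r) powr b) ((t * r) powr - b) / r" if "r > 0" for r
    using h(5)[of "complex_of_real r * cis \<alpha>"] that by (simp add: norm_scaleC norm_mult)
  note * = improper_integral[OF ray_continuous[OF h(1)] h(3,4,2) b]
  show "norm (ray \<alpha> h) \<le> K * (pi / b)" 
    "(\<lambda>r. cis \<alpha> *\<^sub>C h (complex_of_real r * cis \<alpha>)) integrable_on {0<..}"
    "(\<lambda>n. integral {1 / real (Suc n)..real (Suc n)} (\<lambda>r. cis \<alpha> *\<^sub>C h (complex_of_real r * cis \<alpha>)))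
           \<longlonglongrightarrow> ray \<alpha> h"
    using *(1-3) by (simp_all add: ray_def)
  fix s :: real assume "s > 0"
  from *(4)[OF _ this] show "ray \<alpha> (\<lambda>z. complex_of_real s *\<^sub>C h (complex_of_real s * z)) = ray \<alpha> h"
    by (simp add: ray_def scaleR_scaleC scaleC_scaleC mult.commute mult.left_commute)
qed

text \<open>Continuity with decay is chosen over mere integrability because it is preserved by
  bounded continuous multipliers and by bounded operators.\<close>

definition ray_ok :: "real \<Rightarrow> (complex \<Rightarrow> 'x::complex_normed_vector) \<Rightarrow> bool" where
  "ray_ok \<alpha> h \<longleftrightarrow> continuous_on (rayset \<alpha>) h \<and> decays (rayset \<alpha>) h"

lemma ray_ok_D:
  fixes h :: "complex \<Rightarrow> 'x::{complex_normed_vector,banach}"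
  assumes "ray_ok \<alpha> h"
  shows "(\<lambda>r. cis \<alpha> *\<^sub>C h (complex_of_real r * cis \<alpha>)) integrable_on {0<..}"
    and "(\<lambda>n. integral {1 / real (Suc n)..real (Suc n)} (\<lambda>r. cis \<alpha> *\<^sub>C h (complex_of_real r * cis \<alpha>)))
           \<longlonglongrightarrow> ray \<alpha> h"
    and "\<And>s. s > 0 \<Longrightarrow> ray \<alpha> (\<lambda>z. complex_of_real s *\<^sub>C h (complex_of_real s * z)) = ray \<alpha> h"
proof -
  obtain K b where "K \<ge> 0" "b > 0" "\<And>z. z \<in> rayset \<alpha> \<Longrightarrow> norm (h z) \<le> K * min ((1 * cmod z) powr b) ((1 * cmod z) powr - b) / cmod z"
    using assms unfolding ray_ok_def decays_def by auto
  note * = ray_bounds[OF _ this(1,2) zero_less_one this(3)]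
  show "(\<lambda>r. cis \<alpha> *\<^sub>C h (complex_of_real r * cis \<alpha>)) integrable_on {0<..}"
    "(\<lambda>n. integral {1 / real (Suc n)..real (Suc n)} (\<lambda>r. cis \<alpha> *\<^sub>C h (complex_of_real r * cis \<alpha>)))
           \<longlonglongrightarrow> ray \<alpha> h"
    "\<And>s. s > 0 \<Longrightarrow> ray \<alpha> (\<lambda>z. complex_of_real s *\<^sub>C h (complex_of_real s * z)) = ray \<alpha> h"
    using *(2-4) assms by (auto simp: ray_ok_def)
qed

lemma ray_ok_add: "ray_ok \<alpha> g \<Longrightarrow> ray_ok \<alpha> h \<Longrightarrow> ray_ok \<alpha> (\<lambda>z. g z + h z)"
  by (auto simp: ray_ok_def intro!: continuous_intros decays_add)

lemma ray_ok_diff: "ray_ok \<alpha> g \<Longrightarrow> ray_ok \<alpha> h \<Longrightarrow> ray_ok \<alpha> (\<lambda>z. g z - h z)"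
  by (auto simp: ray_ok_def intro!: continuous_intros decays_diff)

lemma ray_ok_linear:
  assumes "ray_ok \<alpha> h" "bounded_linear B" shows "ray_ok \<alpha> (\<lambda>z. B (h z))"
proof -
  obtain K where "\<And>x. norm (B x) \<le> K * norm x"
    using bounded_linear.bounded[OF assms(2)] by (auto simp: mult.commute)
  then show ?thesis using assms
    by (auto simp: ray_ok_def intro!: bounded_linear.continuous_on[OF assms(2)] decays_bound[of _ h _ K])
qed

lemma ray_ok_vholo: "vholo S h \<Longrightarrow> rayset \<alpha> \<subseteq> T \<Longrightarrow> T \<subseteq> S \<Longrightarrow> decays T h \<Longrightarrow> ray_ok \<alpha> h"
  unfolding ray_ok_def by (meson continuous_on_subset decays_subset vholo_continuous)

lemma ray_add: "ray_ok \<alpha> g \<Longrightarrow> ray_ok \<alpha> h \<Longrightarrow> ray \<alpha> (\<lambda>z. g z + h z) = ray \<alpha> g + ray \<alpha> h"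
  using integral_add[OF ray_ok_D(1)[of \<alpha> g] ray_ok_D(1)[of \<alpha> h]] by (simp add: ray_def scaleC_algebra)

lemma ray_diff: "ray_ok \<alpha> g \<Longrightarrow> ray_ok \<alpha> h \<Longrightarrow> ray \<alpha> (\<lambda>z. g z - h z) = ray \<alpha> g - ray \<alpha> h"
  using integral_diff[OF ray_ok_D(1)[of \<alpha> g] ray_ok_D(1)[of \<alpha> h]] by (simp add: ray_def scaleC_algebra)

lemma ray_linear:
  fixes h :: "complex \<Rightarrow> 'x::{complex_normed_vector,banach}" and B :: "'x \<Rightarrow> 'x"
  assumes "ray_ok \<alpha> h" "bounded_linear B" "\<And>c x. B (c *\<^sub>C x) = c *\<^sub>C B x"
  shows "ray \<alpha> (\<lambda>z. B (h z)) = B (ray \<alpha> h)"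
  using integral_linear[OF ray_ok_D(1)[OF assms(1)] assms(2)] by (simp add: ray_def o_def assms(3))

lemma bounded_linear_scaleC_const: "bounded_linear (\<lambda>x::'x::complex_normed_vector. c *\<^sub>C x)"
  by (rule scaleC.bounded_linear_right)

lemma ray_scaleC: "ray_ok \<alpha> h \<Longrightarrow> ray \<alpha> (\<lambda>z. c *\<^sub>C h z) = c *\<^sub>C ray \<alpha> h"
  by (rule ray_linear) (auto simp: bounded_linear_scaleC_const scaleC_scaleC mult.commute)

text \<open>Differentiating the truncated integral in the angle leaves
  only boundary terms, because
  \<open>\<partial>/\<partial>\<alpha> (e^{i\<alpha>} h (r e^{i\<alpha>})) = i e^{i\<alpha>} \<partial>/\<partial>r (r h (r e^{i\<alpha>}))\<close>.\<close>

lemma ray_rotate: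
  fixes h :: "complex \<Rightarrow> 'x::{complex_normed_vector,banach}"
  assumes h: "vholo S h" and T: "\<And>r a. r > 0 \<Longrightarrow> a1 \<le> a \<Longrightarrow> a \<le> a2 \<Longrightarrow> complex_of_real r * cis a \<in> T"
    and TS: "T \<subseteq> S" and dec: "decays T h" and a12: "a1 \<le> a2"
  shows "ray a1 h = ray a2 h"
proof -
  obtain h' where h': "continuous_on S h'" "\<And>z. z \<in> S \<Longrightarrow> (h has_derivative (\<lambda>w. w *\<^sub>C h' z)) (at z)"
    using h unfolding vholo_def by metis
  have ch: "continuous_on S h" using h by (rule vholo_continuous)
  obtain K b where K: "K \<ge> 0" "b > 0" 
    and Kb: "\<And>z. z \<in> T \<Longrightarrow> norm (h z) \<le> K * min (cmod z powr b) (cmod z powr - b) / cmod z"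
    using dec unfolding decays_def by auto
  define w where "w a r = complex_of_real r * cis a" for a r
  have wT: "w a r \<in> T" if "r > 0" "a \<in> {a1..a2}" for a r using T that by (auto simp: w_def)
  then have wS: "w a r \<in> S" if "r > 0" "a \<in> {a1..a2}" for a r using TS that by auto
  define J where "J n a = integral {1 / real (Suc n)..real (Suc n)} (\<lambda>r. cis a *\<^sub>C h (w a r))" for n a
  \<comment> \<open>The boundary terms sit at \<open>r = N\<close> and at
    \<open>r = e = 1/N\<close>; by the decay condition each is at most \<open>K * N^(-b)\<close>.
    The mean value inequality in the angle then bounds the change of the truncated integral by a
    quantity that vanishes as \<open>N\<close> grows.\<close>
  have bd: "norm (J n a2 - J n a1) \<le> 2 * K * (real (Suc n) powr - b) * \<bar>a2 - a1\<bar>" for n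
  proof -
    define e N where "e = 1 / real (Suc n)" and "N = real (Suc n)"
    have eN: "0 < e" "e \<le> N" "1 \<le> N" by (auto simp: e_def N_def field_simps)
    define fx where "fx a r = (\<i> * cis a) *\<^sub>C (h (w a r) + w a r *\<^sub>C h' (w a r))" for a r
    have Je: "J n = (\<lambda>a. integral (cbox e N) (\<lambda>r. cis a *\<^sub>C h (w a r)))"
      by (simp add: J_def[abs_def] e_def N_def)
    have der: "(J n has_vector_derivative integral (cbox e N) (fx a)) (at a within {a1..a2})" if a: "a \<in> {a1..a2}" for a
      unfolding Je
    proof (rule leibniz_rule_vector_derivative)
      fix x t assume x: "x \<in> {a1..a2}" and t: "t \<in> cbox e N"
      then have "w x t \<in> S" using eN wS by auto
      have "((\<lambda>x. w x t) has_derivative (\<lambda>y. complex_of_real y * (\<i> * w x t))) (at x within {a1..a2})"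
        using has_derivative_cis[of "\<lambda>x. x" "\<lambda>x. x" x "{a1..a2}"] unfolding w_def
        by (auto intro!: derivative_eq_intros simp: scaleR_conv_of_real mult_ac)
      from has_derivative_compose[OF this h'(2)[OF \<open>w x t \<in> S\<close>]]
      have "((\<lambda>x. h (w x t)) has_derivative (\<lambda>y. (complex_of_real y * (\<i> * w x t)) *\<^sub>C h' (w x t))) (at x within {a1..a2})" .
      moreover have "((\<lambda>x. cis x) has_derivative (\<lambda>y. complex_of_real y * (\<i> * cis x))) (at x within {a1..a2})"
        using has_derivative_cis[of "\<lambda>x. x" "\<lambda>x. x" x "{a1..a2}"]
        by (auto simp: scaleR_conv_of_real)
      ultimately have "((\<lambda>x. cis x *\<^sub>C h (w x t)) has_derivative
         (\<lambda>y. cis x *\<^sub>C ((complex_of_real y * (\<i> * w x t)) *\<^sub>C h' (w x t)) + (complex_of_real y * (\<i> * cis x)) *\<^sub>C h (w x t)))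
         (at x within {a1..a2})"
        by (intro scaleC.FDERIV)
      then show "((\<lambda>x. cis x *\<^sub>C h (w x t)) has_vector_derivative fx x t) (at x within {a1..a2})"
        unfolding has_vector_derivative_def fx_def
        by (simp add: scaleR_scaleC scaleC_algebra mult_ac add_ac)
    next
      fix x assume x: "x \<in> {a1..a2}"
      have "continuous_on {e..N} (\<lambda>r. cis x *\<^sub>C h (w x r))"
        by (intro scaleC.continuous_on continuous_intros continuous_on_compose2[OF ch])
           (use eN wS x in \<open>auto simp: w_def intro!: continuous_intros\<close>)
      then show "(\<lambda>r. cis x *\<^sub>C h (w x r)) integrable_on cbox e N"
        by (simp add: integrable_continuous_real)
    next
      have w: "continuous_on ({a1..a2} \<times> {e..N}) (\<lambda>p. w (fst p) (snd p))"
        unfolding w_def by (intro continuous_intros continuous_on_cis)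
      show "continuous_on ({a1..a2} \<times> cbox e N) (\<lambda>(x, t). fx x t)"
        unfolding fx_def split_beta cbox_interval
        by (intro scaleC.continuous_on continuous_intros continuous_on_cis
              continuous_on_compose2[OF ch w] continuous_on_compose2[OF h'(1) w] w) (use eN wS in auto)
    qed (use a in auto)
    have val: "integral (cbox e N) (fx a) = (\<i> * cis a) *\<^sub>C (N *\<^sub>R h (w a N) - e *\<^sub>R h (w a e))" if a: "a \<in> {a1..a2}" for a
    proof -
      have "((\<lambda>r. h (w a r) + w a r *\<^sub>C h' (w a r)) has_integral (N *\<^sub>R h (w a N) - e *\<^sub>R h (w a e))) {e..N}"
      proof (rule fundamental_theorem_of_calculus)
        fix r assume r: "r \<in> {e..N}"
        then have "w a r \<in> S" using eN wS a by auto
        have "((\<lambda>r. w a r) has_derivative (\<lambda>y. complex_of_real y * cis a)) (at r within {e..N})"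
          unfolding w_def by (auto intro!: derivative_eq_intros)
        from has_derivative_compose[OF this h'(2)[OF \<open>w a r \<in> S\<close>]]
        have "((\<lambda>r. h (w a r)) has_derivative (\<lambda>y. (complex_of_real y * cis a) *\<^sub>C h' (w a r))) (at r within {e..N})" .
        then have "((\<lambda>r. r *\<^sub>R h (w a r)) has_derivative (\<lambda>y. r *\<^sub>R ((complex_of_real y * cis a) *\<^sub>C h' (w a r)) + y *\<^sub>R h (w a r))) (at r within {e..N})"
          by (auto intro!: derivative_eq_intros)
        then show "((\<lambda>r. r *\<^sub>R h (w a r)) has_vector_derivative h (w a r) + w a r *\<^sub>C h' (w a r)) (at r within {e..N})"
          unfolding has_vector_derivative_def 
          by (simp add: scaleR_scaleC scaleC_algebra mult_ac add_ac w_def)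
      qed (use eN in auto)
      from has_integral_linear[OF this bounded_linear_scaleC_const[of "\<i> * cis a"]]
      show ?thesis by (simp add: fx_def[abs_def] o_def integral_unique)
    qed
    have nb: "norm (integral (cbox e N) (fx a)) \<le> 2 * K * (N powr - b)" if a: "a \<in> {a1..a2}" for a
    proof -
      have 1: "norm (N *\<^sub>R h (w a N)) \<le> K * N powr - b"
      proof -
        have "norm (N *\<^sub>R h (w a N)) \<le> N * (K * min (N powr b) (N powr - b) / N)"
          using mult_left_mono[OF Kb[OF wT[of N a]], of N] a eN by (simp add: w_def norm_mult)
        also have "\<dots> = K * min (N powr b) (N powr - b)" using eN by simp
        also have "\<dots> \<le> K * N powr - b" using K by (intro mult_left_mono) auto
        finally show ?thesis .
      qed
      have 2: "norm (e *\<^sub>R h (w a e)) \<le> K * N powr - b"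
      proof -
        have "norm (e *\<^sub>R h (w a e)) \<le> e * (K * min (e powr b) (e powr - b) / e)"
          using mult_left_mono[OF Kb[OF wT[of e a]], of e] a eN by (simp add: w_def norm_mult)
        also have "\<dots> = K * min (e powr b) (e powr - b)" using eN by simp
        also have "\<dots> \<le> K * e powr b" using K by (intro mult_left_mono) auto
        also have "e powr b = N powr - b" using eN unfolding e_def N_def by (simp add: powr_minus_divide powr_divide)
        finally show ?thesis .
      qed
      show ?thesis unfolding val[OF a] using norm_triangle_ineq4[of "N *\<^sub>R h (w a N)" "e *\<^sub>R h (w a e)"] 1 2
        by (simp add: norm_scaleC norm_mult)
    qed
    have "norm (J n a2 - J n a1) \<le> 2 * K * (N powr - b) * norm (a2 - a1)"
    proof (rule differentiable_bound)
      show "convex {a1..a2}" by simp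
      show "(J n has_derivative (\<lambda>y. y *\<^sub>R integral (cbox e N) (fx a))) (at a within {a1..a2})" if "a \<in> {a1..a2}" for a
        using der[OF that] by (simp add: has_vector_derivative_def)
      show "onorm (\<lambda>y. y *\<^sub>R integral (cbox e N) (fx a)) \<le> 2 * K * (N powr - b)" if "a \<in> {a1..a2}" for a
        by (rule onorm_le) (use nb[OF that] in \<open>simp add: mult.commute[of "2 * K * _"] mult_left_mono\<close>)
    qed (use a12 in auto)
    then show ?thesis by (simp add: N_def)
  qed
  have ok: "ray_ok a h" if "a \<in> {a1..a2}" for a
    by (rule ray_ok_vholo[OF h _ TS dec]) (use that T in \<open>auto simp: rayset_def\<close>)
  have lim: "(\<lambda>n. J n a) \<longlonglongrightarrow> ray a h" if "a \<in> {a1..a2}" for a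
    using ray_ok_D(2)[OF ok[OF that]] by (simp add: J_def w_def)
  have "(\<lambda>n. J n a2 - J n a1) \<longlonglongrightarrow> ray a2 h - ray a1 h"
    using lim a12 by (intro tendsto_diff) auto
  moreover have "(\<lambda>n. J n a2 - J n a1) \<longlonglongrightarrow> 0"
  proof (rule Lim_null_comparison[OF always_eventually[OF allI[OF bd]]])
    show "(\<lambda>n. 2 * K * real (Suc n) powr - b * \<bar>a2 - a1\<bar>) \<longlonglongrightarrow> 0" 
    proof -
      have "(\<lambda>n. real (Suc n) powr - b) \<longlonglongrightarrow> 0" using K(2) by real_asymp
      then have "(\<lambda>n. (2 * K) * real (Suc n) powr - b * \<bar>a2 - a1\<bar>) \<longlonglongrightarrow> (2 * K) * 0 * \<bar>a2 - a1\<bar>" by (intro tendsto_intros)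
      then show ?thesis by simp
    qed
  qed
  ultimately show ?thesis using LIMSEQ_unique by fastforce
qed

subsection \<open>Cauchy theorems for sectors\<close>

text \<open>All these sets exclude \<open>0\<close>, where \<open>Arg\<close> has only a default
  value and the decay majorants divide by zero. Conditions on the absolute value of
  \<open>Arg\<close> count the negative half-line as angle \<open>pi\<close>, so the two outer sets
  extend across the cut.\<close>

definition closed_sector :: "real \<Rightarrow> complex set" where "closed_sector \<alpha> = {z. z \<noteq> 0 \<and> \<bar>Arg z\<bar> \<le> \<alpha>}"
definition outer :: "real \<Rightarrow> complex set" where "outer \<alpha> = {z. z \<noteq> 0 \<and> \<alpha> < \<bar>Arg z\<bar>}"
definition outerc :: "real \<Rightarrow> complex set" where "outerc \<alpha> = {z. z \<noteq> 0 \<and> \<alpha> \<le> \<bar>Arg z\<bar>}"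

lemma mem_sector: "\<phi> > 0 \<Longrightarrow> z \<in> sector \<phi> \<longleftrightarrow> z \<noteq> 0 \<and> \<bar>Arg z\<bar> < \<phi>"
  by (simp add: sector_def)

lemma Arg_bound: "\<bar>Arg z\<bar> \<le> pi"
  using mpi_less_Arg[of z] Arg_le_pi[of z] by linarith

lemma Arg_cis' [simp]: "-pi < a \<Longrightarrow> a \<le> pi \<Longrightarrow> Arg (cis a) = a"
  by (simp add: Arg_cis)

lemma polar_eq: "z = complex_of_real (cmod z) * cis (Arg z)"
  using rcis_cmod_Arg[of z] by (simp add: rcis_def)

lemma cis_mpi [simp]: "cis (- pi) = -1"
  by (simp add: complex_eq_iff)

lemma polar_in_sector: "r > 0 \<Longrightarrow> \<bar>a\<bar> < \<phi> \<Longrightarrow> \<phi> \<le> pi \<Longrightarrow> complex_of_real r * cis a \<in> sector \<phi>"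
  by (simp add: mem_sector)

lemma polar_in_closed_sector: "r > 0 \<Longrightarrow> \<bar>a\<bar> \<le> \<phi> \<Longrightarrow> \<phi> < pi \<Longrightarrow> complex_of_real r * cis a \<in> closed_sector \<phi>"
  by (simp add: closed_sector_def)

lemma polar_in_outerc: "r > 0 \<Longrightarrow> \<alpha> \<le> \<bar>a\<bar> \<Longrightarrow> \<bar>a\<bar> \<le> pi \<Longrightarrow> complex_of_real r * cis a \<in> outerc \<alpha>"
proof -
  assume a: "r > 0" "\<alpha> \<le> \<bar>a\<bar>" "\<bar>a\<bar> \<le> pi"
  show ?thesis
  \<comment> \<open>\<open>Arg\<close> is never \<open>-pi\<close>: on the ray of angle
    \<open>-pi\<close> it takes the value \<open>pi\<close>.\<close>
  proof (cases "a = - pi")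
    case True
    have "Arg (- complex_of_real r) = pi" using a Arg_of_real[of "-r"] by simp
    then show ?thesis using a True by (simp add: outerc_def)
  next
    case False then show ?thesis using a by (simp add: outerc_def)
  qed
qed

lemma open_sector:
  assumes "0 < \<phi>" "\<phi> \<le> pi" shows "open (sector \<phi>)"
proof -
  have "sector \<phi> = - \<real>\<^sub>\<le>\<^sub>0 \<inter> Arg -` {- \<phi><..<\<phi>}"
    using assms by (auto simp: mem_sector nonpos_Reals_def Arg_real complex_is_Real_iff abs_less_iff elim!: nonpos_Reals_cases)
  moreover have "open (- \<real>\<^sub>\<le>\<^sub>0 \<inter> Arg -` {- \<phi><..<\<phi>})"
    by (rule continuous_open_preimage[OF continuous_on_Arg]) (auto simp: open_Compl)
  ultimately show ?thesis by simp
qed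

text \<open>Point reflection sends the absolute value of \<open>Arg\<close> to \<open>pi\<close>
  minus itself and moves the negative half-line, where \<open>Arg\<close> jumps, to the positive
  one. Openness of outer sets thus follows from openness of sectors.\<close>

lemma outer_eq: "0 \<le> \<omega> \<Longrightarrow> \<omega> < pi \<Longrightarrow> outer \<omega> = uminus -` sector (pi - \<omega>)"
proof -
  assume \<omega>: "0 \<le> \<omega>" "\<omega> < pi"
  have "\<bar>Arg (- z)\<bar> = pi - \<bar>Arg z\<bar>" if "z \<noteq> 0" for z
    using mpi_less_Arg[of z] Arg_le_pi[of z] that by (auto simp: Arg_minus)
  then show ?thesis using \<omega> by (auto simp: outer_def mem_sector)
qed

lemma open_outer:
  assumes "0 \<le> \<omega>" "\<omega> < pi" shows "open (outer \<omega>)"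
  unfolding outer_eq[OF assms]
  by (rule continuous_open_vimage) (use assms in \<open>auto intro!: open_sector continuous_intros\<close>)

lemma closure_sector_outer:
  assumes "0 < \<phi>" "\<phi> < pi" "z \<in> outer \<phi>" shows "z \<notin> closure (sector \<phi>)"
proof -
  have "outer \<phi> \<inter> sector \<phi> = {}" using assms by (auto simp: outer_def mem_sector)
  then have "outer \<phi> \<inter> closure (sector \<phi>) = {}"
    using open_Int_closure_eq_empty[OF open_outer] assms by simp
  then show ?thesis using assms by auto
qed

text \<open>The squared distance is \<open>sin^2 * (r+s)^2 + cos^2 * (r-s)^2\<close>, both functions
  taken at half the angle difference.\<close>

lemma cmod_polar_diff:
  assumes "r \<ge> 0" "s \<ge> 0"
  shows "\<bar>sin ((a - b) / 2)\<bar> * (r + s) \<le> cmod (complex_of_real r * cis a - complex_of_real s * cis b)"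
proof (rule power2_le_imp_le)
  have "cos (a - b) = 1 - 2 * (sin ((a - b) / 2))\<^sup>2"
  proof -
    have "2 * ((a - b) / 2) = a - b" by simp
    then show ?thesis using cos_double_sin[of "(a - b) / 2"] by metis
  qed
  then have c: "cos a * cos b + sin a * sin b = 1 - 2 * (sin ((a - b) / 2))\<^sup>2"
    by (simp add: cos_diff)
  have "(cmod (complex_of_real r * cis a - complex_of_real s * cis b))\<^sup>2
      = (r * cos a - s * cos b)\<^sup>2 + (r * sin a - s * sin b)\<^sup>2"
    by (simp add: cmod_power2)
  also have "\<dots> = r\<^sup>2 * ((cos a)\<^sup>2 + (sin a)\<^sup>2) + s\<^sup>2 * ((cos b)\<^sup>2 + (sin b)\<^sup>2) - 2 * r * s * (cos a * cos b + sin a * sin b)"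
    by algebra
  also have "\<dots> = (r - s)\<^sup>2 + 4 * r * s * (sin ((a - b) / 2))\<^sup>2"
    unfolding c by (simp only: sin_cos_squared_add2) algebra
  also have "\<dots> = (sin ((a - b) / 2))\<^sup>2 * (r + s)\<^sup>2 + (r - s)\<^sup>2 * (1 - (sin ((a - b) / 2))\<^sup>2)"
    by (simp add: algebra_simps power2_eq_square)
  also have "\<dots> \<ge> (sin ((a - b) / 2))\<^sup>2 * (r + s)\<^sup>2"
    by (simp add: abs_square_le_1)
  finally show "(\<bar>sin ((a - b) / 2)\<bar> * (r + s))\<^sup>2 \<le> (cmod (complex_of_real r * cis a - complex_of_real s * cis b))\<^sup>2"
    by (simp add: power_mult_distrib)
qed simp

lemma sin_ge_min:
  assumes "0 < p" "p \<le> x" "x \<le> q" "q < pi"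
  shows "min (sin p) (sin q) \<le> sin x"
proof (cases "x \<le> pi / 2")
  case True
  then have "sin p \<le> sin x" using assms by (intro sin_monotone_2pi_le) auto
  then show ?thesis by simp
next
  case False
  then have "sin (pi - q) \<le> sin (pi - x)" using assms by (intro sin_monotone_2pi_le) auto
  then show ?thesis by simp
qed

text \<open>Half the absolute difference of the arguments lies between
  \<open>(\<beta> - \<alpha>) / 2\<close> and \<open>(pi + \<alpha>) / 2\<close>, both inside
  \<open>(0, pi)\<close>, and there \<open>sin\<close> is bounded below by its end values. For
  \<open>\<beta> > pi\<close> no \<open>w\<close> is admissible. As the gap is linear in both
  moduli, it controls kernels \<open>1 / (w - z)\<close> at \<open>0\<close> and at infinity
  alike.\<close>

lemma angle_gap:
  assumes "0 \<le> \<alpha>" "\<alpha> < \<beta>" "\<alpha> < pi"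
  obtains c where "c > 0" "\<And>z w. \<bar>Arg z\<bar> \<le> \<alpha> \<Longrightarrow> \<beta> \<le> \<bar>Arg w\<bar> \<Longrightarrow> c * (cmod w + cmod z) \<le> cmod (w - z)"
proof -
  define c where "c = min (sin ((\<beta> - \<alpha>) / 2)) (sin ((pi + \<alpha>) / 2))"
  show ?thesis
  proof (cases "\<beta> \<le> pi")
    case False then show ?thesis using that[of 1] Arg_bound by (metis order_trans zero_less_one)
  next
    case True
    have c: "c > 0" using assms True by (auto simp: c_def intro!: sin_gt_zero)
    moreover have "c * (cmod w + cmod z) \<le> cmod (w - z)" if "\<bar>Arg z\<bar> \<le> \<alpha>" "\<beta> \<le> \<bar>Arg w\<bar>" for z w
    proof -
      define g where "g = Arg w - Arg z"
      have g: "\<beta> - \<alpha> \<le> \<bar>g\<bar>" "\<bar>g\<bar> \<le> pi + \<alpha>" using that Arg_bound[of w] by (auto simp: g_def)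
      have "c \<le> sin (\<bar>g\<bar> / 2)" unfolding c_def by (rule sin_ge_min) (use assms g in auto)
      also have "\<dots> = \<bar>sin (g / 2)\<bar>"
      proof -
        have "sin (\<bar>g\<bar> / 2) \<ge> 0" using \<open>c \<le> sin (\<bar>g\<bar> / 2)\<close> c by linarith
        then show ?thesis by (cases "g \<ge> 0") (auto simp: abs_if)
      qed
      finally have "c * (cmod w + cmod z) \<le> \<bar>sin (g / 2)\<bar> * (cmod w + cmod z)" by (intro mult_right_mono) auto
      also have "\<dots> \<le> cmod (w - z)"
        using cmod_polar_diff[of "cmod w" "cmod z" "Arg w" "Arg z"] polar_eq[of w] polar_eq[of z] by (simp add: g_def)
      finally show ?thesis .
    qed
    ultimately show ?thesis using that by blast
  qed
qed

text \<open>The lower ray is turned into the upper one through the positive half-line.\<close>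

lemma inner_cauchy:
  assumes "vholo (sector \<beta>) h" "0 \<le> \<alpha>" "\<alpha> < \<beta>" "\<beta> \<le> pi" "decays (closed_sector \<alpha>) h"
  shows "ray (-\<alpha>) h = ray \<alpha> h"
  by (rule ray_rotate[OF assms(1) _ _ assms(5)]) (use assms in \<open>auto simp: polar_in_closed_sector closed_sector_def mem_sector\<close>)

text \<open>Both rays are turned to the negative half-line, where the angles \<open>pi\<close> and
  \<open>-pi\<close> describe the same ray.\<close>

lemma outer_cauchy:
  assumes "vholo S h" "outerc \<alpha> \<subseteq> S" "0 \<le> \<alpha>" "\<alpha> \<le> pi" "decays (outerc \<alpha>) h"
  shows "ray (-\<alpha>) h = ray \<alpha> h"
proof -
  have "ray \<alpha> h = ray pi h"
    by (rule ray_rotate[OF assms(1) _ assms(2,5)]) (use assms in \<open>auto intro!: polar_in_outerc\<close>)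
  moreover have "ray (-pi) h = ray (-\<alpha>) h"
    by (rule ray_rotate[OF assms(1) _ assms(2,5)]) (use assms in \<open>auto intro!: polar_in_outerc\<close>)
  moreover have "ray (-pi) h = ray pi h" by (simp add: ray_def)
  ultimately show ?thesis by simp
qed

text \<open>Cutting \<open>h\<close> off outside each set turns the union into a sum, where the two
  exponents are already reconciled.\<close>

lemma decays_Un:
  fixes h :: "complex \<Rightarrow> 'a::real_normed_vector"
  assumes "decays T h" "decays T' h" "0 \<notin> T \<union> T'"
  shows "decays (T \<union> T') h"
proof -
  have 1: "decays (T \<union> T') (\<lambda>z. if z \<in> T then h z else 0)"
    using assms(1) unfolding decays_def by (elim exE) (rule exI, rule exI, auto)
  have 2: "decays (T \<union> T') (\<lambda>z. if z \<in> T then 0 else h z)"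
    using assms(2) unfolding decays_def by (elim exE) (rule exI, rule exI, auto)
  show ?thesis
    by (rule decays_bound[OF decays_add[OF 1 2 assms(3)], of _ 1]) auto
qed

lemma decays_quadratic:
  assumes "p > 0" "q > 0" "\<And>z. z \<in> T \<Longrightarrow> norm (h z) \<le> C / ((cmod z + p) * (cmod z + q))" "0 \<notin> T"
  shows "decays T h"
proof (rule decays_from_bounds[of 1 _ _ "\<bar>C\<bar> / (p * q)" 1 "\<bar>C\<bar>"])
  fix z assume z: "z \<in> T"
  then have r: "cmod z > 0" using assms(4) by auto
  have pq: "cmod z + p > 0" "cmod z + q > 0" using r assms by linarith+
  have 1: "norm (h z) \<le> \<bar>C\<bar> / ((cmod z + p) * (cmod z + q))"
    using assms(3)[OF z] by (rule order_trans) (use assms r in \<open>intro divide_right_mono mult_nonneg_nonneg, auto\<close>)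
  also have "\<dots> \<le> \<bar>C\<bar> / (p * q)"
    using assms r pq by (intro divide_left_mono mult_mono mult_pos_pos) auto
  finally show "norm (h z) \<le> \<bar>C\<bar> / (p * q)" .
  have "\<bar>C\<bar> / ((cmod z + p) * (cmod z + q)) \<le> \<bar>C\<bar> / (cmod z * cmod z)"
    using assms r pq by (intro divide_left_mono mult_mono mult_pos_pos) auto
  then show "norm (h z) \<le> \<bar>C\<bar> * cmod z powr (- 1 - 1)"
    using 1 r by (simp add: powr_minus_divide power2_eq_square)
qed (use assms in auto)

text \<open>The constant \<open>L\<close> is fixed by \<open>k\<close> before the multiplier is
  chosen, so a family of kernels depending on \<open>z\<close> can be estimated by suprema on the
  ray.\<close>

lemma ray_ok_mult:
  fixes k :: "complex \<Rightarrow> 'x::{complex_normed_vector,banach}"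
  assumes k: "ray_ok b k"
  obtains L where "L \<ge> 0" 
    "\<And>m M. continuous_on (rayset b) m \<Longrightarrow> (\<And>w. w \<in> rayset b \<Longrightarrow> cmod (m w) \<le> M) \<Longrightarrow>
       ray_ok b (\<lambda>w. m w *\<^sub>C k w) \<and> norm (ray b (\<lambda>w. m w *\<^sub>C k w)) \<le> M * L"
proof -
  obtain K \<beta> where K: "K \<ge> 0" "\<beta> > 0" "\<And>z. z \<in> rayset b \<Longrightarrow> norm (k z) \<le> K * min ((1 * cmod z) powr \<beta>) ((1 * cmod z) powr - \<beta>) / cmod z"
    using k unfolding ray_ok_def decays_def by auto
  have "ray_ok b (\<lambda>w. m w *\<^sub>C k w) \<and> norm (ray b (\<lambda>w. m w *\<^sub>C k w)) \<le> M * (K * (pi / \<beta>))"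
    if m: "continuous_on (rayset b) m" and M: "\<And>w. w \<in> rayset b \<Longrightarrow> cmod (m w) \<le> M" for m M
  proof -
    have "M \<ge> 0" using M[OF raysetI[OF zero_less_one]] norm_ge_zero order_trans by blast
    have cont: "continuous_on (rayset b) (\<lambda>w. m w *\<^sub>C k w)" 
      using m k by (intro scaleC.continuous_on) (auto simp: ray_ok_def)
    have le: "norm (m z *\<^sub>C k z) \<le> (M * K) * min ((1 * cmod z) powr \<beta>) ((1 * cmod z) powr - \<beta>) / cmod z" if "z \<in> rayset b" for z
      using mult_mono[OF M[OF that] K(3)[OF that] \<open>M \<ge> 0\<close>] by (simp add: norm_scaleC mult.assoc)
    have "ray_ok b (\<lambda>w. m w *\<^sub>C k w)"
      using cont decaysI[OF K(2), of "rayset b" "\<lambda>w. m w *\<^sub>C k w" "M * K"] le by (simp add: ray_ok_def)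
    moreover have "norm (ray b (\<lambda>w. m w *\<^sub>C k w)) \<le> M * K * (pi / \<beta>)"
      by (rule ray_bounds(1)[OF cont _ K(2) zero_less_one le]) (use K \<open>M \<ge> 0\<close> in auto)
    ultimately show ?thesis by simp
  qed
  moreover have "K * (pi / \<beta>) \<ge> 0" using K by simp
  ultimately show ?thesis using that by blast
qed

section \<open>Cauchy transforms of ray integrands\<close>

lemma rayset_Arg: "-pi < b \<Longrightarrow> b \<le> pi \<Longrightarrow> w \<in> rayset b \<Longrightarrow> w \<noteq> 0 \<and> Arg w = b"
  by (auto simp: rayset_def)

text \<open>A quadratic remainder and a Lipschitz derivative are what explicit kernels deliver: for
  \<open>1 / (w - z)\<close> and for resolvents the remainders have a closed form.\<close>

lemma vholo_local:
  fixes h :: "complex \<Rightarrow> 'x::complex_normed_vector"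
  assumes loc: "\<And>z0. z0 \<in> S \<Longrightarrow> \<exists>d>0. \<exists>C. \<forall>z. cmod (z - z0) < d \<longrightarrow>
       norm (h z - h z0 - (z - z0) *\<^sub>C h' z0) \<le> C * (cmod (z - z0))\<^sup>2 \<and> norm (h' z - h' z0) \<le> C * cmod (z - z0)"
  shows "vholo S h"
proof (rule vholoI[of _ h'])
  have loc': "\<exists>d>0. \<exists>C\<ge>0. \<forall>z. cmod (z - z0) < d \<longrightarrow>
       norm (h z - h z0 - (z - z0) *\<^sub>C h' z0) \<le> C * (cmod (z - z0))\<^sup>2 \<and> norm (h' z - h' z0) \<le> C * cmod (z - z0)"
    if "z0 \<in> S" for z0
  proof -
    obtain d C where d: "d > 0" and C: "\<And>z. cmod (z - z0) < d \<Longrightarrow>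
       norm (h z - h z0 - (z - z0) *\<^sub>C h' z0) \<le> C * (cmod (z - z0))\<^sup>2 \<and> norm (h' z - h' z0) \<le> C * cmod (z - z0)"
      using loc[OF \<open>z0 \<in> S\<close>] by blast
    have "C * (cmod (z - z0))\<^sup>2 \<le> \<bar>C\<bar> * (cmod (z - z0))\<^sup>2" "C * cmod (z - z0) \<le> \<bar>C\<bar> * cmod (z - z0)" for z
      by (intro mult_right_mono; simp)+
    then have "\<forall>z. cmod (z - z0) < d \<longrightarrow>
       norm (h z - h z0 - (z - z0) *\<^sub>C h' z0) \<le> \<bar>C\<bar> * (cmod (z - z0))\<^sup>2 \<and> norm (h' z - h' z0) \<le> \<bar>C\<bar> * cmod (z - z0)"
      using C by (meson order_trans)
    then show ?thesis using d by (intro exI[of _ d]) (auto intro!: exI[of _ "\<bar>C\<bar>"])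
  qed
  show "continuous_on S h'"
  proof (rule continuous_at_imp_continuous_on, rule ballI)
    fix z0 assume "z0 \<in> S"
    from loc'[OF this] obtain d C where d: "d > 0" "\<And>z. cmod (z - z0) < d \<Longrightarrow> norm (h' z - h' z0) \<le> C * cmod (z - z0)"
      by blast
    have "((\<lambda>z. h' z - h' z0) \<longlongrightarrow> 0) (at z0)"
    proof (rule Lim_null_comparison)
      show "\<forall>\<^sub>F z in at z0. norm (h' z - h' z0) \<le> C * cmod (z - z0)"
        unfolding eventually_at using d by (auto simp: dist_norm)
      show "((\<lambda>z. C * cmod (z - z0)) \<longlongrightarrow> 0) (at z0)"
        by (auto intro!: tendsto_eq_intros)
    qed
    then show "isCont h' z0" unfolding isCont_def by (rule LIM_zero_cancel)
  qed
  fix z0 assume "z0 \<in> S"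
  from loc'[OF this] obtain d C where d: "d > 0" "C \<ge> 0" "\<And>z. cmod (z - z0) < d \<Longrightarrow> norm (h z - h z0 - (z - z0) *\<^sub>C h' z0) \<le> C * (cmod (z - z0))\<^sup>2"
    by blast
  show "(h has_derivative (\<lambda>w. w *\<^sub>C h' z0)) (at z0)"
    unfolding has_derivative_at_alt
  proof (intro conjI allI impI)
    show "bounded_linear (\<lambda>w. w *\<^sub>C h' z0)" by (rule scaleC.bounded_linear_left)
    fix e :: real assume e: "e > 0"
    define d' where "d' = min d (e / (C + 1))"
    have "d' > 0" using d e by (simp add: d'_def)
    moreover have "norm (h z - h z0 - (z - z0) *\<^sub>C h' z0) \<le> e * norm (z - z0)" if "norm (z - z0) < d'" for z
    proof -
      have "norm (h z - h z0 - (z - z0) *\<^sub>C h' z0) \<le> (cmod (z - z0) * C) * cmod (z - z0)"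
        using d(3)[of z] that by (simp add: d'_def power2_eq_square mult_ac)
      also have "\<dots> \<le> e * cmod (z - z0)"
      proof (rule mult_right_mono)
        have "cmod (z - z0) * C \<le> (e / (C + 1)) * (C + 1)"
          using that d(2) e by (intro mult_mono) (auto simp: d'_def)
        also have "\<dots> = e" using d(2) by simp
        finally show "cmod (z - z0) * C \<le> e" .
      qed simp
      finally show ?thesis .
    qed
    ultimately show "\<exists>d>0. \<forall>y. norm (y - z0) < d \<longrightarrow> norm (h y - h z0 - (y - z0) *\<^sub>C h' z0) \<le> e * norm (y - z0)" by blast
  qed
qed

text \<open>The remainders of the kernel are powers of \<open>z - z0\<close> divided by three
  factors \<open>w - z\<close> or \<open>w - z0\<close>. Each factor is at least the distance
  \<open>d\<close> to the ray, so \<open>d^(-3)\<close> times the constant of the integrand bounds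
  the transform of the remainder.\<close>

lemma cauchy_transform_vholo:
  fixes k :: "complex \<Rightarrow> 'x::{complex_normed_vector,banach}"
  assumes k: "ray_ok b k" and b: "0 < \<bar>b\<bar>" "\<bar>b\<bar> < pi"
  shows "vholo (sector \<bar>b\<bar>) (\<lambda>z. ray b (\<lambda>w. (1 / (w - z)) *\<^sub>C k w))"
proof -
  obtain L where L: "L \<ge> 0" and Lb: "\<And>m M. continuous_on (rayset b) m \<Longrightarrow> (\<And>w. w \<in> rayset b \<Longrightarrow> cmod (m w) \<le> M) \<Longrightarrow>
       ray_ok b (\<lambda>w. m w *\<^sub>C k w) \<and> norm (ray b (\<lambda>w. m w *\<^sub>C k w)) \<le> M * L"
    using ray_ok_mult[OF k] by blast
  have argb: "w \<noteq> 0 \<and> Arg w = b" if "w \<in> rayset b" for w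
    by (rule rayset_Arg[OF _ _ that]) (use b in auto)
  have loc: "\<exists>d>0. \<forall>z w. cmod (z - z0) < d \<longrightarrow> w \<in> rayset b \<longrightarrow> d \<le> cmod (w - z)" if z0: "z0 \<in> sector \<bar>b\<bar>" for z0
  proof -
    have z0': "z0 \<noteq> 0" "\<bar>Arg z0\<bar> < \<bar>b\<bar>" using z0 b by (auto simp: mem_sector)
    obtain c where c: "c > 0" "\<And>z w. \<bar>Arg z\<bar> \<le> \<bar>Arg z0\<bar> \<Longrightarrow> \<bar>b\<bar> \<le> \<bar>Arg w\<bar> \<Longrightarrow> c * (cmod w + cmod z) \<le> cmod (w - z)"
      using angle_gap[of "\<bar>Arg z0\<bar>" "\<bar>b\<bar>"] z0' b by auto
    \<comment> \<open>Half of the distance between \<open>z0\<close> and the ray that the angle gap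
      guarantees: points of the ball of this radius still have distance \<open>d\<close> from the
      ray.\<close>
    define d where "d = c * cmod z0 / 2"
    have "d > 0" using c z0' by (simp add: d_def)
    moreover have "d \<le> cmod (w - z)" if "cmod (z - z0) < d" "w \<in> rayset b" for z w
    proof -
      have "2 * d \<le> c * (cmod w + cmod z0)" using c by (simp add: d_def algebra_simps)
      also have "\<dots> \<le> cmod (w - z0)" using c(2)[of z0 w] argb[OF that(2)] by simp
      finally show ?thesis using that(1) norm_triangle_ineq[of "w - z" "z - z0"] by simp
    qed
    ultimately show ?thesis by blast
  qed
  define N where "N = (\<lambda>z. ray b (\<lambda>w. (1 / (w - z)) *\<^sub>C k w))"
  define N' where "N' = (\<lambda>z. ray b (\<lambda>w. (1 / (w - z)^2) *\<^sub>C k w))"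
  have key: "\<exists>d>0. \<forall>z. cmod (z - z0) < d \<longrightarrow>
       norm (N z - N z0 - (z - z0) *\<^sub>C N' z0) \<le> (cmod (z - z0))\<^sup>2 * (L / d^3) \<and>
       norm (N' z - N' z0) \<le> cmod (z - z0) * (2 * L / d^3)" if z0: "z0 \<in> sector \<bar>b\<bar>" for z0
  proof -
    obtain d where d: "d > 0" "\<And>z w. cmod (z - z0) < d \<Longrightarrow> w \<in> rayset b \<Longrightarrow> d \<le> cmod (w - z)"
      using loc[OF z0] by blast
    have "norm (N z - N z0 - (z - z0) *\<^sub>C N' z0) \<le> (cmod (z - z0))\<^sup>2 * (L / d^3) \<and>
       norm (N' z - N' z0) \<le> cmod (z - z0) * (2 * L / d^3)" if z: "cmod (z - z0) < d" for z
    proof -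
      have dz: "d \<le> cmod (w - z)" "d \<le> cmod (w - z0)" if "w \<in> rayset b" for w
        using d(2)[OF z that] d(2)[of z0 w] that d(1) by auto
      then have nz: "w - z \<noteq> 0" "w - z0 \<noteq> 0" if "w \<in> rayset b" for w using that d(1) by force+
      have ok1: "ray_ok b (\<lambda>w. (1 / (w - u)) *\<^sub>C k w)" "ray_ok b (\<lambda>w. (1 / (w - u)^2) *\<^sub>C k w)" if u: "u = z \<or> u = z0" for u
      proof -
        have un: "w \<noteq> u" "d \<le> cmod (w - u)" if "w \<in> rayset b" for w using u nz[OF that] dz[OF that] by auto
        show "ray_ok b (\<lambda>w. (1 / (w - u)) *\<^sub>C k w)"
          by (rule conjunct1[OF Lb[of _ "1/d"]])
             (use un d(1) in \<open>auto intro!: continuous_intros divide_left_mono mult_pos_pos simp: norm_divide\<close>)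
        have "1 / cmod (w - u)^2 \<le> 1 / d^2" if "w \<in> rayset b" for w
          using un[OF that] d(1) by (intro divide_left_mono power_mono) auto
        then show "ray_ok b (\<lambda>w. (1 / (w - u)^2) *\<^sub>C k w)"
          by (intro conjunct1[OF Lb[of _ "1/d^2"]])
             (use un d(1) in \<open>auto intro!: continuous_intros simp: norm_divide norm_power\<close>)
      qed
      have "N z - N z0 - (z - z0) *\<^sub>C N' z0 = ray b (\<lambda>w. (1 / (w - z)) *\<^sub>C k w - (1 / (w - z0)) *\<^sub>C k w - (z - z0) *\<^sub>C ((1 / (w - z0)^2) *\<^sub>C k w))"
      proof -
        have s: "ray_ok b (\<lambda>w. (z - z0) *\<^sub>C ((1 / (w - z0)^2) *\<^sub>C k w))"
          by (rule ray_ok_linear[OF ok1(2) bounded_linear_scaleC_const]) simp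
        have 1: "(z - z0) *\<^sub>C N' z0 = ray b (\<lambda>w. (z - z0) *\<^sub>C ((1 / (w - z0)^2) *\<^sub>C k w))"
          unfolding N'_def by (rule ray_scaleC[symmetric], rule ok1) simp
        have 2: "N z - N z0 = ray b (\<lambda>w. (1 / (w - z)) *\<^sub>C k w - (1 / (w - z0)) *\<^sub>C k w)"
          unfolding N_def by (rule ray_diff[symmetric]; rule ok1) simp_all
        show ?thesis unfolding 1 2
          by (rule ray_diff[symmetric], rule ray_ok_diff) (auto intro: ok1 s)
      qed
      also have "\<dots> = ray b (\<lambda>w. ((z - z0)^2 / ((w - z) * (w - z0)^2)) *\<^sub>C k w)"
      proof (rule ray_cong)
        fix w assume "w \<in> rayset b"
        note nz = nz[OF this]
        have "1 / (w - z) - 1 / (w - z0) - (z - z0) * (1 / (w - z0)^2) = (z - z0)^2 / ((w - z) * (w - z0)^2)"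
          using nz by (simp add: divide_simps power2_eq_square) (simp add: algebra_simps)
        then show "(1 / (w - z)) *\<^sub>C k w - (1 / (w - z0)) *\<^sub>C k w - (z - z0) *\<^sub>C ((1 / (w - z0)^2) *\<^sub>C k w) =
            ((z - z0)^2 / ((w - z) * (w - z0)^2)) *\<^sub>C k w"
          by (metis scaleC.diff_left scaleC_scaleC)
      qed
      finally have e1: "N z - N z0 - (z - z0) *\<^sub>C N' z0 = ray b (\<lambda>w. ((z - z0)^2 / ((w - z) * (w - z0)^2)) *\<^sub>C k w)" .
      have "norm (ray b (\<lambda>w. ((z - z0)^2 / ((w - z) * (w - z0)^2)) *\<^sub>C k w)) \<le> (cmod (z - z0))\<^sup>2 / d^3 * L"
      proof (rule conjunct2[OF Lb])
        show "continuous_on (rayset b) (\<lambda>w. (z - z0)^2 / ((w - z) * (w - z0)^2))"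
          using nz by (auto intro!: continuous_intros)
        fix w assume "w \<in> rayset b"
        note dz = dz[OF this]
        have "d * d^2 \<le> cmod (w - z) * cmod (w - z0)^2" using dz d(1) by (intro mult_mono power_mono) auto
        then show "cmod ((z - z0)^2 / ((w - z) * (w - z0)^2)) \<le> (cmod (z - z0))\<^sup>2 / d^3"
          using dz d(1) by (auto simp: norm_divide norm_mult norm_power power3_eq_cube power2_eq_square intro!: divide_left_mono mult_pos_pos)
      qed
      moreover have "N' z - N' z0 = ray b (\<lambda>w. (1 / (w - z)^2) *\<^sub>C k w - (1 / (w - z0)^2) *\<^sub>C k w)"
        unfolding N'_def using ok1 by (subst ray_diff) auto
      moreover have "\<dots> = ray b (\<lambda>w. ((z - z0) * (1 / ((w - z)^2 * (w - z0)) + 1 / ((w - z) * (w - z0)^2))) *\<^sub>C k w)"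
      proof (rule ray_cong)
        fix w assume "w \<in> rayset b"
        note nz = nz[OF this]
        have "1 / (w - z)^2 - 1 / (w - z0)^2 = (z - z0) * (1 / ((w - z)^2 * (w - z0)) + 1 / ((w - z) * (w - z0)^2))"
          using nz by (simp add: divide_simps power2_eq_square) (simp add: algebra_simps)
        then show "(1 / (w - z)^2) *\<^sub>C k w - (1 / (w - z0)^2) *\<^sub>C k w =
            ((z - z0) * (1 / ((w - z)^2 * (w - z0)) + 1 / ((w - z) * (w - z0)^2))) *\<^sub>C k w"
          by (metis scaleC.diff_left)
      qed
      moreover have "norm (ray b (\<lambda>w. ((z - z0) * (1 / ((w - z)^2 * (w - z0)) + 1 / ((w - z) * (w - z0)^2))) *\<^sub>C k w)) 
           \<le> (cmod (z - z0) * (2 / d^3)) * L"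
      proof (rule conjunct2[OF Lb])
        show "continuous_on (rayset b) (\<lambda>w. (z - z0) * (1 / ((w - z)^2 * (w - z0)) + 1 / ((w - z) * (w - z0)^2)))"
          using nz by (auto intro!: continuous_intros)
        fix w assume "w \<in> rayset b"
        note dz = dz[OF this]
        have p: "d * d^2 \<le> cmod (w - z) * cmod (w - z0)^2" "d^2 * d \<le> cmod (w - z)^2 * cmod (w - z0)" 
          using dz d(1) by (intro mult_mono power_mono; simp)+
        have "cmod (1 / ((w - z)^2 * (w - z0))) \<le> 1 / d^3" "cmod (1 / ((w - z) * (w - z0)^2)) \<le> 1 / d^3"
          using p dz d(1) by (auto simp: norm_divide norm_mult norm_power power3_eq_cube power2_eq_square intro!: divide_left_mono mult_pos_pos)
        then have "cmod (1 / ((w - z)^2 * (w - z0)) + 1 / ((w - z) * (w - z0)^2)) \<le> 2 / d^3"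
          using norm_triangle_ineq[of "1 / ((w - z)^2 * (w - z0))" "1 / ((w - z) * (w - z0)^2)"] by simp
        then show "cmod ((z - z0) * (1 / ((w - z)^2 * (w - z0)) + 1 / ((w - z) * (w - z0)^2))) \<le> cmod (z - z0) * (2 / d^3)"
          unfolding norm_mult by (intro mult_left_mono) auto
      qed
      ultimately show ?thesis using e1 by (simp add: algebra_simps)
    qed
    then show ?thesis using d(1) by blast
  qed
  have "vholo (sector \<bar>b\<bar>) N"
  proof (rule vholo_local[of _ _ N'])
    fix z0 assume "z0 \<in> sector \<bar>b\<bar>"
    from key[OF this] obtain d where d: "d > 0" "\<And>z. cmod (z - z0) < d \<Longrightarrow>
       norm (N z - N z0 - (z - z0) *\<^sub>C N' z0) \<le> (cmod (z - z0))\<^sup>2 * (L / d^3) \<and>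
       norm (N' z - N' z0) \<le> cmod (z - z0) * (2 * L / d^3)" by blast
    have "L / d^3 \<ge> 0" using L d(1) by simp
    have "norm (N z - N z0 - (z - z0) *\<^sub>C N' z0) \<le> 2 * L / d^3 * (cmod (z - z0))\<^sup>2 \<and>
       norm (N' z - N' z0) \<le> 2 * L / d^3 * cmod (z - z0)" if "cmod (z - z0) < d" for z
    proof -
      have "(cmod (z - z0))\<^sup>2 * (L / d^3) \<le> (cmod (z - z0))\<^sup>2 * (2 * L / d^3)"
        using \<open>L / d^3 \<ge> 0\<close> by (intro mult_left_mono) auto
      then show ?thesis using d(2)[OF that] by (simp add: mult.commute)
    qed
    then show "\<exists>d>0. \<exists>C. \<forall>z. cmod (z - z0) < d \<longrightarrow>
       norm (N z - N z0 - (z - z0) *\<^sub>C N' z0) \<le> C * (cmod (z - z0))\<^sup>2 \<and> norm (N' z - N' z0) \<le> C * cmod (z - z0)"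
      using d(1) by blast
  qed
  then show ?thesis by (simp add: N_def)
qed

text \<open>The angle gap bounds the kernel by \<open>1 / (c * cmod z)\<close> for all
  \<open>w\<close> on the ray. The factor \<open>1 / cmod z\<close> is the one a resolvent would
  give, so after multiplication by a function in \<open>holo_H\<close> the transform can be
  integrated along inner rays.\<close>

lemma cauchy_transform_bound:
  fixes k :: "complex \<Rightarrow> 'x::{complex_normed_vector,banach}"
  assumes k: "ray_ok b k" and \<alpha>: "0 \<le> \<alpha>" "\<alpha> < \<bar>b\<bar>" "\<bar>b\<bar> < pi"
  obtains L where "\<And>z. z \<in> closed_sector \<alpha> \<Longrightarrow> norm (ray b (\<lambda>w. (1 / (w - z)) *\<^sub>C k w)) \<le> L / cmod z"
    "\<And>z. z \<in> closed_sector \<alpha> \<Longrightarrow> ray_ok b (\<lambda>w. (1 / (w - z)) *\<^sub>C k w)"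
proof -
  obtain L where L: "L \<ge> 0" and Lb: "\<And>m M. continuous_on (rayset b) m \<Longrightarrow> (\<And>w. w \<in> rayset b \<Longrightarrow> cmod (m w) \<le> M) \<Longrightarrow>
       ray_ok b (\<lambda>w. m w *\<^sub>C k w) \<and> norm (ray b (\<lambda>w. m w *\<^sub>C k w)) \<le> M * L"
    using ray_ok_mult[OF k] by blast
  obtain c where c: "c > 0" "\<And>z w. \<bar>Arg z\<bar> \<le> \<alpha> \<Longrightarrow> \<bar>b\<bar> \<le> \<bar>Arg w\<bar> \<Longrightarrow> c * (cmod w + cmod z) \<le> cmod (w - z)"
    using angle_gap[of \<alpha> "\<bar>b\<bar>"] \<alpha> by auto
  have "ray_ok b (\<lambda>w. (1 / (w - z)) *\<^sub>C k w) \<and> norm (ray b (\<lambda>w. (1 / (w - z)) *\<^sub>C k w)) \<le> 1 / (c * cmod z) * L" if z: "z \<in> closed_sector \<alpha>" for z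
  proof (rule Lb)
    have cz: "c * cmod z \<le> cmod (w - z)" "c * cmod z > 0" if "w \<in> rayset b" for w
    proof -
      have "Arg w = b" using rayset_Arg[of b w] that \<alpha> by auto
      then have "c * (cmod w + cmod z) \<le> cmod (w - z)" using c(2) z by (simp add: closed_sector_def)
      moreover have "c * cmod w \<ge> 0" using c(1) by simp
      ultimately show "c * cmod z \<le> cmod (w - z)" by (simp add: algebra_simps)
      show "c * cmod z > 0" using c z by (simp add: closed_sector_def)
    qed
    then have nz: "w \<noteq> z" if "w \<in> rayset b" for w using that by force
    then show "continuous_on (rayset b) (\<lambda>w. 1 / (w - z))" by (auto intro!: continuous_intros)
    show "cmod (1 / (w - z)) \<le> 1 / (c * cmod z)" if "w \<in> rayset b" for w
      using cz[OF that] by (auto simp: norm_divide intro!: divide_left_mono mult_pos_pos)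
  qed
  moreover have "1 / (c * cmod z) * L = L / c / cmod z" for z by simp
  ultimately show ?thesis using that[of "L / c"] by metis
qed

lemma one_plus_bound:
  assumes "0 \<le> \<phi>" "\<phi> < pi"
  obtains c where "c > 0" "\<And>z. \<bar>Arg z\<bar> \<le> \<phi> \<Longrightarrow> c * (1 + cmod z) \<le> cmod (1 + z)"
proof -
  obtain c where c: "c > 0" "\<And>z w. \<bar>Arg z\<bar> \<le> \<phi> \<Longrightarrow> pi \<le> \<bar>Arg w\<bar> \<Longrightarrow> c * (cmod w + cmod z) \<le> cmod (w - z)"
    using angle_gap[of \<phi> pi] assms by auto
  have "c * (1 + cmod z) \<le> cmod (1 + z)" if "\<bar>Arg z\<bar> \<le> \<phi>" for z
  proof -
    have "c * (cmod (-1) + cmod z) \<le> cmod (-1 - z)" 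
      by (rule c(2)[OF that]) (use Arg_of_real[of "-1"] in simp)
    also have "\<dots> = cmod (1 + z)" by (metis minus_diff_commute diff_minus_eq_add norm_minus_commute add.commute minus_add_distrib norm_minus_cancel uminus_add_conv_diff)
    finally show ?thesis by simp
  qed
  then show ?thesis using c(1) that by blast
qed

section \<open>A residue and Cauchy's formula for sectors\<close>

lemma Arg_m1: "Arg (-1) = pi"
  using Arg_of_real[of "-1"] by simp

lemma one_plus_nz: "\<bar>Arg z\<bar> < pi \<Longrightarrow> 1 + z \<noteq> 0"
  using Arg_m1 by (metis abs_of_pos add_eq_0_iff less_irrefl pi_gt_zero)

lemma rayset_closed_sector: "0 \<le> \<alpha> \<Longrightarrow> \<alpha> < pi \<Longrightarrow> rayset \<alpha> \<subseteq> closed_sector \<alpha> \<and> rayset (-\<alpha>) \<subseteq> closed_sector \<alpha>"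
  unfolding rayset_def by (auto intro!: polar_in_closed_sector simp del: cis_neq_zero)

lemma rayset_outerc: "0 \<le> \<alpha> \<Longrightarrow> \<alpha> \<le> pi \<Longrightarrow> rayset \<alpha> \<subseteq> outerc \<alpha> \<and> rayset (-\<alpha>) \<subseteq> outerc \<alpha>"
  unfolding rayset_def by (auto intro!: polar_in_outerc simp del: cis_neq_zero)

lemma closed_sector_subset: "0 \<le> \<alpha> \<Longrightarrow> \<alpha> < \<phi> \<Longrightarrow> closed_sector \<alpha> \<subseteq> sector \<phi>"
  by (auto simp: closed_sector_def mem_sector)

text \<open>The kernel is \<open>1 / (w - 1) - 1 / (w + 1)\<close>, and the contour has
  \<open>1\<close> inside and \<open>-1\<close> outside. Rotated to the imaginary axis it becomes a
  multiple of \<open>1 / (1 + r^2)\<close>, and the arctangent yields \<open>pi i\<close> from each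
  ray. All residues are reduced to this one explicit integral.\<close>

lemma log_integral:
  fixes u :: "'x::{complex_normed_vector,banach}"
  assumes \<alpha>: "0 < \<alpha>" "\<alpha> < pi"
  defines "p \<equiv> \<lambda>w::complex. (2 / ((w - 1) * (w + 1))) *\<^sub>C u"
  shows "ray (-\<alpha>) p - ray \<alpha> p = (2 * complex_of_real pi * \<i>) *\<^sub>C u"
    and "ray_ok \<alpha> p" "ray_ok (-\<alpha>) p"
proof -
  \<comment> \<open>\<open>T\<close> contains all angles between \<open>\<alpha>\<close> and
    \<open>pi/2\<close>, whichever is larger, on both sides, and stays away from \<open>1\<close>
    and \<open>-1\<close>.\<close>
  define lo hi where "lo = min \<alpha> (pi/2)" and "hi = max \<alpha> (pi/2)"
  have lh: "0 < lo" "hi < pi" "lo \<le> \<alpha>" "\<alpha> \<le> hi" "lo \<le> pi/2" "pi/2 \<le> hi" using \<alpha> by (auto simp: lo_def hi_def)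
  define T where "T = {w. w \<noteq> 0 \<and> lo \<le> \<bar>Arg w\<bar> \<and> \<bar>Arg w\<bar> \<le> hi}"
  have T0: "0 \<notin> T" by (simp add: T_def)
  obtain c where c: "c > 0" "\<And>z. \<bar>Arg z\<bar> \<le> hi \<Longrightarrow> c * (1 + cmod z) \<le> cmod (1 + z)"
    using one_plus_bound[of hi] lh by auto
  obtain d where d: "d > 0" "\<And>z w. \<bar>Arg z\<bar> \<le> 0 \<Longrightarrow> lo \<le> \<bar>Arg w\<bar> \<Longrightarrow> d * (cmod w + cmod z) \<le> cmod (w - z)"
    using angle_gap[of 0 lo] lh by auto
  have b: "c * (cmod w + 1) \<le> cmod (w + 1)" "d * (cmod w + 1) \<le> cmod (w - 1)" if "w \<in> T" for w
    using c(2)[of w] d(2)[of 1 w] that by (auto simp: T_def add.commute)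
  have dec: "decays T p"
  proof (rule decays_quadratic[OF zero_less_one zero_less_one _ T0])
    fix w assume w: "w \<in> T"
    have "(d * (cmod w + 1)) * (c * (cmod w + 1)) \<le> cmod (w - 1) * cmod (w + 1)"
      using b[OF w] c(1) d(1) by (intro mult_mono) auto
    moreover have "0 < (d * (cmod w + 1)) * (c * (cmod w + 1))" using c(1) d(1) by (intro mult_pos_pos add_nonneg_pos) auto
    ultimately have "2 / (cmod (w - 1) * cmod (w + 1)) \<le> 2 / ((d * (cmod w + 1)) * (c * (cmod w + 1)))"
      by (intro divide_left_mono) auto
    then have "norm (p w) \<le> 2 / ((d * (cmod w + 1)) * (c * (cmod w + 1))) * norm u"
      unfolding p_def norm_scaleC norm_divide norm_mult by (intro mult_right_mono) auto
    also have "\<dots> = (2 / (c * d) * norm u) / ((cmod w + 1) * (cmod w + 1))" by (simp add: mult_ac)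
    finally show "norm (p w) \<le> (2 / (c * d) * norm u) / ((cmod w + 1) * (cmod w + 1))" .
  qed
  have vh: "vholo (- {1, -1}) p"
    unfolding p_def
  proof (rule vholo_scaleC[OF _ _ vholo_const])
    have "w + 1 \<noteq> 0" if "w \<noteq> -1" for w :: complex using that by (metis add.inverse_inverse add_eq_0_iff)
    then show "(\<lambda>w. 2 / ((w - 1) * (w + 1))) holomorphic_on - {1, - 1}"
      by (auto intro!: holomorphic_intros)
    show "open (- {1, - 1 :: complex})" by (intro open_Compl finite_imp_closed) auto
  qed
  have TS: "T \<subseteq> - {1, -1}" using lh Arg_m1 by (auto simp: T_def)
  have inT: "complex_of_real r * cis a \<in> T" if "r > 0" "lo \<le> \<bar>a\<bar>" "\<bar>a\<bar> \<le> hi" for r a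
    using that lh by (auto simp: T_def)
  have rot: "ray \<alpha> p = ray (pi/2) p" "ray (-\<alpha>) p = ray (-(pi/2)) p"
  proof -
    show "ray \<alpha> p = ray (pi/2) p"
    proof (cases "\<alpha> \<le> pi/2")
      case True then show ?thesis using lh \<alpha> by (intro ray_rotate[OF vh _ TS dec]) (auto intro!: inT)
    next
      case False then show ?thesis using lh \<alpha> by (intro ray_rotate[OF vh _ TS dec, symmetric]) (auto intro!: inT)
    qed
    show "ray (-\<alpha>) p = ray (-(pi/2)) p"
    proof (cases "\<alpha> \<le> pi/2")
      case True then show ?thesis using lh \<alpha> by (intro ray_rotate[OF vh _ TS dec, symmetric]) (auto intro!: inT)
    next
      case False then show ?thesis using lh \<alpha> by (intro ray_rotate[OF vh _ TS dec]) (auto intro!: inT)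
    qed
  qed
  \<comment> \<open>\<open>s = 1\<close> is the upper and \<open>s = -1\<close> the lower half of
    the imaginary axis.\<close>
  have at: "((\<lambda>r. (s * \<i>) *\<^sub>C (2 / ((complex_of_real r * (s * \<i>) - 1) * (complex_of_real r * (s * \<i>) + 1))) *\<^sub>C u) has_integral 
       (- s * complex_of_real pi * \<i>) *\<^sub>C u) {0<..}" if s: "s = 1 \<or> s = -1" for s :: complex
  proof -
    define v where "v = (- 2 * s * \<i>) *\<^sub>C u"
    have "((\<lambda>r. inverse (1 + r\<^sup>2) *\<^sub>R v) has_integral ((pi/2) *\<^sub>R v - 0 *\<^sub>R v)) {0<..}"
    proof (rule has_integral_Ioi_FTC[of "\<lambda>r. arctan r *\<^sub>R v"])
      fix r :: real
      show "((\<lambda>r. arctan r *\<^sub>R v) has_vector_derivative inverse (1 + r\<^sup>2) *\<^sub>R v) (at r)"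
        by (rule has_vector_derivative_scaleR[OF DERIV_arctan has_vector_derivative_const, simplified])
      have "(arctan \<longlongrightarrow> arctan 0) (at_right 0)" by (intro tendsto_intros)
      then show "((\<lambda>r. arctan r *\<^sub>R v) \<longlongrightarrow> 0 *\<^sub>R v) (at_right 0)" by (auto intro!: tendsto_eq_intros)
      show "((\<lambda>r. arctan r *\<^sub>R v) \<longlongrightarrow> (pi / 2) *\<^sub>R v) at_top"
        by (intro tendsto_intros tendsto_arctan_at_top)
    qed
    moreover have "(s * \<i>) *\<^sub>C (2 / ((complex_of_real r * (s * \<i>) - 1) * (complex_of_real r * (s * \<i>) + 1))) *\<^sub>C u
        = inverse (1 + r\<^sup>2) *\<^sub>R v" for r
    proof -
      have "(complex_of_real r * (s * \<i>) - 1) * (complex_of_real r * (s * \<i>) + 1) = - complex_of_real (1 + r\<^sup>2)"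
        using s by (auto simp: algebra_simps power2_eq_square)
      moreover have "complex_of_real (1 + r\<^sup>2) \<noteq> 0" by (metis of_real_eq_0_iff sum_power2_eq_zero_iff one_power2 zero_neq_one)
      ultimately have "s * \<i> * (2 / ((complex_of_real r * (s * \<i>) - 1) * (complex_of_real r * (s * \<i>) + 1)))
          = complex_of_real (inverse (1 + r\<^sup>2)) * (- 2 * s * \<i>)"
        by (simp add: divide_simps del: of_real_add of_real_power)
      then show ?thesis
        unfolding v_def scaleR_scaleC scaleC_scaleC by simp
    qed
    moreover have "(pi/2) *\<^sub>R v - 0 *\<^sub>R v = (- s * complex_of_real pi * \<i>) *\<^sub>C u"
      by (simp add: v_def scaleR_scaleC scaleC_scaleC mult_ac)
    ultimately show ?thesis by (metis (no_types, lifting) has_integral_cong)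
  qed
  have "ray (pi/2) p = (- 1 * complex_of_real pi * \<i>) *\<^sub>C u"
    using integral_unique[OF at[of 1]] by (simp add: ray_def p_def)
  moreover have "cis (- (pi/2)) = -\<i>" by (simp add: complex_eq_iff)
  then have "ray (-(pi/2)) p = (complex_of_real pi * \<i>) *\<^sub>C u"
    using integral_unique[OF at[of "-1"]] by (simp add: ray_def p_def)
  ultimately show "ray (-\<alpha>) p - ray \<alpha> p = (2 * complex_of_real pi * \<i>) *\<^sub>C u"
    unfolding rot by (simp flip: scaleC.diff_left add: algebra_simps)
  show "ray_ok \<alpha> p" "ray_ok (-\<alpha>) p"
    by (rule ray_ok_vholo[OF vh _ TS dec], use \<alpha> lh in \<open>auto simp: rayset_def intro!: inT\<close>)+
qed

lemma holo_H_bounded: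
  assumes "holo_H \<phi> \<psi>" obtains C where "C > 0" "\<And>z. z \<in> sector \<phi> \<Longrightarrow> cmod (\<psi> z) \<le> C"
proof -
  obtain C b where C: "C > 0" "b > 0" "\<And>z. z \<in> sector \<phi> \<Longrightarrow> cmod (\<psi> z) \<le> C * min (cmod z powr b) (cmod z powr - b)"
    using assms unfolding holo_H_def by auto
  have "cmod (\<psi> z) \<le> C" if "z \<in> sector \<phi>" for z
  proof (cases "z = 0")
    case True then show ?thesis using C(1,2) C(3)[OF that] by simp
  next
    case False
    have "min (cmod z powr b) (cmod z powr - b) \<le> min (cmod z powr 0) (cmod z powr - 0)"
      using False C by (intro min_powr_antimono) auto
    then have "C * min (cmod z powr b) (cmod z powr - b) \<le> C * 1" using C False by (intro mult_left_mono) auto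
    then show ?thesis using C(3)[OF that] by linarith
  qed
  then show ?thesis using C(1) that by blast
qed

lemma holo_H_decays:
  assumes "holo_H \<phi> \<psi>" "T \<subseteq> sector \<phi>" "\<And>z. z \<in> T \<Longrightarrow> norm (h z) \<le> C * (cmod (\<psi> z) / cmod z)"
  shows "decays T h"
proof -
  obtain K b where K: "K > 0" "b > 0" "\<And>z. z \<in> sector \<phi> \<Longrightarrow> cmod (\<psi> z) \<le> K * min (cmod z powr b) (cmod z powr - b)"
    using assms(1) unfolding holo_H_def by auto
  have "decays T (\<lambda>z. \<psi> z / z)"
  proof (rule decaysI[OF K(2)])
    fix z assume "z \<in> T"
    then have "cmod (\<psi> z) / cmod z \<le> K * min (cmod z powr b) (cmod z powr - b) / cmod z"
      using assms(2) by (intro divide_right_mono K) auto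
    then show "cmod (\<psi> z / z) \<le> K * min (cmod z powr b) (cmod z powr - b) / cmod z"
      by (simp add: norm_divide)
  qed
  then show ?thesis
    by (rule decays_bound[of _ _ _ C]) (use assms(3) in \<open>simp add: norm_divide\<close>)
qed

text \<open>The integrand is split into \<open>k + \<psi> z * (m + l)\<close>. Here \<open>k\<close>
  is holomorphic inside the contour and \<open>m\<close> outside it, so neither contributes;
  \<open>l\<close> is the kernel of \<open>log_integral\<close> and yields \<open>2 pi i\<close>.
  The auxiliary poles at \<open>1\<close> and \<open>-1\<close> give each piece enough decay at
  infinity.\<close>

lemma cauchy_formula:
  fixes u :: "'x::{complex_normed_vector,banach}"
  assumes \<psi>: "holo_H \<phi> \<psi>" and \<alpha>: "0 < \<alpha>" "\<alpha> < \<phi>" "\<phi> < pi" and z: "z \<noteq> 0" "\<bar>Arg z\<bar> < \<alpha>"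
  defines "p \<equiv> \<lambda>w. (\<psi> w / (w - z)) *\<^sub>C u"
  shows "ray (-\<alpha>) p - ray \<alpha> p = (2 * complex_of_real pi * \<i> * \<psi> z) *\<^sub>C u"
    and "ray_ok \<alpha> p" "ray_ok (-\<alpha>) p"
proof -
  have hol: "\<psi> holomorphic_on sector \<phi>" using \<psi> by (simp add: holo_H_def)
  have os: "open (sector \<phi>)" using \<alpha> by (intro open_sector) auto
  obtain C where C: "C > 0" "\<And>w. w \<in> sector \<phi> \<Longrightarrow> cmod (\<psi> w) \<le> C" using holo_H_bounded[OF \<psi>] by blast
  have zs: "z \<in> sector \<phi>" using z \<alpha> by (auto simp: mem_sector)
  have cs: "closed_sector \<alpha> \<subseteq> sector \<phi>" using \<alpha> by (intro closed_sector_subset) auto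
  obtain c where c: "c > 0" "\<And>w. \<bar>Arg w\<bar> \<le> \<phi> \<Longrightarrow> c * (1 + cmod w) \<le> cmod (1 + w)"
    using one_plus_bound[of \<phi>] \<alpha> by auto
  have c': "c * (1 + cmod w) \<le> cmod (w + 1)" if "w \<in> sector \<phi>" for w
    using c(2)[of w] that \<alpha> by (auto simp: mem_sector add.commute)
  have w1: "w + 1 \<noteq> 0" if "w \<in> sector \<phi>" for w
    using one_plus_nz[of w] that \<alpha> by (auto simp: mem_sector add.commute)
  define q where "q = (\<lambda>w. if w = z then deriv \<psi> z else (\<psi> w - \<psi> z) / (w - z))"
  have q: "q holomorphic_on sector \<phi>" unfolding q_def by (rule pole_lemma_open[OF hol os])
  \<comment> \<open>The difference quotient contains \<open>- \<psi> z / (w - z)\<close>, which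
    decays only like \<open>1 / w\<close>; the added term cancels its leading part.\<close>
  define k where "k = (\<lambda>w. q w + \<psi> z / (w + 1))"
  have khol: "k holomorphic_on sector \<phi>" unfolding k_def using q w1 by (intro holomorphic_intros) auto
  \<comment> \<open>From this modulus on, the distance to \<open>z\<close> is at least
    \<open>cmod w / 2\<close>.\<close>
  define N where "N = 2 * cmod z + 1"
  define T1 T2 where "T1 = {w \<in> closed_sector \<alpha>. cmod w \<le> N}" and "T2 = {w \<in> closed_sector \<alpha>. N \<le> cmod w}"
  have T12: "closed_sector \<alpha> = T1 \<union> T2" by (auto simp: T1_def T2_def)
  have cs0: "0 \<notin> closed_sector \<alpha>" by (simp add: closed_sector_def)
  have p0: "0 \<notin> T1" "0 \<notin> T2" by (auto simp: T1_def T2_def closed_sector_def)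
  have d1: "decays T1 (\<lambda>w. k w *\<^sub>C u)"
  proof -
    \<comment> \<open>Near \<open>z\<close> the quotient \<open>q\<close> is bounded by compactness,
      elsewhere by \<open>2 * C / e\<close>.\<close>
    obtain e where e: "e > 0" "cball z e \<subseteq> sector \<phi>" using os zs open_contains_cball by blast
    have "compact (q ` cball z e)"
      by (rule compact_continuous_image[OF continuous_on_subset[OF holomorphic_on_imp_continuous_on[OF q] e(2)]]) auto
    then obtain Q where Q: "\<And>w. w \<in> cball z e \<Longrightarrow> cmod (q w) \<le> Q"
      using compact_imp_bounded[of "q ` cball z e"] unfolding bounded_iff by (metis imageI)
    define M where "M = max Q (2 * C / e)"
    have qM: "cmod (q w) \<le> M" if "w \<in> sector \<phi>" for w
    proof (cases "w \<in> cball z e")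
      case True then show ?thesis using Q[of w] by (simp add: M_def)
    next
      case False
      then have ew: "e \<le> cmod (w - z)" "w \<noteq> z" using e by (auto simp: dist_norm norm_minus_commute)
      have "cmod (\<psi> w - \<psi> z) \<le> 2 * C" using C(2)[OF that] C(2)[OF zs] norm_triangle_ineq4[of "\<psi> w" "\<psi> z"] by linarith
      then have "cmod (\<psi> w - \<psi> z) / cmod (w - z) \<le> 2 * C / e" using ew e C(1) by (intro frac_le) auto
      then show ?thesis using ew by (simp add: q_def norm_divide M_def)
    qed
    have kM: "cmod (k w) \<le> M + C / c" if "w \<in> sector \<phi>" for w
    proof -
      have "c * (1 + 0) \<le> c * (1 + cmod w)" using c(1) by (intro mult_left_mono) auto
      then have "c \<le> cmod (w + 1)" using c'[OF that] by simp
      then have "cmod (\<psi> z / (w + 1)) \<le> C / c" unfolding norm_divide using C(2)[OF zs] c(1) C(1) by (intro frac_le) auto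
      then show ?thesis using qM[OF that] norm_triangle_ineq[of "q w" "\<psi> z / (w + 1)"] by (simp add: k_def)
    qed
    show ?thesis
    \<comment> \<open>On \<open>T1\<close> the modulus is at most \<open>N\<close>, so the condition
      at infinity, imposed from \<open>N + 1\<close> on, is vacuous.\<close>
    proof (rule decays_from_bounds[of 1 _ _ "(M + C / c) * norm u" "N + 1" 0])
      fix w assume "w \<in> T1"
      then have "w \<in> sector \<phi>" using cs by (auto simp: T1_def)
      then show "norm (k w *\<^sub>C u) \<le> (M + C / c) * norm u" unfolding norm_scaleC by (intro mult_right_mono kM) auto
    qed (use p0 in \<open>auto simp: T1_def\<close>)
  qed
  have far: "w \<noteq> z" "cmod w / 2 \<le> cmod (w - z)" "w \<in> sector \<phi>" "cmod w \<ge> 1" if "w \<in> T2" for w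
  proof -
    have N: "2 * cmod z + 1 \<le> cmod w" using that by (simp add: T2_def N_def)
    show "cmod w / 2 \<le> cmod (w - z)" using N norm_triangle_ineq2[of w z] by linarith
    show "w \<noteq> z" using N norm_ge_zero[of z] by (metis add_le_same_cancel1 add_mono_thms_linordered_semiring(1) le_add_same_cancel1 mult_2 not_one_le_zero order_trans add.commute add.assoc)
    show "cmod w \<ge> 1" using N norm_ge_zero[of z] by linarith
    show "w \<in> sector \<phi>" using that cs by (auto simp: T2_def)
  qed
  have d2: "decays T2 (\<lambda>w. k w *\<^sub>C u)"
  proof -
    have "decays T2 (\<lambda>w. (\<psi> w / (w - z)) *\<^sub>C u - (\<psi> z * (z + 1) / ((w - z) * (w + 1))) *\<^sub>C u)"
    proof (rule decays_diff[OF _ _ p0(2)])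
      show "decays T2 (\<lambda>w. (\<psi> w / (w - z)) *\<^sub>C u)"
      proof (rule holo_H_decays[OF \<psi>, of _ _ "2 * norm u"])
        fix w assume w: "w \<in> T2"
        have "cmod (\<psi> w) / cmod (w - z) \<le> cmod (\<psi> w) / (cmod w / 2)"
          using far[OF w] by (intro divide_left_mono) (auto intro!: mult_pos_pos)
        then have "cmod (\<psi> w) / cmod (w - z) * norm u \<le> cmod (\<psi> w) / (cmod w / 2) * norm u" by (rule mult_right_mono) simp
        then show "norm ((\<psi> w / (w - z)) *\<^sub>C u) \<le> 2 * norm u * (cmod (\<psi> w) / cmod w)"
          by (simp add: norm_scaleC norm_divide mult_ac)
      qed (use far in auto)
      show "decays T2 (\<lambda>w. (\<psi> z * (z + 1) / ((w - z) * (w + 1))) *\<^sub>C u)"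
      proof (rule decays_quadratic[OF zero_less_one zero_less_one, of _ _ "4 / c * (cmod (\<psi> z * (z + 1)) * norm u)"])
        fix w assume w: "w \<in> T2"
        have 1: "(cmod w + 1) / 4 \<le> cmod (w - z)" using far(2,4)[OF w] by simp
        have 2: "c * (cmod w + 1) \<le> cmod (w + 1)" using c'[OF far(3)[OF w]] by (simp add: add.commute)
        have "(cmod w + 1) / 4 * (c * (cmod w + 1)) \<le> cmod (w - z) * cmod (w + 1)"
          using 1 2 c(1) by (intro mult_mono) auto
        moreover have "0 < (cmod w + 1) / 4 * (c * (cmod w + 1))" using c(1) far[OF w] by (intro mult_pos_pos divide_pos_pos) auto
        ultimately have "cmod (\<psi> z * (z + 1)) * norm u / (cmod (w - z) * cmod (w + 1)) \<le> cmod (\<psi> z * (z + 1)) * norm u / ((cmod w + 1) / 4 * (c * (cmod w + 1)))"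
          by (intro divide_left_mono mult_nonneg_nonneg) auto
        also have "\<dots> = 4 / c * (cmod (\<psi> z * (z + 1)) * norm u) / ((cmod w + 1) * (cmod w + 1))" by (simp add: mult_ac)
        finally show "norm ((\<psi> z * (z + 1) / ((w - z) * (w + 1))) *\<^sub>C u) \<le> 4 / c * (cmod (\<psi> z * (z + 1)) * norm u) / ((cmod w + 1) * (cmod w + 1))"
          by (simp add: norm_scaleC norm_divide norm_mult)
      qed (use p0 in auto)
    qed
    moreover have "k w = \<psi> w / (w - z) - \<psi> z * (z + 1) / ((w - z) * (w + 1))" if "w \<in> T2" for w
      using far[OF that] w1[of w] by (simp add: k_def q_def divide_simps) (simp add: algebra_simps)
    ultimately show ?thesis
      by (elim decays_bound[of _ _ _ 1]) (auto simp: scaleC_algebra)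
  qed
  have kdec: "decays (closed_sector \<alpha>) (\<lambda>w. k w *\<^sub>C u)"
    unfolding T12 by (rule decays_Un[OF d1 d2]) (use p0 in auto)
  have kvh: "vholo (sector \<phi>) (\<lambda>w. k w *\<^sub>C u)" by (rule vholo_scaleC[OF khol os vholo_const])
  have kray: "ray (-\<alpha>) (\<lambda>w. k w *\<^sub>C u) = ray \<alpha> (\<lambda>w. k w *\<^sub>C u)"
    by (rule inner_cauchy[OF kvh _ _ _ kdec]) (use \<alpha> in auto)
  have rs: "rayset \<alpha> \<subseteq> closed_sector \<alpha>" "rayset (-\<alpha>) \<subseteq> closed_sector \<alpha>"
    using rayset_closed_sector[of \<alpha>] \<alpha> by auto
  have kok: "ray_ok \<alpha> (\<lambda>w. k w *\<^sub>C u)" "ray_ok (-\<alpha>) (\<lambda>w. k w *\<^sub>C u)"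
    by (rule ray_ok_vholo[OF kvh _ cs kdec], use rs in simp)+
  \<comment> \<open>This is \<open>1 / (w - z) - 1 / (w - 1)\<close>: the pole at \<open>z\<close>
    is exchanged for the one at \<open>1\<close>, both lying inside the contour.\<close>
  define m where "m = (\<lambda>w. ((z - 1) / ((w - z) * (w - 1))) *\<^sub>C u)"
  have mvh: "vholo (- {z, 1}) m"
    unfolding m_def by (rule vholo_scaleC[OF _ _ vholo_const]) (auto intro!: holomorphic_intros open_Compl finite_imp_closed)
  have mT: "outerc \<alpha> \<subseteq> - {z, 1}" using z \<alpha> by (auto simp: outerc_def)
  obtain d where d: "d > 0" "\<And>z' w. \<bar>Arg z'\<bar> \<le> \<bar>Arg z\<bar> \<Longrightarrow> \<alpha> \<le> \<bar>Arg w\<bar> \<Longrightarrow> d * (cmod w + cmod z') \<le> cmod (w - z')"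
    using angle_gap[of "\<bar>Arg z\<bar>" \<alpha>] z \<alpha> by auto
  have mdec: "decays (outerc \<alpha>) m"
  proof (rule decays_quadratic[of "cmod z" 1 _ _ "cmod (z - 1) * norm u / (d * d)"])
    fix w assume w: "w \<in> outerc \<alpha>"
    have 1: "d * (cmod w + cmod z) \<le> cmod (w - z)" using d(2)[of z w] w by (simp add: outerc_def)
    have 2: "d * (cmod w + 1) \<le> cmod (w - 1)" using d(2)[of 1 w] w by (simp add: outerc_def)
    have "(d * (cmod w + cmod z)) * (d * (cmod w + 1)) \<le> cmod (w - z) * cmod (w - 1)"
      using 1 2 d(1) by (intro mult_mono) auto
    moreover have "0 < (d * (cmod w + cmod z)) * (d * (cmod w + 1))" using d(1) z by (intro mult_pos_pos add_nonneg_pos) auto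
    ultimately have "cmod (z - 1) * norm u / (cmod (w - z) * cmod (w - 1)) \<le> cmod (z - 1) * norm u / ((d * (cmod w + cmod z)) * (d * (cmod w + 1)))"
      by (intro divide_left_mono mult_nonneg_nonneg) auto
    also have "\<dots> = cmod (z - 1) * norm u / (d * d) / ((cmod w + cmod z) * (cmod w + 1))" by (simp add: mult_ac)
    finally show "norm (m w) \<le> cmod (z - 1) * norm u / (d * d) / ((cmod w + cmod z) * (cmod w + 1))"
      by (simp add: m_def norm_scaleC norm_divide norm_mult)
  qed (use z in \<open>auto simp: outerc_def\<close>)
  have mray: "ray (-\<alpha>) m = ray \<alpha> m"
    by (rule outer_cauchy[OF mvh mT _ _ mdec]) (use \<alpha> in auto)
  have ro: "rayset \<alpha> \<subseteq> outerc \<alpha>" "rayset (-\<alpha>) \<subseteq> outerc \<alpha>"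
    using rayset_outerc[of \<alpha>] \<alpha> by auto
  have mok: "ray_ok \<alpha> m" "ray_ok (-\<alpha>) m"
    by (rule ray_ok_vholo[OF mvh _ mT mdec], use ro in simp)+
  define l where "l = (\<lambda>w::complex. (2 / ((w - 1) * (w + 1))) *\<^sub>C u)"
  have \<alpha>': "\<alpha> < pi" using \<alpha> by simp
  note l = log_integral[OF \<alpha>(1) \<alpha>', of u, folded l_def]
  have dec: "p w = k w *\<^sub>C u + \<psi> z *\<^sub>C (m w + l w)" if "w \<in> rayset \<alpha> \<union> rayset (-\<alpha>)" for w
  proof -
    have w: "w \<in> outerc \<alpha>" "w \<in> sector \<phi>" using that ro rs cs by auto
    then have nz: "w - z \<noteq> 0" "w - 1 \<noteq> 0" "w + 1 \<noteq> 0" using mT w1 by auto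
    have "\<psi> w / (w - z) = k w + \<psi> z * ((z - 1) / ((w - z) * (w - 1)) + 2 / ((w - 1) * (w + 1)))"
      using nz by (simp add: k_def q_def divide_simps) (simp add: algebra_simps)
    then show ?thesis unfolding p_def m_def l_def
      by (simp only: scaleC_add_left scaleC_add_right scaleC_scaleC distrib_left)
  qed
  have mlok: "ray_ok b (\<lambda>w. \<psi> z *\<^sub>C (m w + l w))" "ray_ok b (\<lambda>w. m w + l w)" if "b = \<alpha> \<or> b = -\<alpha>" for b
    by (intro ray_ok_linear[OF _ bounded_linear_scaleC_const] ray_ok_add, use mok l(2,3) that in auto)+
  have pr: "ray b p = ray b (\<lambda>w. k w *\<^sub>C u) + \<psi> z *\<^sub>C (ray b m + ray b l) \<and> ray_ok b p" if b: "b = \<alpha> \<or> b = -\<alpha>" for b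
  proof -
    have b1: "ray_ok b (\<lambda>w. k w *\<^sub>C u)" "ray_ok b m" "ray_ok b l" using b kok mok l by auto
    have eq: "p w = k w *\<^sub>C u + \<psi> z *\<^sub>C (m w + l w)" if "w \<in> rayset b" for w using dec[of w] b that by auto
    have "ray b p = ray b (\<lambda>w. k w *\<^sub>C u + \<psi> z *\<^sub>C (m w + l w))" by (rule ray_cong) (rule eq)
    also have "\<dots> = ray b (\<lambda>w. k w *\<^sub>C u) + \<psi> z *\<^sub>C (ray b m + ray b l)"
      using b1 mlok[OF b] by (simp add: ray_add ray_scaleC)
    finally have "ray b p = ray b (\<lambda>w. k w *\<^sub>C u) + \<psi> z *\<^sub>C (ray b m + ray b l)" .
    moreover have "ray_ok b (\<lambda>w. k w *\<^sub>C u + \<psi> z *\<^sub>C (m w + l w))" using b1 mlok[OF b] by (intro ray_ok_add)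
    then have "ray_ok b p" unfolding ray_ok_def decays_def using eq by (simp cong: continuous_on_cong)
    ultimately show ?thesis by simp
  qed
  have "ray (-\<alpha>) p - ray \<alpha> p = \<psi> z *\<^sub>C (ray (-\<alpha>) l - ray \<alpha> l)"
    using pr[of \<alpha>] pr[of "-\<alpha>"] kray mray by (simp add: scaleC_algebra)
  then show "ray (-\<alpha>) p - ray \<alpha> p = (2 * complex_of_real pi * \<i> * \<psi> z) *\<^sub>C u"
    unfolding l(1) by (simp add: scaleC_scaleC mult_ac)
  show "ray_ok \<alpha> p" "ray_ok (-\<alpha>) p" using pr by auto
qed

subsection \<open>Resolvents of sectorial operators\<close>

locale sectorial_operator =
  fixes A :: "'x::{complex_normed_vector,banach} \<Rightarrow> 'x" and V :: "'x set" and \<omega> :: real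
  assumes \<omega>: "0 \<le> \<omega>" "\<omega> < pi" and A_sect: "sectorial \<omega> A V" and A_inv: "invertible_op A V"
begin

definition R :: "complex \<Rightarrow> 'x \<Rightarrow> 'x" where "R z = resolvent A V z"

text \<open>A convenient part of the resolvent set: the complement of the sector, together with
  \<open>0\<close>, which belongs to it by invertibility.\<close>

definition \<rho> :: "complex set" where "\<rho> = insert 0 (outer \<omega>)"

lemma closed_op: "linear_closed_op A V"
proof (cases "\<omega> = 0")
  case True
  then have "sectorial_pos (pi/2) A V" using A_sect by (auto simp: sectorial_def)
  then show ?thesis by (simp add: sectorial_pos_def)
next
  case False then show ?thesis using A_sect by (simp add: sectorial_def sectorial_pos_def)
qed

lemma V_add: "x \<in> V \<Longrightarrow> y \<in> V \<Longrightarrow> x + y \<in> V" and V_scaleC: "x \<in> V \<Longrightarrow> c *\<^sub>C x \<in> V"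
  using closed_op[unfolded linear_closed_op_def, THEN conjunct1] by (simp_all add: complex_subspace_def)

lemma A_add: "x \<in> V \<Longrightarrow> y \<in> V \<Longrightarrow> A (x + y) = A x + A y" and A_scaleC: "x \<in> V \<Longrightarrow> A (c *\<^sub>C x) = c *\<^sub>C A x"
  using closed_op[unfolded linear_closed_op_def, THEN conjunct2, THEN conjunct1]
    closed_op[unfolded linear_closed_op_def, THEN conjunct2, THEN conjunct2, THEN conjunct1] by simp_all

lemma scaleC_m1: "(-1) *\<^sub>C (x::'x) = - x"
  by (simp add: scaleC.minus_left)

lemma V_diff: "x \<in> V \<Longrightarrow> y \<in> V \<Longrightarrow> x - y \<in> V"
  by (metis V_add V_scaleC scaleC_m1 diff_conv_add_uminus)

lemma A_diff: "x \<in> V \<Longrightarrow> y \<in> V \<Longrightarrow> A (x - y) = A x - A y"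
  by (metis A_add A_scaleC V_scaleC scaleC_m1 diff_conv_add_uminus)

lemma outer_facts:
  assumes "\<omega> < \<alpha>"
  obtains M where "M > 0" "\<And>z. z \<in> outerc \<alpha> \<Longrightarrow> z \<in> resolvent_set A V"
    "\<And>z x. z \<in> outerc \<alpha> \<Longrightarrow> norm (z *\<^sub>C R z x) \<le> M * norm x"
proof (cases "\<alpha> \<le> pi")
  case False
  then have "\<not> \<alpha> \<le> \<bar>Arg z\<bar>" for z using Arg_bound[of z] by linarith
  then have "outerc \<alpha> = {}" by (simp add: outerc_def)
  then show ?thesis using that[of 1] by simp
next
  case True
  \<comment> \<open>The resolvent bound holds only outside the closure of a sector wider than the
    spectral one, hence an angle strictly between \<open>\<omega>\<close> and
    \<open>\<alpha>\<close>. \<open>\<omega>'\<close> replaces \<open>\<omega> = 0\<close>, for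
    which sectoriality speaks about all positive angles.\<close>
  define \<psi> where "\<psi> = (\<omega> + \<alpha>) / 2"
  define \<omega>' where "\<omega>' = (if \<omega> = 0 then \<psi> / 2 else \<omega>)"
  have w: "0 < \<omega>'" "\<omega>' < \<psi>" "\<psi> < \<alpha>" "\<psi> < pi" using assms \<omega> True by (auto simp: \<psi>_def \<omega>'_def)
  have pos: "sectorial_pos \<omega>' A V" using A_sect w by (auto simp: sectorial_def \<omega>'_def split: if_splits)
  then obtain C where C: "\<And>l y. l \<notin> closure (sector \<psi>) \<Longrightarrow> norm (l *\<^sub>C resolvent A V l y) \<le> C * norm y"
    unfolding sectorial_pos_def using w by (meson greaterThanLessThan_iff)
  have sp: "spectrum_op A V \<subseteq> closure (sector \<omega>')" using pos by (simp add: sectorial_pos_def)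
  have 1: "z \<notin> closure (sector \<omega>')" "z \<notin> closure (sector \<psi>)" if "z \<in> outerc \<alpha>" for z
    using closure_sector_outer[of \<omega>' z] closure_sector_outer[of \<psi> z] w that by (auto simp: outer_def outerc_def)
  show ?thesis
  proof (rule that[of "\<bar>C\<bar> + 1"])
    fix z and x :: 'x assume "z \<in> outerc \<alpha>"
    show "z \<in> resolvent_set A V" using 1(1)[OF \<open>z \<in> outerc \<alpha>\<close>] sp by (auto simp: spectrum_op_def)
    have "C * norm x \<le> (\<bar>C\<bar> + 1) * norm x" by (intro mult_right_mono) auto
    then show "norm (z *\<^sub>C R z x) \<le> (\<bar>C\<bar> + 1) * norm x" using C[OF 1(2)[OF \<open>z \<in> outerc \<alpha>\<close>], of x] by (simp add: R_def)
  qed simp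
qed

lemma \<rho>_resolvent: "z \<in> \<rho> \<Longrightarrow> z \<in> resolvent_set A V"
proof -
  assume "z \<in> \<rho>"
  then consider "z = 0" | "z \<in> outer \<omega>" by (auto simp: \<rho>_def)
  then show ?thesis
  proof cases
    case 1
    have "bij_betw A V UNIV" using A_inv by (simp add: invertible_op_def)
    then have "bij_betw (uminus \<circ> A) V UNIV" by (rule bij_betw_trans) (rule bij_uminus)
    then show ?thesis using 1 A_inv by (simp add: resolvent_set_def invertible_op_def o_def)
  next
    case 2
    define \<alpha> where "\<alpha> = \<bar>Arg z\<bar>"
    have "\<omega> < \<alpha>" "z \<in> outerc \<alpha>" using 2 by (auto simp: outer_def outerc_def \<alpha>_def)
    then show ?thesis using outer_facts[of \<alpha>] by blast
  qed
qed

lemma resolvent_eqI: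
  assumes "z \<in> \<rho>" "x \<in> V" "z *\<^sub>C x - A x = y" shows "R z y = x"
proof -
  have "bij_betw (\<lambda>x. z *\<^sub>C x - A x) V UNIV" using \<rho>_resolvent[OF assms(1)] by (simp add: resolvent_set_def)
  then have "inj_on (\<lambda>x. z *\<^sub>C x - A x) V" by (simp add: bij_betw_def)
  then show ?thesis unfolding R_def resolvent_def
    by (intro the_equality) (use assms in \<open>auto dest: inj_onD\<close>)
qed

lemma R_in_V: "z \<in> \<rho> \<Longrightarrow> R z y \<in> V" and R_eq: "z \<in> \<rho> \<Longrightarrow> z *\<^sub>C R z y - A (R z y) = y"
proof -
  assume z: "z \<in> \<rho>"
  have "bij_betw (\<lambda>x. z *\<^sub>C x - A x) V UNIV" using \<rho>_resolvent[OF z] by (simp add: resolvent_set_def)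
  then have "y \<in> (\<lambda>x. z *\<^sub>C x - A x) ` V" by (simp add: bij_betw_def)
  then obtain x where "x \<in> V" "z *\<^sub>C x - A x = y" by (elim imageE) simp
  then show "R z y \<in> V" "z *\<^sub>C R z y - A (R z y) = y" using resolvent_eqI[OF z] by auto
qed

lemma R_cancel: "z \<in> \<rho> \<Longrightarrow> x \<in> V \<Longrightarrow> R z (z *\<^sub>C x - A x) = x"
  by (rule resolvent_eqI) auto

lemma R_add: "z \<in> \<rho> \<Longrightarrow> R z (x + y) = R z x + R z y"
proof (rule resolvent_eqI)
  assume z: "z \<in> \<rho>"
  show "z *\<^sub>C (R z x + R z y) - A (R z x + R z y) = x + y"
    using R_eq[OF z, of x] R_eq[OF z, of y] A_add[OF R_in_V[OF z] R_in_V[OF z], of x y]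
    by (simp add: scaleC_add_right algebra_simps)
qed (auto intro: V_add R_in_V)

lemma R_scaleC: "z \<in> \<rho> \<Longrightarrow> R z (c *\<^sub>C x) = c *\<^sub>C R z x"
proof (rule resolvent_eqI)
  assume z: "z \<in> \<rho>"
  have "z *\<^sub>C c *\<^sub>C R z x - A (c *\<^sub>C R z x) = c *\<^sub>C (z *\<^sub>C R z x - A (R z x))"
    using A_scaleC[OF R_in_V[OF z]] by (simp add: scaleC_algebra mult.commute)
  then show "z *\<^sub>C c *\<^sub>C R z x - A (c *\<^sub>C R z x) = c *\<^sub>C x" by (simp add: R_eq[OF z])
qed (auto intro: V_scaleC R_in_V)

lemma R_bounded_linear: "z \<in> \<rho> \<Longrightarrow> bounded_linear (R z)"
proof -
  assume z: "z \<in> \<rho>"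
  obtain C where C: "\<forall>x\<in>V. norm x \<le> C * norm (z *\<^sub>C x - A x)"
    using \<rho>_resolvent[OF z] by (auto simp: resolvent_set_def)
  show ?thesis
  proof
    show "R z (x + y) = R z x + R z y" for x y by (rule R_add[OF z])
    show "R z (r *\<^sub>R x) = r *\<^sub>R R z x" for r x using R_scaleC[OF z] by (simp add: scaleR_scaleC)
    show "\<exists>K. \<forall>x. norm (R z x) \<le> norm x * K"
      using C R_in_V[OF z] R_eq[OF z] by (metis mult.commute)
  qed
qed

lemma R_diff: "z \<in> \<rho> \<Longrightarrow> R z (x - y) = R z x - R z y"
  by (metis R_add R_scaleC scaleC_m1 diff_conv_add_uminus)

lemma resolvent_identity:
  assumes "z \<in> \<rho>" "w \<in> \<rho>" shows "R z x - R w x = (w - z) *\<^sub>C R z (R w x)"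
proof -
  define y where "y = R w x"
  have y: "y \<in> V" "w *\<^sub>C y - A y = x" using R_in_V R_eq assms by (auto simp: y_def)
  have "y = R z (z *\<^sub>C y - A y)" using R_cancel[OF assms(1) y(1)] by simp
  also have "z *\<^sub>C y - A y = x - (w - z) *\<^sub>C y" unfolding y(2)[symmetric] by (simp add: scaleC_algebra)
  also have "R z \<dots> = R z x - (w - z) *\<^sub>C R z y" using assms by (simp add: R_diff R_scaleC)
  finally have "y + (w - z) *\<^sub>C R z y = R z x" by (simp only: eq_diff_eq)
  then show ?thesis unfolding y_def by (metis add_diff_cancel_left')
qed

lemma R_commute:
  assumes "z \<in> \<rho>" "w \<in> \<rho>" shows "R z (R w x) = R w (R z x)"
proof (cases "z = w")
  case False
  have "(w - z) *\<^sub>C R z (R w x) = (w - z) *\<^sub>C R w (R z x)"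
  proof -
    have "(w - z) *\<^sub>C R w (R z x) = - ((z - w) *\<^sub>C R w (R z x))"
      by (simp flip: scaleC.minus_left)
    also have "\<dots> = R z x - R w x" using resolvent_identity[OF assms(2,1), of x, symmetric] by simp
    finally show ?thesis using resolvent_identity[OF assms, of x] by simp
  qed
  then show ?thesis using False by (simp add: scaleC_cancel_left)
qed simp

lemma R_product:
  assumes "z \<in> \<rho>" "w \<in> \<rho>" "z \<noteq> w" shows "R z (R w x) = (1 / (w - z)) *\<^sub>C (R z x - R w x)"
proof -
  have 1: "(1 / (w - z)) * (w - z) = 1" using assms(3) by simp
  have "(1 / (w - z)) *\<^sub>C (R z x - R w x) = (1 / (w - z)) *\<^sub>C ((w - z) *\<^sub>C R z (R w x))"
    by (rule arg_cong[OF resolvent_identity[OF assms(1,2)]])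
  also have "\<dots> = R z (R w x)" unfolding scaleC_scaleC 1 by (rule scaleC_one)
  finally show ?thesis by (rule sym)
qed

text \<open>Sectoriality gives \<open>M / cmod z\<close>, which degenerates at \<open>0\<close>.
  Invertibility repairs this: \<open>R z x = R 0 x - z R z (R 0 x)\<close> bounds the resolvent near
  the origin.\<close>

lemma R_estimate:
  assumes "\<omega> < \<alpha>"
  obtains M where "M > 0" "\<And>z. z \<in> outerc \<alpha> \<Longrightarrow> z \<in> \<rho>"
    "\<And>z x. z \<in> outerc \<alpha> \<Longrightarrow> norm (R z x) \<le> M / (1 + cmod z) * norm x"
proof -
  obtain M where M: "M > 0" "\<And>z. z \<in> outerc \<alpha> \<Longrightarrow> z \<in> resolvent_set A V"
    "\<And>z x. z \<in> outerc \<alpha> \<Longrightarrow> norm (z *\<^sub>C R z x) \<le> M * norm x"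
    by (rule outer_facts[OF assms], rule that)
  obtain C where C: "C > 0" "\<And>x. norm (R 0 x) \<le> C * norm x"
  proof -
    have "bounded_linear (R 0)" by (rule R_bounded_linear) (simp add: \<rho>_def)
    then obtain C where "C > 0" "\<And>x. norm (R 0 x) \<le> norm x * C" using bounded_linear.pos_bounded by blast
    then show ?thesis using that[of C] by (simp add: mult.commute)
  qed
  have \<rho>: "z \<in> \<rho>" if "z \<in> outerc \<alpha>" for z using that assms by (auto simp: \<rho>_def outer_def outerc_def)
  have bd: "norm (R z x) \<le> (M + (1 + M) * C) / (1 + cmod z) * norm x" if z: "z \<in> outerc \<alpha>" for z x
  proof -
    have "R z x = R 0 x - z *\<^sub>C R z (R 0 x)"
    proof -
      have "R z x - R 0 x = - (z *\<^sub>C R z (R 0 x))"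
        using resolvent_identity[OF \<rho>[OF z], of 0 x] by (simp add: \<rho>_def scaleC.minus_left)
      then show ?thesis by (simp only: diff_eq_eq) simp
    qed
    then have "norm (R z x) \<le> norm (R 0 x) + norm (z *\<^sub>C R z (R 0 x))" by (metis norm_triangle_ineq4)
    also have "\<dots> \<le> (1 + M) * norm (R 0 x)" using M(3)[OF z, of "R 0 x"] by (simp add: algebra_simps)
    also have "\<dots> \<le> (1 + M) * (C * norm x)" using C(2) M(1) by (intro mult_left_mono) auto
    finally have "(1 + cmod z) * norm (R z x) \<le> (M + (1 + M) * C) * norm x"
      using M(3)[OF z, of x] by (simp add: norm_scaleC algebra_simps)
    then show ?thesis by (simp add: divide_simps add_nonneg_pos mult.commute add_pos_nonneg)
  qed
  have "M + (1 + M) * C > 0" using M C by (simp add: add_pos_pos)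
  then show ?thesis using \<rho> bd by (rule that)
qed

lemma R_estimate':
  assumes "\<omega> < \<alpha>"
  obtains M where "M > 0" "\<And>z. z \<in> outerc \<alpha> \<Longrightarrow> z \<in> \<rho>"
    "\<And>z x. z \<in> outerc \<alpha> \<Longrightarrow> norm (R z x) \<le> M * norm x"
    "\<And>z x. z \<in> outerc \<alpha> \<Longrightarrow> norm (R z x) \<le> M / cmod z * norm x"
proof -
  obtain M where M: "M > 0" "\<And>z. z \<in> outerc \<alpha> \<Longrightarrow> z \<in> \<rho>"
    "\<And>z x. z \<in> outerc \<alpha> \<Longrightarrow> norm (R z x) \<le> M / (1 + cmod z) * norm x"
    by (rule R_estimate[OF assms], rule that)
  have pos: "1 + cmod z > 0" for z by (simp add: add_pos_nonneg)
  have "M / (1 + cmod z) * norm x \<le> M / 1 * norm x" for z and x :: 'x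
    using M(1) pos[of z] by (intro mult_right_mono divide_left_mono) auto
  moreover have "M / (1 + cmod z) * norm x \<le> M / cmod z * norm x" if "z \<in> outerc \<alpha>" for z and x :: 'x
    using M(1) that pos[of z] by (intro mult_right_mono divide_left_mono) (auto simp: outerc_def intro!: mult_pos_pos)
  ultimately show ?thesis using that[OF M(1,2)] M(3) by (simp add: order_trans[OF M(3)])
qed

text \<open>Two applications of the resolvent identity turn the remainder into
  \<open>(z0 - z)^2\<close> times \<open>R z (R z0 (R z0 x))\<close>, the derivative being
  \<open>- R z (R z x)\<close>. A resolvent bound uniform near \<open>z0\<close> does the
  rest.\<close>

lemma R_vholo: "vholo (outer \<omega>) (\<lambda>z. R z x)"
proof (rule vholo_local[of _ _ "\<lambda>z. - R z (R z x)"])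
  fix z0 assume z0: "z0 \<in> outer \<omega>"
  \<comment> \<open>Halfway between \<open>\<omega>\<close> and the angle of \<open>z0\<close>, so
    that a whole ball around \<open>z0\<close> shares one constant \<open>M\<close>.\<close>
  define \<alpha> where "\<alpha> = (\<omega> + \<bar>Arg z0\<bar>) / 2"
  have \<alpha>: "\<omega> < \<alpha>" "\<alpha> < \<bar>Arg z0\<bar>" using z0 by (auto simp: \<alpha>_def outer_def)
  obtain M where M: "M > 0" "\<And>z. z \<in> outerc \<alpha> \<Longrightarrow> z \<in> \<rho>"
    "\<And>z x. z \<in> outerc \<alpha> \<Longrightarrow> norm (R z x) \<le> M * norm x"
    "\<And>z x. z \<in> outerc \<alpha> \<Longrightarrow> norm (R z x) \<le> M / cmod z * norm x"
    by (rule R_estimate'[OF \<alpha>(1)], rule that)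
  have "open (outer \<alpha>)" using \<alpha> \<omega> Arg_bound[of z0] by (intro open_outer) auto
  moreover have "z0 \<in> outer \<alpha>" using z0 \<alpha> by (auto simp: outer_def)
  ultimately obtain d where d: "d > 0" "ball z0 d \<subseteq> outer \<alpha>" using openE by blast
  have MM: "norm (R z (R z0 y)) \<le> M^2 * norm y" "norm (R z (R z0 (R z0 y))) \<le> M^3 * norm y"
    "norm (R z (R z (R z0 y))) \<le> M^3 * norm y"
    if "z \<in> outerc \<alpha>" "z0 \<in> outerc \<alpha>" for z y
  proof -
    have 1: "norm (R u (R v y)) \<le> M^2 * norm y" if "u \<in> outerc \<alpha>" "v \<in> outerc \<alpha>" for u v y
    proof -
      have "norm (R u (R v y)) \<le> M * norm (R v y)" by (rule M(3)[OF that(1)])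
      also have "\<dots> \<le> M * (M * norm y)" using M that by (intro mult_left_mono) auto
      finally show ?thesis by (simp add: power2_eq_square)
    qed
    have 2: "norm (R s (R u (R v y))) \<le> M^3 * norm y" if "u \<in> outerc \<alpha>" "v \<in> outerc \<alpha>" "s \<in> outerc \<alpha>" for u v s
    proof -
      have "norm (R s (R u (R v y))) \<le> M * norm (R u (R v y))" by (rule M(3)[OF that(3)])
      also have "\<dots> \<le> M * (M^2 * norm y)" using M 1 that by (intro mult_left_mono) auto
      finally show ?thesis by (simp add: power2_eq_square power3_eq_cube)
    qed
    show "norm (R z (R z0 y)) \<le> M^2 * norm y" "norm (R z (R z0 (R z0 y))) \<le> M^3 * norm y"
      "norm (R z (R z (R z0 y))) \<le> M^3 * norm y" using 1 2 that by auto
  qed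
  have z0o: "z0 \<in> outerc \<alpha>" using \<open>z0 \<in> outer \<alpha>\<close> by (auto simp: outer_def outerc_def)
  define C where "C = max (M^3 * norm x) (2 * M^3 * norm x)"
  have "norm (R z x - R z0 x - (z - z0) *\<^sub>C - R z0 (R z0 x)) \<le> C * (cmod (z - z0))\<^sup>2 \<and>
        norm (- R z (R z x) - - R z0 (R z0 x)) \<le> C * cmod (z - z0)" if "cmod (z - z0) < d" for z
  proof -
    have zo: "z \<in> outerc \<alpha>" using d(2) that by (force simp: outer_def outerc_def dist_norm norm_minus_commute)
    have \<rho>: "z \<in> \<rho>" "z0 \<in> \<rho>" using M(2) zo z0o by auto
    have i1: "R z y - R z0 y = (z0 - z) *\<^sub>C R z (R z0 y)" for y by (rule resolvent_identity[OF \<rho>])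
    have neg: "(z - z0) *\<^sub>C - u = (z0 - z) *\<^sub>C u" for u :: 'x
      by (simp add: scaleC.minus_right scaleC.diff_left)
    have "R z x - R z0 x - (z - z0) *\<^sub>C - R z0 (R z0 x) = (z0 - z) *\<^sub>C (R z (R z0 x) - R z0 (R z0 x))"
      by (simp only: i1[of x] neg scaleC.diff_right)
    also have "\<dots> = (z0 - z)^2 *\<^sub>C R z (R z0 (R z0 x))"
      by (simp only: i1 scaleC_scaleC power2_eq_square)
    finally have "norm (R z x - R z0 x - (z - z0) *\<^sub>C - R z0 (R z0 x)) \<le> (cmod (z - z0))\<^sup>2 * (M^3 * norm x)"
      using MM(2)[OF zo z0o, of x] by (simp add: norm_scaleC norm_power norm_minus_commute mult_left_mono)
    also have "\<dots> \<le> (cmod (z - z0))\<^sup>2 * C" by (intro mult_left_mono) (auto simp: C_def)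
    finally have 1: "norm (R z x - R z0 x - (z - z0) *\<^sub>C - R z0 (R z0 x)) \<le> C * (cmod (z - z0))\<^sup>2" by (simp add: mult.commute)
    have "R z (R z x) - R z0 (R z0 x) = R z (R z x - R z0 x) + (R z (R z0 x) - R z0 (R z0 x))"
      by (simp add: R_diff[OF \<rho>(1)])
    also have "\<dots> = (z0 - z) *\<^sub>C (R z (R z (R z0 x)) + R z (R z0 (R z0 x)))"
      by (simp only: i1 R_scaleC[OF \<rho>(1)] scaleC_add_right)
    finally have "norm (R z (R z x) - R z0 (R z0 x)) = cmod (z - z0) * norm (R z (R z (R z0 x)) + R z (R z0 (R z0 x)))"
      by (simp add: norm_scaleC norm_minus_commute)
    also have "\<dots> \<le> cmod (z - z0) * (2 * M^3 * norm x)"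
      using norm_triangle_ineq[of "R z (R z (R z0 x))" "R z (R z0 (R z0 x))"] MM(2,3)[OF zo z0o, of x]
      by (intro mult_left_mono) auto
    also have "\<dots> \<le> cmod (z - z0) * C" by (intro mult_left_mono) (auto simp: C_def)
    finally have "norm (- R z (R z x) - - R z0 (R z0 x)) \<le> C * cmod (z - z0)"
      by (simp add: mult.commute norm_minus_commute)
    then show ?thesis using 1 by simp
  qed
  then show "\<exists>d>0. \<exists>C. \<forall>z. cmod (z - z0) < d \<longrightarrow> norm (R z x - R z0 x - (z - z0) *\<^sub>C - R z0 (R z0 x)) \<le> C * (cmod (z - z0))\<^sup>2 \<and>
        norm (- R z (R z x) - - R z0 (R z0 x)) \<le> C * cmod (z - z0)"
    using d(1) by blast
qed

text \<open>\<open>calc_H\<close> with the half-angle \<open>\<alpha>\<close> of the contour as a free parameter: \<open>frac_pow\<close> and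
  \<open>calc_E\<close> use different contours, which have to be compared.\<close>

definition Q :: "real \<Rightarrow> (complex \<Rightarrow> complex) \<Rightarrow> 'x \<Rightarrow> 'x" where
  "Q \<alpha> h x = (1 / (2 * complex_of_real pi * \<i>)) *\<^sub>C (ray (-\<alpha>) (\<lambda>z. h z *\<^sub>C R z x) - ray \<alpha> (\<lambda>z. h z *\<^sub>C R z x))"

lemma rayset_\<rho>: "\<omega> < \<bar>b\<bar> \<Longrightarrow> \<bar>b\<bar> < pi \<Longrightarrow> z \<in> rayset b \<Longrightarrow> z \<in> \<rho> \<and> z \<in> outerc \<bar>b\<bar> \<and> z \<in> outer \<omega>"
  using rayset_Arg[of b z] by (auto simp: \<rho>_def outer_def outerc_def)

text \<open>The function is holomorphic inside \<open>sector \<phi>\<close>, the resolvent outside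
  the spectral sector. Their common domain between the angles \<open>\<omega>\<close> and
  \<open>\<phi>\<close> is the region through which the contour may be moved.\<close>

lemma annulus_facts:
  fixes x :: 'x
  assumes h: "holo_H \<phi> h" and \<alpha>: "\<omega> < \<alpha>" "\<phi> \<le> pi"
    and T: "T \<subseteq> sector \<phi> \<inter> outerc \<alpha>" 
  shows "vholo (sector \<phi> \<inter> outer \<omega>) (\<lambda>z. h z *\<^sub>C R z x)" "decays T (\<lambda>z. h z *\<^sub>C R z x)"
    "T \<subseteq> sector \<phi> \<inter> outer \<omega>"
proof -
  show "vholo (sector \<phi> \<inter> outer \<omega>) (\<lambda>z. h z *\<^sub>C R z x)"
  proof (cases "\<phi> > 0")
    case True
    show ?thesis
      by (rule vholo_scaleC) (use h \<omega> True \<alpha> R_vholo in 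
        \<open>auto simp: holo_H_def intro: holomorphic_on_subset open_Int open_sector open_outer vholo_subset\<close>)
  next
    case False
    \<comment> \<open>For \<open>\<phi> = 0\<close> the sector is the positive half-line, which is
      not open but does not meet \<open>outer \<omega>\<close>; for negative \<open>\<phi>\<close>
      it is empty.\<close>
    have "sector \<phi> \<inter> outer \<omega> = {}"
      using False \<omega> by (cases "\<phi> = 0") (auto simp: sector_def outer_def)
    then show ?thesis by (auto simp: vholo_def)
  qed
  obtain M where M: "M > 0" "\<And>z. z \<in> outerc \<alpha> \<Longrightarrow> z \<in> \<rho>"
    "\<And>z x. z \<in> outerc \<alpha> \<Longrightarrow> norm (R z x) \<le> M * norm x"
    "\<And>z x. z \<in> outerc \<alpha> \<Longrightarrow> norm (R z x) \<le> M / cmod z * norm x"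
    by (rule R_estimate'[OF \<alpha>(1)], rule that)
  show "decays T (\<lambda>z. h z *\<^sub>C R z x)"
  proof (rule holo_H_decays[OF h, of _ _ "M * norm x"])
    fix z assume "z \<in> T"
    then have "cmod (h z) * norm (R z x) \<le> cmod (h z) * (M / cmod z * norm x)" using M(4) T by (intro mult_left_mono) auto
    then show "norm (h z *\<^sub>C R z x) \<le> M * norm x * (cmod (h z) / cmod z)" by (simp add: norm_scaleC mult_ac)
  qed (use T in auto)
  show "T \<subseteq> sector \<phi> \<inter> outer \<omega>" using T \<alpha> by (force simp: outer_def outerc_def)
qed

lemma Q_ray_ok:
  fixes x :: 'x
  assumes h: "holo_H \<phi> h" and b: "\<omega> < \<bar>b\<bar>" "\<bar>b\<bar> < \<phi>" "\<phi> \<le> pi"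
  shows "ray_ok b (\<lambda>z. h z *\<^sub>C R z x)"
proof -
  have T: "rayset b \<subseteq> sector \<phi> \<inter> outerc \<bar>b\<bar>" 
    unfolding rayset_def using b \<omega> by (auto intro!: polar_in_sector polar_in_outerc simp del: cis_neq_zero)
  show ?thesis
    by (rule ray_ok_vholo[OF _ order.refl]) (rule annulus_facts[OF h b(1,3) T])+
qed

lemma Q_angle:
  fixes x :: 'x
  assumes h: "holo_H \<phi> h" and \<alpha>: "\<omega> < \<alpha>" "\<alpha> \<le> \<beta>" "\<beta> < \<phi>" "\<phi> \<le> pi"
  shows "Q \<alpha> h x = Q \<beta> h x"
proof -
  define T where "T = sector \<phi> \<inter> outerc \<alpha>"
  have "T \<subseteq> sector \<phi> \<inter> outerc \<alpha>" by (simp add: T_def)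
  note * = annulus_facts(1,2)[OF h \<alpha>(1) \<alpha>(4) this, of x] annulus_facts(3)[OF h \<alpha>(1) \<alpha>(4) this]
  have inT: "complex_of_real r * cis a \<in> T" if "r > 0" "\<alpha> \<le> \<bar>a\<bar>" "\<bar>a\<bar> \<le> \<beta>" for r a
    using that \<alpha> \<omega> by (auto simp: T_def intro!: polar_in_sector polar_in_outerc)
  have "ray \<alpha> (\<lambda>z. h z *\<^sub>C R z x) = ray \<beta> (\<lambda>z. h z *\<^sub>C R z x)"
    by (rule ray_rotate[OF *(1) _ *(3,2)]) (use \<alpha> \<omega> in \<open>auto simp: T_def[symmetric] intro!: inT\<close>)
  moreover have "ray (-\<beta>) (\<lambda>z. h z *\<^sub>C R z x) = ray (-\<alpha>) (\<lambda>z. h z *\<^sub>C R z x)"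
    by (rule ray_rotate[OF *(1) _ *(3,2)]) (use \<alpha> \<omega> in \<open>auto simp: T_def[symmetric] intro!: inT\<close>)
  ultimately show ?thesis by (simp add: Q_def)
qed

lemma Q_bounded_linear:
  assumes h: "holo_H \<phi> h" and \<alpha>: "\<omega> < \<alpha>" "\<alpha> < \<phi>" "\<phi> \<le> pi"
  shows "Q \<alpha> h (x + y) = Q \<alpha> h x + Q \<alpha> h y" "Q \<alpha> h (c *\<^sub>C x) = c *\<^sub>C Q \<alpha> h x" 
    "\<mu> \<in> \<rho> \<Longrightarrow> Q \<alpha> h (R \<mu> x) = R \<mu> (Q \<alpha> h x)"
proof -
  have ok: "ray_ok b (\<lambda>z. h z *\<^sub>C R z x)" if "b = \<alpha> \<or> b = -\<alpha>" for b x
    by (rule Q_ray_ok[OF h]) (use that \<alpha> \<omega> in auto)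
  have \<rho>: "z \<in> \<rho>" if "b = \<alpha> \<or> b = -\<alpha>" "z \<in> rayset b" for z b
    using rayset_\<rho>[of b z] that \<alpha> \<omega> by auto
  have 1: "ray b (\<lambda>z. h z *\<^sub>C R z (x + y)) = ray b (\<lambda>z. h z *\<^sub>C R z x) + ray b (\<lambda>z. h z *\<^sub>C R z y)" if b: "b = \<alpha> \<or> b = -\<alpha>" for b
    unfolding ray_add[OF ok[OF b] ok[OF b], symmetric]
    by (rule ray_cong) (simp add: R_add[OF \<rho>[OF b]] scaleC_add_right)
  show "Q \<alpha> h (x + y) = Q \<alpha> h x + Q \<alpha> h y" by (simp add: Q_def 1 scaleC_algebra)
  have 2: "ray b (\<lambda>z. h z *\<^sub>C R z (c *\<^sub>C x)) = c *\<^sub>C ray b (\<lambda>z. h z *\<^sub>C R z x)" if b: "b = \<alpha> \<or> b = -\<alpha>" for b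
    unfolding ray_scaleC[OF ok[OF b], symmetric]
    by (rule ray_cong) (simp add: R_scaleC[OF \<rho>[OF b]] scaleC_scaleC mult.commute)
  show "Q \<alpha> h (c *\<^sub>C x) = c *\<^sub>C Q \<alpha> h x" by (simp add: Q_def 2 scaleC_algebra mult.commute)
  assume \<mu>: "\<mu> \<in> \<rho>"
  have 3: "ray b (\<lambda>z. h z *\<^sub>C R z (R \<mu> x)) = R \<mu> (ray b (\<lambda>z. h z *\<^sub>C R z x))" if b: "b = \<alpha> \<or> b = -\<alpha>" for b
    unfolding ray_linear[OF ok[OF b] R_bounded_linear[OF \<mu>] R_scaleC[OF \<mu>], symmetric]
    by (rule ray_cong) (simp add: R_scaleC[OF \<mu>] R_commute[OF \<rho>[OF b] \<mu>])
  show "Q \<alpha> h (R \<mu> x) = R \<mu> (Q \<alpha> h x)" by (simp add: Q_def 3 R_scaleC[OF \<mu>] R_diff[OF \<mu>])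
qed

text \<open>The resolvent bound \<open>M / cmod z\<close> scales like \<open>dr / r\<close>, so
  dilating \<open>h\<close> shifts the majorant along the ray without changing its integral. Hence
  \<open>K\<close> can be chosen before \<open>t\<close>.\<close>

lemma Q_estimate:
  assumes h: "holo_H \<phi> h" and \<alpha>: "\<omega> < \<alpha>" "\<alpha> < \<phi>" "\<phi> \<le> pi"
  obtains K where "K \<ge> 0" "\<And>t x. t > 0 \<Longrightarrow> norm (Q \<alpha> (\<lambda>z. h (complex_of_real t * z)) x) \<le> K * norm x"
proof -
  obtain C b where C: "C > 0" "b > 0" and Cb: "\<And>z. z \<in> sector \<phi> \<Longrightarrow> cmod (h z) \<le> C * min (cmod z powr b) (cmod z powr - b)"
    and hol: "h holomorphic_on sector \<phi>"
    using h unfolding holo_H_def by auto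
  obtain M where M: "M > 0" "\<And>z. z \<in> outerc \<alpha> \<Longrightarrow> z \<in> \<rho>"
    "\<And>z x. z \<in> outerc \<alpha> \<Longrightarrow> norm (R z x) \<le> M * norm x"
    "\<And>z x. z \<in> outerc \<alpha> \<Longrightarrow> norm (R z x) \<le> M / cmod z * norm x"
    by (rule R_estimate'[OF \<alpha>(1)], rule that)
  define K where "K = 2 * (C * M * (pi / b))"
  have ray: "norm (ray \<beta> (\<lambda>z. h (complex_of_real t * z) *\<^sub>C R z x)) \<le> (C * M * norm x) * (pi / b)"
    if \<beta>: "\<beta> = \<alpha> \<or> \<beta> = -\<alpha>" and t: "t > 0" for \<beta> t x
  proof (rule ray_bounds(1)[OF _ _ C(2) t])
    have sec: "complex_of_real t * z \<in> sector \<phi>" "z \<in> outerc \<alpha>" "z \<in> outer \<omega>" if "z \<in> rayset \<beta>" for z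
    proof -
      have z: "z \<noteq> 0 \<and> Arg z = \<beta>" using rayset_Arg[of \<beta> z] \<beta> \<alpha> \<omega> that by auto
      then have "Arg (complex_of_real t * z) = \<beta>" using t by simp
      then show "complex_of_real t * z \<in> sector \<phi>" using z t \<beta> \<alpha> \<omega> by (auto simp: mem_sector)
      show "z \<in> outerc \<alpha>" "z \<in> outer \<omega>" using z \<beta> \<alpha> \<omega> by (auto simp: outerc_def outer_def)
    qed
    show "continuous_on (rayset \<beta>) (\<lambda>z. h (complex_of_real t * z) *\<^sub>C R z x)"
    proof (rule scaleC.continuous_on)
      show "continuous_on (rayset \<beta>) (\<lambda>z. h (complex_of_real t * z))"
        by (rule continuous_on_compose2[OF holomorphic_on_imp_continuous_on[OF hol]]) (use sec in \<open>auto intro!: continuous_intros\<close>)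
      show "continuous_on (rayset \<beta>) (\<lambda>z. R z x)"
        by (rule continuous_on_subset[OF vholo_continuous[OF R_vholo]]) (use sec in auto)
    qed
    fix z assume z: "z \<in> rayset \<beta>"
    have "norm (h (complex_of_real t * z) *\<^sub>C R z x) \<le> (C * min ((t * cmod z) powr b) ((t * cmod z) powr - b)) * (M / cmod z * norm x)"
      unfolding norm_scaleC using Cb[OF sec(1)[OF z]] M(4)[OF sec(2)[OF z], of x] t C(1)
      by (intro mult_mono) (auto simp: norm_mult)
    then show "norm (h (complex_of_real t * z) *\<^sub>C R z x) \<le> C * M * norm x * min ((t * cmod z) powr b) ((t * cmod z) powr - b) / cmod z"
      by (simp add: mult_ac)
  qed (use C M in auto)
  have "norm (Q \<alpha> (\<lambda>z. h (complex_of_real t * z)) x) \<le> K * norm x" if t: "t > 0" for t x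
  proof -
    define u v where "u = ray (-\<alpha>) (\<lambda>z. h (complex_of_real t * z) *\<^sub>C R z x)" and "v = ray \<alpha> (\<lambda>z. h (complex_of_real t * z) *\<^sub>C R z x)"
    have "norm u \<le> (C * M * norm x) * (pi / b)" "norm v \<le> (C * M * norm x) * (pi / b)"
      using ray[OF _ t] by (auto simp: u_def v_def)
    moreover have "K * norm x = (C * M * norm x) * (pi / b) + (C * M * norm x) * (pi / b)"
      by (simp add: K_def)
    ultimately have uv: "norm (u - v) \<le> K * norm x" using norm_triangle_ineq4[of u v] by linarith
    have "norm (Q \<alpha> (\<lambda>z. h (complex_of_real t * z)) x) = 1 / (2 * pi) * norm (u - v)"
      by (simp add: Q_def u_def v_def norm_scaleC norm_divide norm_mult)
    also have "\<dots> \<le> 1 * norm (u - v)" using pi_gt3 by (intro mult_right_mono) auto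
    finally show ?thesis using uv by simp
  qed
  then show ?thesis using that[of K] C M by (simp add: K_def)
qed

end

subsection \<open>Multiplicativity of the functional calculus\<close>

lemma holo_HI:
  assumes "h holomorphic_on sector \<phi>" "b > 0"
    "\<And>z. z \<in> sector \<phi> \<Longrightarrow> cmod (h z) \<le> C * min (cmod z powr b) (cmod z powr - b)"
  shows "holo_H \<phi> h"
proof -
  have "C * min (cmod z powr b) (cmod z powr - b) \<le> (\<bar>C\<bar> + 1) * min (cmod z powr b) (cmod z powr - b)" for z
    by (intro mult_right_mono) auto
  then have "\<forall>z\<in>sector \<phi>. cmod (h z) \<le> (\<bar>C\<bar> + 1) * min (cmod z powr b) (cmod z powr - b)"
    using assms(3) order_trans by blast
  moreover have "\<bar>C\<bar> + 1 > 0" by simp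
  ultimately show ?thesis using assms(1,2) unfolding holo_H_def by blast
qed

lemma holo_H_bounded_mult:
  assumes "holo_H \<phi> h" "g holomorphic_on sector \<phi>" "\<And>z. z \<in> sector \<phi> \<Longrightarrow> cmod (g z) \<le> B"
  shows "holo_H \<phi> (\<lambda>z. g z * h z)"
proof -
  obtain C b where C: "C > 0" "b > 0" "h holomorphic_on sector \<phi>"
    "\<And>z. z \<in> sector \<phi> \<Longrightarrow> cmod (h z) \<le> C * min (cmod z powr b) (cmod z powr - b)"
    using assms(1) unfolding holo_H_def by blast
  show ?thesis
  proof (rule holo_HI[OF holomorphic_on_mult[OF assms(2) C(3)] C(2)])
    fix z assume z: "z \<in> sector \<phi>"
    have "0 \<le> B" using assms(3)[OF z] norm_ge_zero order_trans by blast
    then show "cmod (g z * h z) \<le> B * C * min (cmod z powr b) (cmod z powr - b)"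
      unfolding norm_mult using mult_mono[OF assms(3)[OF z] C(4)[OF z]] by (simp add: mult.assoc)
  qed
qed

lemma holo_H_mult: "holo_H \<phi> g \<Longrightarrow> holo_H \<phi> h \<Longrightarrow> holo_H \<phi> (\<lambda>z. g z * h z)"
  by (rule holo_H_bounded[of \<phi> g]) (auto intro: holo_H_bounded_mult simp: holo_H_def[of \<phi> g])

lemma holo_H_cmult: "holo_H \<phi> h \<Longrightarrow> holo_H \<phi> (\<lambda>z. c * h z)"
  by (rule holo_H_bounded_mult[of _ _ _ "cmod c"]) auto

lemma holo_H_add:
  assumes "holo_H \<phi> g" "holo_H \<phi> h" shows "holo_H \<phi> (\<lambda>z. g z + h z)"
proof -
  obtain C b where C: "C > 0" "b > 0" "g holomorphic_on sector \<phi>"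
    "\<And>z. z \<in> sector \<phi> \<Longrightarrow> cmod (g z) \<le> C * min (cmod z powr b) (cmod z powr - b)"
    using assms(1) unfolding holo_H_def by blast
  obtain D d where D: "D > 0" "d > 0" "h holomorphic_on sector \<phi>"
    "\<And>z. z \<in> sector \<phi> \<Longrightarrow> cmod (h z) \<le> D * min (cmod z powr d) (cmod z powr - d)"
    using assms(2) unfolding holo_H_def by blast
  define e where "e = min b d"
  show ?thesis
  proof (rule holo_HI[OF holomorphic_on_add[OF C(3) D(3)], of e "C + D"])
    fix z assume z: "z \<in> sector \<phi>"
    then have z0: "cmod z > 0" by (auto simp: sector_def split: if_splits)
    have "C * min (cmod z powr b) (cmod z powr - b) \<le> C * min (cmod z powr e) (cmod z powr - e)"
      "D * min (cmod z powr d) (cmod z powr - d) \<le> D * min (cmod z powr e) (cmod z powr - e)"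
      using C D z0 by (intro mult_left_mono min_powr_antimono; simp add: e_def)+
    then show "cmod (g z + h z) \<le> (C + D) * min (cmod z powr e) (cmod z powr - e)"
      using C(4)[OF z] D(4)[OF z] norm_triangle_ineq[of "g z" "h z"] by (simp add: distrib_right)
  qed (use C D in \<open>simp add: e_def\<close>)
qed

lemma sector_scale: "t > 0 \<Longrightarrow> \<phi> > 0 \<Longrightarrow> z \<in> sector \<phi> \<Longrightarrow> complex_of_real t * z \<in> sector \<phi>"
  by (simp add: mem_sector)

lemma holomorphic_scale:
  assumes "f holomorphic_on sector \<phi>" "t > 0" "\<phi> > 0"
  shows "(\<lambda>z. f (complex_of_real t * z)) holomorphic_on sector \<phi>"
proof -
  have "(\<lambda>z. complex_of_real t * z) ` sector \<phi> \<subseteq> sector \<phi>" using sector_scale assms by auto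
  then show ?thesis
    using holomorphic_on_compose_gen[of "\<lambda>z. complex_of_real t * z" "sector \<phi>" f "sector \<phi>"] assms
    by (auto simp: o_def intro!: holomorphic_intros)
qed

text \<open>The constant found here depends on \<open>t\<close>; membership alone is at stake.
  Bounds uniform in \<open>t\<close> come from \<open>Q_estimate\<close>, which works with the
  undilated function.\<close>

lemma holo_H_scale:
  assumes "holo_H \<phi> h" "t > 0" "\<phi> > 0"
  shows "holo_H \<phi> (\<lambda>z. h (complex_of_real t * z))"
proof -
  obtain C b where C: "C > 0" "b > 0" "h holomorphic_on sector \<phi>"
    "\<And>z. z \<in> sector \<phi> \<Longrightarrow> cmod (h z) \<le> C * min (cmod z powr b) (cmod z powr - b)"
    using assms(1) unfolding holo_H_def by blast
  show ?thesis
  proof (rule holo_HI[OF holomorphic_scale[OF C(3) assms(2,3)] C(2)])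
    fix z assume z: "z \<in> sector \<phi>"
    have "cmod (h (complex_of_real t * z)) \<le> C * min ((t * cmod z) powr b) ((t * cmod z) powr - b)"
      using C(4)[OF sector_scale[OF assms(2,3) z]] assms(2) by (simp add: norm_mult)
    also have "min ((t * cmod z) powr b) ((t * cmod z) powr - b) \<le> max (t powr b) (t powr - b) * min (cmod z powr b) (cmod z powr - b)"
    proof -
      have "t powr b * cmod z powr b \<le> max (t powr b) (t powr - b) * cmod z powr b" 
        "t powr - b * cmod z powr - b \<le> max (t powr b) (t powr - b) * cmod z powr - b"
        by (intro mult_right_mono; simp)+
      then show ?thesis using assms(2) by (auto simp: powr_mult min_def)
    qed
    finally show "cmod (h (complex_of_real t * z)) \<le> C * max (t powr b) (t powr - b) * min (cmod z powr b) (cmod z powr - b)"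
      using C(1) by (simp add: mult.assoc mult_left_mono)
  qed
qed

lemma sector_not_nonpos: "0 < \<phi> \<Longrightarrow> \<phi> \<le> pi \<Longrightarrow> z \<in> sector \<phi> \<Longrightarrow> z \<notin> \<real>\<^sub>\<le>\<^sub>0"
  by (auto simp: mem_sector elim!: nonpos_Reals_cases split: if_splits)

lemma norm_powr_of_real: "cmod (z powr complex_of_real p) = cmod z powr p"
  using norm_powr_real_powr'[of "complex_of_real p" z] by simp

text \<open>The function behaves like \<open>z^p\<close> at \<open>0\<close> and like
  \<open>z^(p-q)\<close> at infinity; \<open>\<phi> < pi\<close> makes the denominator comparable to
  the power \<open>q\<close> of \<open>1 + cmod z\<close>.\<close>

lemma holo_H_powr:
  assumes "0 < p" "p < real q" "0 < \<phi>" "\<phi> < pi"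
  shows "holo_H \<phi> (\<lambda>z. z powr complex_of_real p / (1 + z) ^ q)"
proof -
  obtain c where c: "c > 0" "\<And>z. \<bar>Arg z\<bar> \<le> \<phi> \<Longrightarrow> c * (1 + cmod z) \<le> cmod (1 + z)"
    using one_plus_bound[of \<phi>] assms by auto
  define b where "b = min p (real q - p)"
  show ?thesis
  proof (rule holo_HI[of _ _ b "1 / c ^ q"])
    show "(\<lambda>z. z powr complex_of_real p / (1 + z) ^ q) holomorphic_on sector \<phi>"
      using assms sector_not_nonpos[of \<phi>] one_plus_nz by (auto intro!: holomorphic_intros simp: mem_sector)
    show b0: "b > 0" using assms by (simp add: b_def)
    have b1: "b \<le> p" "b \<le> real q - p" by (auto simp: b_def)
    fix z assume z: "z \<in> sector \<phi>"
    define r where "r = cmod z"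
    have r: "r > 0" using z assms by (auto simp: mem_sector r_def)
    have "c * (1 + r) \<le> cmod (1 + z)" using c(2)[of z] z assms by (auto simp: mem_sector r_def)
    then have "(c * (1 + r)) ^ q \<le> cmod (1 + z) ^ q" using c(1) r by (intro power_mono) auto
    moreover have "(c * (1 + r)) ^ q > 0" using c(1) r by simp
    ultimately have "cmod (z powr complex_of_real p / (1 + z) ^ q) \<le> r powr p / (c * (1 + r)) ^ q"
      unfolding norm_divide norm_power norm_powr_of_real r_def[symmetric] by (intro divide_left_mono mult_pos_pos) auto
    also have "\<dots> = 1 / c ^ q * (r powr p / (1 + r) ^ q)" by (simp add: power_mult_distrib)
    also have "\<dots> \<le> 1 / c ^ q * min (r powr b) (r powr - b)"
    proof (rule mult_left_mono)
      have q1: "1 \<le> (1 + r) ^ q" using r by simp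
      have q2: "r ^ q \<le> (1 + r) ^ q" using r by (intro power_mono) auto
      have 1: "r powr p / (1 + r) ^ q \<le> r powr p" using q1 r by (simp add: divide_le_eq mult_le_cancel_left1)
      have "r powr p / (1 + r) ^ q \<le> r powr p / r ^ q" using q2 r by (intro divide_left_mono mult_pos_pos) auto
      also have "\<dots> = r powr (p - real q)" using r by (simp add: powr_diff powr_realpow)
      finally have 2: "r powr p / (1 + r) ^ q \<le> r powr (p - real q)" .
      show "r powr p / (1 + r) ^ q \<le> min (r powr b) (r powr - b)"
      proof (cases "r \<le> 1")
        case True
        then have "r powr p \<le> r powr b" "r powr b \<le> r powr - b" using r b0 b1 by (intro powr_mono'; linarith)+
        then show ?thesis using 1 by simp
      next
        case False
        then have "r powr (p - real q) \<le> r powr - b" "r powr - b \<le> r powr b" using b0 b1 by (intro powr_mono; linarith)+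
        then show ?thesis using 2 by simp
      qed
    qed (use c in simp)
    finally show "cmod (z powr complex_of_real p / (1 + z) ^ q) \<le> 1 / c ^ q * min (cmod z powr b) (cmod z powr - b)"
      by (simp add: r_def)
  qed
qed

text \<open>One half-angle \<open>\<alpha>\<close> serves the whole calculus. The strict inequality
  \<open>\<omega> < \<alpha>\<close> leaves room for the inner contour of the product
  formula.\<close>

locale sectorial_calculus = sectorial_operator A V \<omega>
  for A :: "'x::{complex_normed_vector,banach} \<Rightarrow> 'x" and V \<omega> +
  fixes \<phi> \<alpha> :: real
  assumes angles: "\<omega> < \<alpha>" "\<alpha> < \<phi>" "\<phi> < pi"
begin

lemma angle_pos: "0 < \<alpha>" "0 < \<phi>" "\<phi> \<le> pi"
  using angles \<omega> by auto

lemma Q_cong: "(\<And>z. z \<in> sector \<phi> \<Longrightarrow> g z = h z) \<Longrightarrow> Q \<alpha> g x = Q \<alpha> h x"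
proof -
  assume gh: "\<And>z. z \<in> sector \<phi> \<Longrightarrow> g z = h z"
  have "rayset \<beta> \<subseteq> sector \<phi>" if "\<beta> = \<alpha> \<or> \<beta> = -\<alpha>" for \<beta>
    using that angles angle_pos unfolding rayset_def by (auto intro!: polar_in_sector)
  then have "ray \<beta> (\<lambda>z. g z *\<^sub>C R z x) = ray \<beta> (\<lambda>z. h z *\<^sub>C R z x)" if "\<beta> = \<alpha> \<or> \<beta> = -\<alpha>" for \<beta>
    using that by (intro ray_cong) (simp add: gh subset_iff)
  then show ?thesis by (simp add: Q_def)
qed

lemma calc_ray_ok: "holo_H \<phi> h \<Longrightarrow> \<beta> = \<alpha> \<or> \<beta> = -\<alpha> \<Longrightarrow> ray_ok \<beta> (\<lambda>z. h z *\<^sub>C R z x)"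
  by (rule Q_ray_ok) (use angles angle_pos in auto)

lemma rayset_facts:
  assumes "\<beta> = \<alpha> \<or> \<beta> = -\<alpha>" "z \<in> rayset \<beta>"
  shows "z \<in> \<rho>" "z \<in> sector \<phi>" "z \<in> outerc \<alpha>"
proof -
  have "z \<in> \<rho> \<and> z \<in> outerc \<bar>\<beta>\<bar>" using rayset_\<rho>[of \<beta> z] assms angles angle_pos by auto
  then show "z \<in> \<rho>" "z \<in> outerc \<alpha>" using assms angle_pos by auto
  show "z \<in> sector \<phi>" using assms angles angle_pos unfolding rayset_def by (auto intro!: polar_in_sector)
qed

lemma Q_add: "holo_H \<phi> g \<Longrightarrow> holo_H \<phi> h \<Longrightarrow> Q \<alpha> (\<lambda>z. g z + h z) x = Q \<alpha> g x + Q \<alpha> h x"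
  using ray_add[OF calc_ray_ok[of g \<alpha> x] calc_ray_ok[of h \<alpha> x]] ray_add[OF calc_ray_ok[of g "-\<alpha>" x] calc_ray_ok[of h "-\<alpha>" x]]
  by (simp add: Q_def scaleC_algebra)

lemma Q_cmult: "holo_H \<phi> h \<Longrightarrow> Q \<alpha> (\<lambda>z. c * h z) x = c *\<^sub>C Q \<alpha> h x"
  using ray_scaleC[OF calc_ray_ok[of h \<alpha> x], of c] ray_scaleC[OF calc_ray_ok[of h "-\<alpha>" x], of c]
  by (simp add: Q_def scaleC_algebra mult.commute)

lemma Q_linear:
  assumes "holo_H \<phi> h"
  shows "Q \<alpha> h (x + y) = Q \<alpha> h x + Q \<alpha> h y" "Q \<alpha> h (c *\<^sub>C x) = c *\<^sub>C Q \<alpha> h x" "Q \<alpha> h (x - y) = Q \<alpha> h x - Q \<alpha> h y"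
    "\<mu> \<in> \<rho> \<Longrightarrow> Q \<alpha> h (R \<mu> x) = R \<mu> (Q \<alpha> h x)"
proof -
  note * = Q_bounded_linear[OF assms angles(1,2) angle_pos(3)]
  show 1: "Q \<alpha> h (x + y) = Q \<alpha> h x + Q \<alpha> h y" "Q \<alpha> h (c *\<^sub>C x) = c *\<^sub>C Q \<alpha> h x" for x y c using * by auto
  show "Q \<alpha> h (x - y) = Q \<alpha> h x - Q \<alpha> h y" by (metis 1 scaleC_m1 diff_conv_add_uminus)
  show "\<mu> \<in> \<rho> \<Longrightarrow> Q \<alpha> h (R \<mu> x) = R \<mu> (Q \<alpha> h x)" using * by auto
qed

text \<open>Instead of Fubini's theorem the proof uses that the Cauchy transform of the inner integrand
  is holomorphic inside the outer contour.\<close>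

lemma Q_mult_nested:
  assumes h1: "holo_H \<phi> h1" and h2: "holo_H \<phi> h2" and \<beta>: "\<omega> < \<beta>" "\<beta> < \<alpha>"
  shows "Q \<beta> h1 (Q \<alpha> h2 x) = Q \<beta> (\<lambda>z. h1 z * h2 z) x"
proof -
  define c where "c = 1 / (2 * complex_of_real pi * \<i>)"
  define k where "k = (\<lambda>w. h2 w *\<^sub>C R w x)"
  \<comment> \<open>\<open>N b\<close> is the Cauchy transform of the integrand of \<open>h2\<close>
    along one ray; up to a constant, \<open>G\<close> is \<open>h1\<close> times the part of
    \<open>R z (Q \<alpha> h2 x)\<close> that is not a multiple of \<open>R z x\<close>.\<close>
  define N where "N b z = ray b (\<lambda>w. (1 / (w - z)) *\<^sub>C k w)" for b z
  define G where "G z = h1 z *\<^sub>C (N (-\<alpha>) z - N \<alpha> z)" for z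
  have kok: "ray_ok b k" if "b = \<alpha> \<or> b = -\<alpha>" for b unfolding k_def by (rule calc_ray_ok[OF h2 that])
  have \<beta>0: "0 \<le> \<beta>" "\<beta> < \<phi>" using \<beta> \<omega> angles by auto
  have "\<exists>L. \<forall>z\<in>closed_sector \<beta>. norm (N b z) \<le> L / cmod z \<and> ray_ok b (\<lambda>w. (1 / (w - z)) *\<^sub>C k w)" if b: "b = \<alpha> \<or> b = -\<alpha>" for b
  proof -
    have "\<beta> < \<bar>b\<bar>" "\<bar>b\<bar> < pi" using b \<beta> angles angle_pos by auto
    from cauchy_transform_bound[OF kok[OF b] \<beta>0(1) this]
    obtain L where "\<And>z. z \<in> closed_sector \<beta> \<Longrightarrow> norm (ray b (\<lambda>w. (1 / (w - z)) *\<^sub>C k w)) \<le> L / cmod z"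
      "\<And>z. z \<in> closed_sector \<beta> \<Longrightarrow> ray_ok b (\<lambda>w. (1 / (w - z)) *\<^sub>C k w)" by metis
    then show ?thesis unfolding N_def by blast
  qed
  then have "\<forall>b. \<exists>L. b = \<alpha> \<or> b = -\<alpha> \<longrightarrow> (\<forall>z\<in>closed_sector \<beta>. norm (N b z) \<le> L / cmod z \<and> ray_ok b (\<lambda>w. (1 / (w - z)) *\<^sub>C k w))" by blast
  from choice[OF this] obtain L where L0: "\<forall>b. b = \<alpha> \<or> b = -\<alpha> \<longrightarrow> (\<forall>z\<in>closed_sector \<beta>. norm (N b z) \<le> L b / cmod z \<and> ray_ok b (\<lambda>w. (1 / (w - z)) *\<^sub>C k w))" by blast
  have L: "\<And>b z. b = \<alpha> \<or> b = -\<alpha> \<Longrightarrow> z \<in> closed_sector \<beta> \<Longrightarrow> norm (N b z) \<le> L b / cmod z"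
    "\<And>b z. b = \<alpha> \<or> b = -\<alpha> \<Longrightarrow> z \<in> closed_sector \<beta> \<Longrightarrow> ray_ok b (\<lambda>w. (1 / (w - z)) *\<^sub>C k w)"
    using L0 by auto
  \<comment> \<open>Partial fractions of the resolvent product: the terms with \<open>R z x\<close>
    are summed by Cauchy's formula, as \<open>z\<close> lies inside the outer contour, and the terms
    with \<open>R w x\<close> form the Cauchy transforms.\<close>
  have pt: "R z (Q \<alpha> h2 x) = h2 z *\<^sub>C R z x - c *\<^sub>C (N (-\<alpha>) z - N \<alpha> z)"
    if z: "z \<in> closed_sector \<beta>" "z \<in> \<rho>" for z
  proof -
    have z': "z \<noteq> 0" "\<bar>Arg z\<bar> < \<alpha>" using z(1) \<beta> by (auto simp: closed_sector_def)
    define p where "p w = (h2 w / (w - z)) *\<^sub>C R z x" for w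
    note cf = cauchy_formula[OF h2 angle_pos(1) angles(2,3) z', of "R z x", folded p_def]
    have rb: "ray b (\<lambda>w. R z (k w)) = ray b p - N b z" if b: "b = \<alpha> \<or> b = -\<alpha>" for b
    proof -
      have "ray b (\<lambda>w. R z (k w)) = ray b (\<lambda>w. p w - (1 / (w - z)) *\<^sub>C k w)"
      proof (rule ray_cong)
        fix w assume w: "w \<in> rayset b"
        note wf = rayset_facts[OF b w]
        have zw: "z \<noteq> w" using wf(3) z' by (auto simp: outerc_def)
        have "R z (k w) = h2 w *\<^sub>C ((1 / (w - z)) *\<^sub>C (R z x - R w x))"
          unfolding k_def by (simp only: R_scaleC[OF z(2)] R_product[OF z(2) wf(1) zw])
        then show "R z (k w) = p w - (1 / (w - z)) *\<^sub>C k w"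
          by (simp add: p_def k_def scaleC_algebra)
      qed
      also have "\<dots> = ray b p - N b z"
        unfolding N_def by (rule ray_diff) (use cf b L(2)[OF b z(1)] in auto)
      finally show ?thesis .
    qed
    have "R z (Q \<alpha> h2 x) = c *\<^sub>C (ray (-\<alpha>) (\<lambda>w. R z (k w)) - ray \<alpha> (\<lambda>w. R z (k w)))"
      unfolding Q_def c_def[symmetric] k_def[symmetric]
      using ray_linear[OF kok R_bounded_linear[OF z(2)] R_scaleC[OF z(2)]]
      by (simp add: R_scaleC[OF z(2)] R_diff[OF z(2)])
    also have "\<dots> = c *\<^sub>C ((ray (-\<alpha>) p - ray \<alpha> p) - (N (-\<alpha>) z - N \<alpha> z))"
      by (simp only: rb simp_thms) (simp add: algebra_simps)
    also have "\<dots> = (c * (2 * complex_of_real pi * \<i> * h2 z)) *\<^sub>C R z x - c *\<^sub>C (N (-\<alpha>) z - N \<alpha> z)"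
      unfolding cf(1) by (simp only: scaleC.diff_right scaleC_scaleC)
    also have "c * (2 * complex_of_real pi * \<i> * h2 z) = h2 z" by (simp add: c_def)
    finally show ?thesis .
  qed
  have Gvh: "vholo (sector \<alpha>) G"
  proof -
    have "vholo (sector \<alpha>) (N b)" if b: "b = \<alpha> \<or> b = -\<alpha>" for b
      using cauchy_transform_vholo[OF kok[OF b]] b angle_pos angles by (auto simp: N_def[abs_def])
    moreover have "open (sector \<alpha>)" using angle_pos angles by (intro open_sector) auto
    moreover have "h1 holomorphic_on sector \<alpha>"
      using h1 angle_pos angles by (auto simp: holo_H_def mem_sector elim!: holomorphic_on_subset)
    ultimately show ?thesis unfolding G_def by (intro vholo_scaleC vholo_diff) auto
  qed
  have cs: "closed_sector \<beta> \<subseteq> sector \<alpha>" "closed_sector \<beta> \<subseteq> sector \<phi>"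
    using closed_sector_subset[of \<beta>] \<beta>0 \<beta> by auto
  have Gdec: "decays (closed_sector \<beta>) G"
  proof (rule holo_H_decays[OF h1, of _ _ "L (-\<alpha>) + L \<alpha>"])
    fix z assume z: "z \<in> closed_sector \<beta>"
    have "norm (N (-\<alpha>) z - N \<alpha> z) \<le> L (-\<alpha>) / cmod z + L \<alpha> / cmod z"
      using L(1)[of "-\<alpha>", OF _ z] L(1)[of \<alpha>, OF _ z] norm_triangle_ineq4[of "N (-\<alpha>) z" "N \<alpha> z"] by linarith
    then have "norm (G z) \<le> cmod (h1 z) * (L (-\<alpha>) / cmod z + L \<alpha> / cmod z)"
      unfolding G_def norm_scaleC by (intro mult_left_mono) auto
    then show "norm (G z) \<le> (L (-\<alpha>) + L \<alpha>) * (cmod (h1 z) / cmod z)"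
      by (simp add: add_divide_distrib[symmetric] mult.commute)
  qed (use cs in auto)
  \<comment> \<open>\<open>G\<close> is holomorphic on all of \<open>sector \<alpha>\<close>, so the
    two inner rays can be rotated into each other and the transforms contribute nothing.\<close>
  have Geq: "ray (-\<beta>) G = ray \<beta> G" by (rule inner_cauchy[OF Gvh _ \<beta>(2) _ Gdec]) (use \<beta>0 angles in auto)
  have h12: "holo_H \<phi> (\<lambda>z. h1 z * h2 z)" by (rule holo_H_mult[OF h1 h2])
  have rb: "ray b (\<lambda>z. h1 z *\<^sub>C R z (Q \<alpha> h2 x)) = ray b (\<lambda>z. (h1 z * h2 z) *\<^sub>C R z x) - c *\<^sub>C ray b G"
    if b: "b = \<beta> \<or> b = -\<beta>" for b
  proof -
    have bset: "rayset b \<subseteq> closed_sector \<beta>" using rayset_closed_sector[of \<beta>] b \<beta>0 angles by auto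
    have bb: "\<omega> < \<bar>b\<bar>" "\<bar>b\<bar> < pi" "\<bar>b\<bar> < \<phi>" using b \<beta> \<beta>0 angles by auto
    have "ray b (\<lambda>z. h1 z *\<^sub>C R z (Q \<alpha> h2 x)) = ray b (\<lambda>z. (h1 z * h2 z) *\<^sub>C R z x - c *\<^sub>C G z)"
    proof (rule ray_cong)
      fix z assume z: "z \<in> rayset b"
      then have "z \<in> closed_sector \<beta>" "z \<in> \<rho>" using bset rayset_\<rho>[OF bb(1,2)] by auto
      then show "h1 z *\<^sub>C R z (Q \<alpha> h2 x) = (h1 z * h2 z) *\<^sub>C R z x - c *\<^sub>C G z"
        by (simp only: pt G_def scaleC.diff_right scaleC_scaleC mult.commute[of c])
    qed
    also have "\<dots> = ray b (\<lambda>z. (h1 z * h2 z) *\<^sub>C R z x) - ray b (\<lambda>z. c *\<^sub>C G z)"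
      by (rule ray_diff[OF Q_ray_ok[OF h12 bb(1,3) angle_pos(3)]])
         (rule ray_ok_linear[OF ray_ok_vholo[OF Gvh bset cs(1) Gdec] bounded_linear_scaleC_const])
    also have "ray b (\<lambda>z. c *\<^sub>C G z) = c *\<^sub>C ray b G"
      by (rule ray_scaleC[OF ray_ok_vholo[OF Gvh bset cs(1) Gdec]])
    finally show ?thesis .
  qed
  show ?thesis unfolding Q_def[of \<beta>] using rb Geq by simp
qed

lemma Q_mult:
  assumes "holo_H \<phi> h1" "holo_H \<phi> h2"
  shows "Q \<alpha> h1 (Q \<alpha> h2 x) = Q \<alpha> (\<lambda>z. h1 z * h2 z) x"
proof -
  define \<beta> where "\<beta> = (\<omega> + \<alpha>) / 2"
  have \<beta>: "\<omega> < \<beta>" "\<beta> < \<alpha>" using angles by (auto simp: \<beta>_def)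
  have "Q \<beta> h y = Q \<alpha> h y" if "holo_H \<phi> h" for h y
    by (rule Q_angle[OF that]) (use \<beta> angles in auto)
  then show ?thesis using Q_mult_nested[OF assms \<beta>, of x] assms holo_H_mult by metis
qed

text \<open>Partial fractions leave a term with the constant vector \<open>R \<mu> x\<close>,
  holomorphic inside the contour and hence without contribution, and the asserted integrand.
  \<open>m = 0\<close> stands for the negative of the inverse of \<open>A\<close>,
  \<open>m = - 1 / t\<close> for \<open>S t\<close> up to a factor.\<close>

lemma R_Q:
  assumes h: "holo_H \<phi> h" and m: "m \<le> 0"
  shows "R (complex_of_real m) (Q \<alpha> h x) = Q \<alpha> (\<lambda>z. h z / (complex_of_real m - z)) x"
proof -
  define \<mu> where "\<mu> = complex_of_real m"
  have \<mu>: "\<mu> \<in> \<rho>" using m \<omega> by (auto simp: \<mu>_def \<rho>_def outer_def)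
  obtain c where c: "c > 0" "\<And>z w. \<bar>Arg z\<bar> \<le> \<phi> \<Longrightarrow> pi \<le> \<bar>Arg w\<bar> \<Longrightarrow> c * (cmod w + cmod z) \<le> cmod (w - z)"
    using angle_gap[of \<phi> pi] angles angle_pos by auto
  have cz: "min 1 c * cmod z \<le> cmod (\<mu> - z)" if "z \<in> sector \<phi>" for z
  proof (cases "m = 0")
    case True then show ?thesis using mult_right_mono[of "min 1 c" 1 "cmod z"] by (simp add: \<mu>_def)
  next
    case False
    then have "c * (cmod \<mu> + cmod z) \<le> cmod (\<mu> - z)" using c(2)[of z \<mu>] m that angle_pos by (auto simp: \<mu>_def mem_sector)
    moreover have "min 1 c * cmod z \<le> c * (cmod \<mu> + cmod z)" using c(1) by (intro mult_mono) auto
    ultimately show ?thesis by linarith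
  qed
  define d where "d = min 1 c"
  have d: "d > 0" using c by (simp add: d_def)
  have nz: "\<mu> \<noteq> z" "z \<noteq> 0" if "z \<in> sector \<phi>" for z
    using sector_not_nonpos[OF angle_pos(2,3) that] m that angle_pos by (auto simp: \<mu>_def mem_sector)
  define g where "g = (\<lambda>z. h z / (\<mu> - z))"
  have ghol: "g holomorphic_on sector \<phi>" unfolding g_def using h nz by (auto intro!: holomorphic_intros simp: holo_H_def)
  have gb: "cmod (g z) \<le> 1 / d * (cmod (h z) / cmod z)" if "z \<in> sector \<phi>" for z
  proof -
    have "cmod (h z) / cmod (\<mu> - z) \<le> cmod (h z) / (d * cmod z)"
      using cz[OF that] nz[OF that] d by (intro divide_left_mono) (auto simp: d_def[symmetric])
    then show ?thesis by (simp add: g_def norm_divide mult.commute)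
  qed
  have os: "open (sector \<phi>)" using angle_pos by (intro open_sector) auto
  have cs: "closed_sector \<alpha> \<subseteq> sector \<phi>" using angles angle_pos by (intro closed_sector_subset) auto
  define p where "p = (\<lambda>z. g z *\<^sub>C R \<mu> x)"
  have pvh: "vholo (sector \<phi>) p" unfolding p_def by (rule vholo_scaleC[OF ghol os vholo_const])
  have pdec: "decays (closed_sector \<alpha>) p"
  proof (rule holo_H_decays[OF h cs, of _ "1 / d * norm (R \<mu> x)"])
    fix z assume "z \<in> closed_sector \<alpha>"
    then have "cmod (g z) * norm (R \<mu> x) \<le> 1 / d * (cmod (h z) / cmod z) * norm (R \<mu> x)" using gb cs by (intro mult_right_mono) auto
    then show "norm (p z) \<le> 1 / d * norm (R \<mu> x) * (cmod (h z) / cmod z)" by (simp add: p_def norm_scaleC mult_ac)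
  qed
  have peq: "ray (-\<alpha>) p = ray \<alpha> p" by (rule inner_cauchy[OF pvh _ angles(2) _ pdec]) (use angle_pos in auto)
  define q where "q = (\<lambda>z. g z *\<^sub>C R z x)"
  have qvh: "vholo (sector \<phi> \<inter> outer \<omega>) q" unfolding q_def
    by (rule vholo_scaleC) (use ghol os open_outer \<omega> R_vholo in \<open>auto intro: holomorphic_on_subset vholo_subset\<close>)
  obtain M where M: "M > 0" "\<And>z. z \<in> outerc \<alpha> \<Longrightarrow> z \<in> \<rho>"
    "\<And>z x. z \<in> outerc \<alpha> \<Longrightarrow> norm (R z x) \<le> M * norm x"
    "\<And>z x. z \<in> outerc \<alpha> \<Longrightarrow> norm (R z x) \<le> M / cmod z * norm x"
    by (rule R_estimate'[OF angles(1)], rule that)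
  \<comment> \<open>For \<open>m = 0\<close> the quotient \<open>g\<close> may be unbounded at
    \<open>0\<close> and thus outside \<open>holo_H\<close>. The resolvent bound without
    \<open>1 / cmod z\<close>, due to invertibility, compensates for the lost factor.\<close>
  have qdec: "decays (sector \<phi> \<inter> outerc \<alpha>) q"
  proof (rule holo_H_decays[OF h, of _ _ "1 / d * (M * norm x)"])
    fix z assume z: "z \<in> sector \<phi> \<inter> outerc \<alpha>"
    have "cmod (g z) * norm (R z x) \<le> 1 / d * (cmod (h z) / cmod z) * (M * norm x)"
      using gb M(3) z d by (intro mult_mono) auto
    then show "norm (q z) \<le> 1 / d * (M * norm x) * (cmod (h z) / cmod z)" by (simp add: q_def norm_scaleC mult_ac)
  qed auto
  have rb: "ray b (\<lambda>z. R \<mu> (h z *\<^sub>C R z x)) = ray b q - ray b p" if b: "b = \<alpha> \<or> b = -\<alpha>" for b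
  proof -
    have "rayset b \<subseteq> closed_sector \<alpha>" using rayset_closed_sector[of \<alpha>] b angles angle_pos by auto
    then have pok: "ray_ok b p" by (rule ray_ok_vholo[OF pvh _ cs pdec])
    have "rayset b \<subseteq> sector \<phi> \<inter> outerc \<alpha>" using rayset_facts[OF b] by auto
    then have qok: "ray_ok b q" 
      by (rule ray_ok_vholo[OF qvh _ _ qdec]) (use angles in \<open>force simp: outer_def outerc_def\<close>)
    have "ray b (\<lambda>z. R \<mu> (h z *\<^sub>C R z x)) = ray b (\<lambda>z. q z - p z)"
    proof (rule ray_cong)
      fix z assume z: "z \<in> rayset b"
      note zf = rayset_facts[OF b z]
      have "R \<mu> (h z *\<^sub>C R z x) = h z *\<^sub>C ((1 / (z - \<mu>)) *\<^sub>C (R \<mu> x - R z x))"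
        by (simp only: R_scaleC[OF \<mu>] R_product[OF \<mu> zf(1) nz(1)[OF zf(2)]])
      also have "\<dots> = (- g z) *\<^sub>C (R \<mu> x - R z x)"
        using nz(1)[OF zf(2)] by (simp add: scaleC_scaleC g_def divide_simps scaleC.minus_left)
          (metis minus_diff_eq minus_divide_right scaleC.minus_left)
      finally show "R \<mu> (h z *\<^sub>C R z x) = q z - p z" by (simp add: p_def q_def scaleC_algebra)
    qed
    then show ?thesis using ray_diff[OF qok pok] by simp
  qed
  have "R \<mu> (Q \<alpha> h x) = (1 / (2 * complex_of_real pi * \<i>)) *\<^sub>C
     (ray (-\<alpha>) (\<lambda>z. R \<mu> (h z *\<^sub>C R z x)) - ray \<alpha> (\<lambda>z. R \<mu> (h z *\<^sub>C R z x)))"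
    unfolding Q_def using ray_linear[OF calc_ray_ok[OF h] R_bounded_linear[OF \<mu>] R_scaleC[OF \<mu>]]
    by (simp add: R_scaleC[OF \<mu>] R_diff[OF \<mu>])
  also have "\<dots> = Q \<alpha> g x" unfolding Q_def using rb peq by (simp add: q_def)
  finally show ?thesis by (simp add: g_def \<mu>_def)
qed

end

subsection \<open>Regularisers and fractional powers\<close>

lemma holo_H_cong: "holo_H \<phi> g \<Longrightarrow> (\<And>z. z \<in> sector \<phi> \<Longrightarrow> h z = g z) \<Longrightarrow> holo_H \<phi> h"
  unfolding holo_H_def by (metis (no_types, lifting) holomorphic_transform)

text \<open>The product is \<open>z^(k+s) / (1 + z)^(2k)\<close>, whose exponent
  \<open>k + s\<close> lies strictly between \<open>0\<close> and \<open>2k\<close>.\<close>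

lemma holo_H_reg_powr:
  assumes "0 < \<phi>" "\<phi> < pi" "\<bar>s\<bar> < real k"
  shows "holo_H \<phi> (\<lambda>z. reg_fun k z * z powr complex_of_real s)"
proof (rule holo_H_cong)
  show "holo_H \<phi> (\<lambda>z. z powr complex_of_real (real k + s) / (1 + z) ^ (2 * k))"
    by (rule holo_H_powr) (use assms in auto)
  fix z assume "z \<in> sector \<phi>"
  then have z: "z \<noteq> 0" using assms by (simp add: mem_sector)
  have "z powr complex_of_real (real k + s) = z powr (of_nat k) * z powr complex_of_real s"
    by (simp add: powr_add)
  then show "reg_fun k z * z powr complex_of_real s = z powr complex_of_real (real k + s) / (1 + z) ^ (2 * k)"
    using z by (simp add: reg_fun_def power_divide power_mult)
qed

lemma holo_H_reg:
  assumes "0 < \<phi>" "\<phi> < pi" "k > 0" shows "holo_H \<phi> (reg_fun k)"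
  by (rule holo_H_cong[OF holo_H_reg_powr[of \<phi> 0 k]]) (use assms in \<open>auto simp: mem_sector\<close>)

context sectorial_operator begin

text \<open>This is \<open>(id + tA)^(-1)\<close>, because \<open>id + tA\<close> equals
  \<open>-t\<close> times \<open>- 1 / t - A\<close>.\<close>

definition S :: "real \<Rightarrow> 'x \<Rightarrow> 'x" where
  "S t x = complex_of_real (- 1 / t) *\<^sub>C R (complex_of_real (- 1 / t)) x"

lemma neg_\<rho>: "m \<le> 0 \<Longrightarrow> complex_of_real m \<in> \<rho>"
  using \<omega> by (auto simp: \<rho>_def outer_def)

lemma neg_\<rho>': "t > 0 \<Longrightarrow> complex_of_real (- 1 / t) \<in> \<rho>"
  by (rule neg_\<rho>) simp

lemma S_unique:
  assumes "t > 0" "y \<in> V" "y + t *\<^sub>R A y = x" shows "S t x = y"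
proof -
  define m where "m = - 1 / t"
  have m: "complex_of_real m \<in> \<rho>" "m * t = -1" using neg_\<rho>[of m] assms(1) by (simp_all add: m_def)
  have "complex_of_real m *\<^sub>C x = complex_of_real m *\<^sub>C y - A y"
    unfolding assms(3)[symmetric] scaleC_add_right using m(2)
    by (simp add: scaleR_scaleC scaleC_scaleC flip: of_real_mult) (simp add: scaleC.minus_left)
  then have "R (complex_of_real m) (complex_of_real m *\<^sub>C x) = y" using resolvent_eqI[OF m(1) assms(2)] by simp
  then show ?thesis unfolding S_def m_def[symmetric] by (simp only: R_scaleC[OF m(1)])
qed

lemma S_in_V: "t > 0 \<Longrightarrow> S t x \<in> V"
  unfolding S_def by (intro V_scaleC R_in_V neg_\<rho>')

lemma S_eq: assumes "t > 0" shows "S t x + t *\<^sub>R A (S t x) = x"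
proof -
  define m where "m = - 1 / t"
  have m: "complex_of_real m \<in> \<rho>" "m * t = -1" "t * m = -1" using neg_\<rho>[of m] assms(1) by (simp_all add: m_def)
  have "A (S t x) = complex_of_real m *\<^sub>C A (R (complex_of_real m) x)"
    unfolding S_def m_def[symmetric] by (rule A_scaleC[OF R_in_V[OF m(1)]])
  then have "t *\<^sub>R A (S t x) = - A (R (complex_of_real m) x)"
    using m(3) by (simp add: scaleR_scaleC scaleC_scaleC flip: of_real_mult) (simp add: scaleC.minus_left)
  then have "S t x + t *\<^sub>R A (S t x) = complex_of_real m *\<^sub>C R (complex_of_real m) x - A (R (complex_of_real m) x)"
    unfolding S_def m_def[symmetric] by simp
  then show ?thesis using R_eq[OF m(1), of x] by simp
qed

lemma inv_id_plus_S: "t > 0 \<Longrightarrow> inv_id_plus (\<lambda>x. t *\<^sub>R A x) V x = S t x"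
  unfolding inv_id_plus_def by (rule the_equality) (use S_in_V S_eq S_unique in auto)

lemma S_linear: "t > 0 \<Longrightarrow> S t (x + y) = S t x + S t y" "t > 0 \<Longrightarrow> S t (c *\<^sub>C x) = c *\<^sub>C S t x"
  "t > 0 \<Longrightarrow> S t (x - y) = S t x - S t y"
  unfolding S_def by (simp_all only: R_add[OF neg_\<rho>'] R_scaleC[OF neg_\<rho>'] R_diff[OF neg_\<rho>'] scaleC_add_right
      scaleC.diff_right scaleC_scaleC mult.commute)

lemma S_R: "t > 0 \<Longrightarrow> \<mu> \<in> \<rho> \<Longrightarrow> S t (R \<mu> x) = R \<mu> (S t x)"
  unfolding S_def by (simp only: R_scaleC R_commute[OF neg_\<rho>'])

text \<open>The point \<open>- 1 / t\<close> runs through the negative half-line, where sectoriality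
  bounds the resolvent times its parameter by one constant.\<close>

lemma S_bound:
  obtains M where "M > 0" "\<And>t x. t > 0 \<Longrightarrow> norm (S t x) \<le> M * norm x"
proof -
  obtain M where M: "M > 0" "\<And>z. z \<in> outerc pi \<Longrightarrow> z \<in> \<rho>"
    "\<And>z x. z \<in> outerc pi \<Longrightarrow> norm (R z x) \<le> M * norm x"
    "\<And>z x. z \<in> outerc pi \<Longrightarrow> norm (R z x) \<le> M / cmod z * norm x"
    by (rule R_estimate'[OF \<omega>(2)], rule that)
  have "norm (S t x) \<le> M * norm x" if t: "t > 0" for t x
  proof -
    have "Arg (complex_of_real (- 1 / t)) = pi" by (subst Arg_of_real) (use t in simp)
    then have "complex_of_real (- 1 / t) \<in> outerc pi" using t by (simp add: outerc_def)
    from mult_left_mono[OF M(4)[OF this, of x], of "1 / t"]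
    show ?thesis using t by (simp add: S_def norm_scaleC norm_divide)
  qed
  from M(1) this show ?thesis by (rule that)
qed

lemma S_inj: "t > 0 \<Longrightarrow> S t x = 0 \<Longrightarrow> x = 0"
  using S_eq[of t x] A_scaleC[of "S t x" 0] S_in_V[of t x] by simp

lemma A_inj: "x \<in> V \<Longrightarrow> A x = 0 \<Longrightarrow> x = 0"
  using R_cancel[of 0 x] R_scaleC[of 0 0] by (simp add: \<rho>_def)

lemma calc_H_Q: "calc_H \<omega> \<psi> A V h x = Q ((\<omega> + \<psi>) / 2) h x"
proof -
  have "integral {0..} g = integral {0<..} g" for g :: "real \<Rightarrow> 'x"
    by (rule integral_spike_set; rule negligible_subset[of "{0}"]) auto
  then show ?thesis
    by (simp add: calc_H_def Q_def Let_def ray_def R_def scaleC_scaleC mult.commute)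
qed

end

context sectorial_calculus begin

lemma S_Q: "t > 0 \<Longrightarrow> holo_H \<phi> h \<Longrightarrow> S t (Q \<alpha> h x) = Q \<alpha> (\<lambda>z. h z / (1 + complex_of_real t * z)) x"
proof -
  assume t: "t > 0" and h: "holo_H \<phi> h"
  define m where "m = complex_of_real (- 1 / t)"
  have m: "m \<in> \<rho>" "- (complex_of_real t * m) = 1" using t neg_\<rho>'[of t] by (simp_all add: m_def)
  have "S t (Q \<alpha> h x) = R m (Q \<alpha> (\<lambda>z. m * h z) x)"
    unfolding S_def m_def[symmetric] by (simp only: Q_cmult[OF h] R_scaleC[OF m(1)])
  also have "\<dots> = Q \<alpha> (\<lambda>z. m * h z / (m - z)) x"
    unfolding m_def by (rule R_Q[OF holo_H_cmult[OF h]]) (use t in simp)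
  also have "\<dots> = Q \<alpha> (\<lambda>z. h z / (1 + complex_of_real t * z)) x"
  proof (rule Q_cong)
    fix z assume "z \<in> sector \<phi>"
    have "m \<noteq> 0" using m(2) by auto
    have tm: "complex_of_real t * m = -1" using m(2) by (metis minus_minus)
    have "m * (1 + complex_of_real t * z) = m + (complex_of_real t * m) * z" by (simp add: distrib_left)
    then have "m * (1 + complex_of_real t * z) = m - z" by (simp add: tm)
    then have "m * h z / (m - z) = m * h z / (m * (1 + complex_of_real t * z))" by simp
    then show "m * h z / (m - z) = h z / (1 + complex_of_real t * z)" using \<open>m \<noteq> 0\<close> by simp
  qed
  finally show ?thesis .
qed

lemma Q_S: "t > 0 \<Longrightarrow> holo_H \<phi> h \<Longrightarrow> Q \<alpha> h (S t x) = S t (Q \<alpha> h x)"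
  unfolding S_def by (simp only: Q_linear(2) Q_linear(4)[OF _ neg_\<rho>'])

lemma one_plus_sector:
  obtains c where "c > 0" "\<And>z. z \<in> sector \<phi> \<Longrightarrow> c * (1 + cmod z) \<le> cmod (1 + z)" "\<And>z. z \<in> sector \<phi> \<Longrightarrow> 1 + z \<noteq> 0"
proof -
  obtain c where c: "c > 0" "\<And>z. \<bar>Arg z\<bar> \<le> \<phi> \<Longrightarrow> c * (1 + cmod z) \<le> cmod (1 + z)"
    using one_plus_bound[of \<phi>] angles angle_pos by auto
  show ?thesis by (rule that[OF c(1)]) (use c(2) one_plus_nz angles angle_pos in \<open>auto simp: mem_sector\<close>)
qed

text \<open>The only place where a residue is picked up: \<open>1/(z-1) - 1/(z+1)\<close> contributes \<open>2\<pi>i\<close>.\<close>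

lemma Q_reg1: "Q \<alpha> (reg_fun 1) x = S 1 (x - S 1 x)"
proof -
  define s where "s = S 1 x"
  \<comment> \<open>The expected value, \<open>A (1 + A)^(-2) x\<close>. As it lies in
    \<open>V\<close>, subtracting \<open>W / (z - 1)\<close> from \<open>R z W\<close> gains one
    order of decay.\<close>
  define W where "W = s - S 1 s"
  have W: "W \<in> V" unfolding W_def s_def by (intro V_diff S_in_V) auto
  have S1: "S 1 y = - R (-1) y" for y by (simp add: S_def scaleC.minus_left)
  have m1: "-1 \<in> \<rho>" using neg_\<rho>[of "-1"] by simp
  obtain c where c: "c > 0" "\<And>z. z \<in> sector \<phi> \<Longrightarrow> c * (1 + cmod z) \<le> cmod (1 + z)" "\<And>z. z \<in> sector \<phi> \<Longrightarrow> 1 + z \<noteq> 0"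
    by (rule one_plus_sector, rule that)
  have os: "open (sector \<phi>)" using angle_pos by (intro open_sector) auto
  have cs: "closed_sector \<alpha> \<subseteq> sector \<phi>" using angles angle_pos by (intro closed_sector_subset) auto
  \<comment> \<open>The part of the integrand that is free of resolvents in \<open>z\<close>; its
    pole at \<open>-1\<close> is outside the contour.\<close>
  define p where "p = (\<lambda>z::complex. (1 / (1 + z)^2) *\<^sub>C s)"
  have pvh: "vholo (sector \<phi>) p" unfolding p_def
    by (rule vholo_scaleC[OF _ os vholo_const]) (use c(3) in \<open>auto intro!: holomorphic_intros\<close>)
  have pdec: "decays (closed_sector \<alpha>) p"
  proof (rule decays_quadratic[OF zero_less_one zero_less_one, of _ _ "norm s / c^2"])
    fix z assume "z \<in> closed_sector \<alpha>"
    then have z: "z \<in> sector \<phi>" using cs by auto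
    have "c * (1 + cmod z) > 0" using c(1) by (simp add: add_pos_nonneg)
    then have "1 / cmod (1 + z)^2 \<le> 1 / (c * (1 + cmod z))^2"
      using c(2)[OF z] by (intro frac_le power_mono zero_less_power) auto
    from mult_right_mono[OF this, of "norm s"]
    have "norm (p z) \<le> norm s / c^2 / (1 + cmod z)^2"
      by (simp add: p_def norm_scaleC norm_divide norm_power power_mult_distrib)
    then show "norm (p z) \<le> norm s / c^2 / ((cmod z + 1) * (cmod z + 1))"
      by (simp add: power2_eq_square add.commute)
  qed (simp add: closed_sector_def)
  have peq: "ray (-\<alpha>) p = ray \<alpha> p" by (rule inner_cauchy[OF pvh _ angles(2) _ pdec]) (use angle_pos in auto)
  \<comment> \<open>Equal to \<open>R z W - W / (z - 1)\<close> on the rays; it is holomorphic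
    outside the contour and decays quadratically.\<close>
  define m where "m = (\<lambda>z. (1 / (z - 1)) *\<^sub>C R z (A W - W))"
  have mvh: "vholo (outer \<omega>) m" unfolding m_def
    by (rule vholo_scaleC[OF _ open_outer[OF \<omega>] R_vholo]) (use \<omega> in \<open>auto intro!: holomorphic_intros simp: outer_def\<close>)
  obtain M where M: "M > 0" "\<And>z. z \<in> outerc \<alpha> \<Longrightarrow> z \<in> \<rho>"
    "\<And>z x. z \<in> outerc \<alpha> \<Longrightarrow> norm (R z x) \<le> M / (1 + cmod z) * norm x"
    by (rule R_estimate[OF angles(1)], rule that)
  obtain d where d: "d > 0" "\<And>z w. \<bar>Arg z\<bar> \<le> 0 \<Longrightarrow> \<alpha> \<le> \<bar>Arg w\<bar> \<Longrightarrow> d * (cmod w + cmod z) \<le> cmod (w - z)"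
    using angle_gap[of 0 \<alpha>] angle_pos by auto
  have mdec: "decays (outerc \<alpha>) m"
  proof (rule decays_quadratic[OF zero_less_one zero_less_one, of _ _ "M * norm (A W - W) / d"])
    fix z assume z: "z \<in> outerc \<alpha>"
    have 1: "d * (1 + cmod z) > 0" using d(1) by (simp add: add_pos_nonneg)
    have "d * (1 + cmod z) \<le> cmod (z - 1)" using d(2)[of 1 z] z by (simp add: outerc_def add.commute)
    then have "1 / cmod (z - 1) \<le> 1 / (d * (1 + cmod z))" using 1 by (intro frac_le) auto
    then have "1 / cmod (z - 1) * norm (R z (A W - W)) \<le> 1 / (d * (1 + cmod z)) * (M / (1 + cmod z) * norm (A W - W))"
      using M(3)[OF z] 1 by (intro mult_mono) auto
    then show "norm (m z) \<le> M * norm (A W - W) / d / ((cmod z + 1) * (cmod z + 1))"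
      by (simp add: m_def norm_scaleC norm_divide mult_ac add.commute)
  qed (simp add: outerc_def)
  have oo: "outerc \<alpha> \<subseteq> outer \<omega>" using angles by (auto simp: outer_def outerc_def)
  have meq: "ray (-\<alpha>) m = ray \<alpha> m" by (rule outer_cauchy[OF mvh oo _ _ mdec]) (use angle_pos angles in auto)
  define l where "l = (\<lambda>w::complex. (2 / ((w - 1) * (w + 1))) *\<^sub>C W)"
  have \<alpha>pi: "\<alpha> < pi" using angles by simp
  note l = log_integral[OF angle_pos(1) \<alpha>pi, of W, folded l_def]
  have rb: "ray b (\<lambda>z. reg_fun 1 z *\<^sub>C R z x) = ray b m + ray b l + ray b p" if b: "b = \<alpha> \<or> b = -\<alpha>" for b
  proof -
    have bset: "rayset b \<subseteq> closed_sector \<alpha>" "rayset b \<subseteq> outerc \<alpha>"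
      using rayset_closed_sector[of \<alpha>] rayset_outerc[of \<alpha>] b angles angle_pos by auto
    have oks: "ray_ok b p" "ray_ok b m" "ray_ok b l"
      using ray_ok_vholo[OF pvh bset(1) cs pdec] ray_ok_vholo[OF mvh bset(2) oo mdec] l b by auto
    have "ray b (\<lambda>z. reg_fun 1 z *\<^sub>C R z x) = ray b (\<lambda>z. m z + l z + p z)"
    proof (rule ray_cong)
      fix z assume "z \<in> rayset b"
      note zf = rayset_facts[OF b this]
      have nz: "1 + z \<noteq> 0" "z - 1 \<noteq> 0" using c(3)[OF zf(2)] zf(3) angle_pos by (auto simp: outerc_def)
      have Rs: "R z (S 1 y) = (1 / (1 + z)) *\<^sub>C (R z y + S 1 y)" for y
      proof -
        have "R z (S 1 y) = - ((1 / (-1 - z)) *\<^sub>C (R z y - R (-1) y))"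
          using R_product[OF zf(1) m1] nz(1) R_scaleC[OF zf(1), of "-1"] unfolding S1 scaleC_m1
          by (metis add_eq_0_iff minus_minus add.commute)
        also have "\<dots> = (- (1 / (-1 - z))) *\<^sub>C (R z y + S 1 y)" by (simp add: S1 scaleC.minus_left)
        also have "- (1 / (-1 - z)) = 1 / (1 + z)" by (metis minus_divide_right minus_diff_eq diff_minus_eq_add add.commute)
        finally show ?thesis .
      qed
      have RW: "R z W = (1 / (1 + z)) *\<^sub>C (R z x + s) - (1 / (1 + z)) *\<^sub>C ((1 / (1 + z)) *\<^sub>C (R z x + s) + S 1 s)"
        using Rs[of x] Rs[of s] by (simp add: W_def R_diff[OF zf(1)] s_def[symmetric])
      have "(z - 1) *\<^sub>C R z W - R z (A W - W) = W"
        using R_cancel[OF zf(1) W] R_scaleC[OF zf(1)] by (simp add: R_diff[OF zf(1)] scaleC_algebra)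
      then have "R z (A W - W) = (z - 1) *\<^sub>C R z W - W" by (simp add: algebra_simps)
      then have "m z = R z W - (1 / (z - 1)) *\<^sub>C W" using nz by (simp add: m_def scaleC.diff_right scaleC_scaleC)
      moreover have "(2 / ((z - 1) * (z + 1))) = 1 / (z - 1) - 1 / (1 + z)" using nz by (simp add: divide_simps add.commute)
      ultimately have ml: "m z + l z = R z W - (1 / (1 + z)) *\<^sub>C W" by (simp add: l_def scaleC_algebra)
      have "m z + l z + p z = (1 / (1 + z) - 1 / (1 + z) * (1 / (1 + z))) *\<^sub>C R z x
          + (1 / (1 + z) - 1 / (1 + z) * (1 / (1 + z)) - 1 / (1 + z) + 1 / (1 + z)^2) *\<^sub>C s"
        unfolding ml RW p_def by (simp add: W_def scaleC_algebra)
      also have "1 / (1 + z) - 1 / (1 + z) * (1 / (1 + z)) = reg_fun 1 z" using nz by (simp add: reg_fun_def divide_simps power2_eq_square)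
      also have "reg_fun 1 z - 1 / (1 + z) + 1 / (1 + z)^2 = 0" using nz by (simp add: reg_fun_def divide_simps power2_eq_square)
      finally show "reg_fun 1 z *\<^sub>C R z x = m z + l z + p z" by simp
    qed
    then show ?thesis using oks by (simp add: ray_add ray_ok_add)
  qed
  have "ray (-\<alpha>) (\<lambda>z. reg_fun 1 z *\<^sub>C R z x) - ray \<alpha> (\<lambda>z. reg_fun 1 z *\<^sub>C R z x) = ray (-\<alpha>) l - ray \<alpha> l"
    using rb[of \<alpha>] rb[of "-\<alpha>"] peq meq by simp
  then have "Q \<alpha> (reg_fun 1) x = (1 / (2 * complex_of_real pi * \<i>) * (2 * complex_of_real pi * \<i>)) *\<^sub>C W"
    unfolding Q_def l(1) by (simp only: scaleC_scaleC)
  also have "\<dots> = S 1 (x - S 1 x)" by (simp add: W_def s_def S_linear)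
  finally show ?thesis .
qed

lemma holo_H_reg_fun: "k > 0 \<Longrightarrow> holo_H \<phi> (reg_fun k)"
  by (rule holo_H_reg) (use angles angle_pos in auto)

lemma Q_reg_Suc: "k > 0 \<Longrightarrow> Q \<alpha> (reg_fun (Suc k)) x = Q \<alpha> (reg_fun 1) (Q \<alpha> (reg_fun k) x)"
proof -
  assume "k > 0"
  moreover have "reg_fun (Suc k) = (\<lambda>z. reg_fun 1 z * reg_fun k z)" by (simp add: fun_eq_iff reg_fun_def)
  ultimately show ?thesis by (simp add: Q_mult holo_H_reg_fun del: One_nat_def)
qed

text \<open>A vector killed by the operator of \<open>reg_fun 1\<close> satisfies
  \<open>(1 + A)^(-1) x = x\<close>, hence \<open>A x = 0\<close>. Injectivity makes the
  \<open>THE\<close> in \<open>frac_pow\<close> determinate and is the cancellation rule behind the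
  operator identities that follow.\<close>

lemma Q_reg_inj: "k > 0 \<Longrightarrow> Q \<alpha> (reg_fun k) x = Q \<alpha> (reg_fun k) y \<Longrightarrow> x = y"
proof -
  have 1: "x = 0" if "Q \<alpha> (reg_fun 1) x = 0" for x
  proof -
    have "x - S 1 x = 0" by (rule S_inj[OF zero_less_one]) (use that in \<open>simp only: Q_reg1\<close>)
    then have "S 1 x = x" by simp
    moreover from this have "x \<in> V" using S_in_V[OF zero_less_one, of x] by simp
    ultimately have "A x = 0" "x \<in> V" using S_eq[OF zero_less_one, of x] by simp_all
    then show ?thesis using A_inj \<open>x \<in> V\<close> by simp
  qed
  have 2: "x = 0" if "k > 0" "Q \<alpha> (reg_fun k) x = 0" for k x
    using that
  proof (induction k)
    case (Suc k)
    show ?case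
    proof (cases "k = 0")
      case True then show ?thesis using 1 Suc.prems by simp
    next
      case False
      then have "Q \<alpha> (reg_fun 1) (Q \<alpha> (reg_fun k) x) = 0" using Suc.prems(2) Q_reg_Suc[of k x] by simp
      then have "Q \<alpha> (reg_fun k) x = 0" by (rule 1)
      then show ?thesis using Suc.IH False by simp
    qed
  qed simp
  assume "k > 0" "Q \<alpha> (reg_fun k) x = Q \<alpha> (reg_fun k) y"
  then have "Q \<alpha> (reg_fun k) (x - y) = 0" by (simp add: Q_linear(3) holo_H_reg_fun)
  with \<open>k > 0\<close> have "x - y = 0" by (rule 2)
  then show "x = y" by simp
qed

text \<open>With parameter \<open>pi\<close> the contour has half-angle
  \<open>(\<omega> + pi) / 2\<close>. Functions such as \<open>reg_fun k\<close> are unbounded on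
  \<open>sector pi\<close> because of the pole at \<open>-1\<close>, so membership is asked for
  every smaller angle; one angle above both contours then permits the rotation.\<close>

lemma calc_H_pi:
  assumes "\<And>\<psi>. 0 < \<psi> \<Longrightarrow> \<psi> < pi \<Longrightarrow> holo_H \<psi> h"
  shows "calc_H \<omega> pi A V h x = Q \<alpha> h x"
proof -
  define \<beta> where "\<beta> = (\<omega> + pi) / 2"
  have \<beta>: "\<omega> < \<beta>" "\<beta> < pi" using \<omega> by (auto simp: \<beta>_def)
  then have "max \<alpha> \<beta> < pi" using angles by simp
  then obtain \<psi> where "max \<alpha> \<beta> < \<psi>" "\<psi> < pi" using dense by blast
  then have b: "\<omega> < \<beta>" "\<beta> < \<psi>" "\<alpha> < \<psi>" "0 < \<psi>" "\<psi> < pi" using \<beta> angle_pos(1) by simp_all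
  have "Q \<beta> h x = Q \<alpha> h x"
  proof (cases "\<alpha> \<le> \<beta>")
    case True then show ?thesis using Q_angle[OF assms[OF b(4,5)] angles(1) True b(2)] b by simp
  next
    case False then show ?thesis using Q_angle[OF assms[OF b(4,5)] b(1) _ b(3)] b by simp
  qed
  then show ?thesis by (simp add: calc_H_Q \<beta>_def)
qed

section \<open>Fractional powers in terms of regularisers\<close>

lemma reg_k_gt: "\<bar>s\<bar> < real (reg_k s)"
  unfolding reg_k_def using real_nat_ceiling_ge[of "\<bar>s\<bar>"] by linarith

lemma reg_k_pos: "reg_k s > 0"
  by (simp add: reg_k_def)

lemma frac_pow_calc:
  shows "calc_H \<omega> pi A V (reg_fun (reg_k s)) x = Q \<alpha> (reg_fun (reg_k s)) x"
    and "calc_H \<omega> pi A V (\<lambda>z. reg_fun (reg_k s) z * z powr complex_of_real s) x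
        = Q \<alpha> (\<lambda>z. reg_fun (reg_k s) z * z powr complex_of_real s) x"
  by (rule calc_H_pi, rule holo_H_reg, simp_all add: reg_k_pos)
     (rule calc_H_pi, rule holo_H_reg_powr, simp_all add: reg_k_gt)

lemma frac_pow_eqI:
  assumes "Q \<alpha> (reg_fun (reg_k s)) y = Q \<alpha> (\<lambda>z. reg_fun (reg_k s) z * z powr complex_of_real s) x"
  shows "frac_pow \<omega> A V s x = y"
  unfolding frac_pow_def frac_pow_calc
  by (rule the_equality, rule assms, rule Q_reg_inj[OF reg_k_pos[of s]]) (simp add: assms)

lemma frac_pow_dom_eq:
  assumes "x \<in> frac_pow_dom \<omega> A V s"
  shows "Q \<alpha> (reg_fun (reg_k s)) (frac_pow \<omega> A V s x) = Q \<alpha> (\<lambda>z. reg_fun (reg_k s) z * z powr complex_of_real s) x"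
proof -
  obtain y where "Q \<alpha> (reg_fun (reg_k s)) y = Q \<alpha> (\<lambda>z. reg_fun (reg_k s) z * z powr complex_of_real s) x"
    using assms unfolding frac_pow_dom_def frac_pow_calc by auto
  then show ?thesis using frac_pow_eqI by metis
qed

end

subsection \<open>The extended calculus and smoothing estimates\<close>

lemma complex_scale_powr:
  "t > 0 \<Longrightarrow> (complex_of_real t * z) powr complex_of_real s = complex_of_real (t powr s) * z powr complex_of_real s"
  by (simp add: powr_times_real_left powr_of_real)

lemma holo_H_limits:
  assumes "holo_H \<phi> h" "0 < \<phi>" "\<phi> < pi"
  shows "((\<lambda>r. h (complex_of_real r)) \<longlongrightarrow> 0) (at_right 0)" "((\<lambda>r. h (complex_of_real r)) \<longlongrightarrow> 0) at_top"
proof -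
  obtain C b where C: "C > 0" "b > 0" "\<And>z. z \<in> sector \<phi> \<Longrightarrow> cmod (h z) \<le> C * min (cmod z powr b) (cmod z powr - b)"
    using assms(1) unfolding holo_H_def by blast
  have bd: "cmod (h (complex_of_real r)) \<le> C * r powr b" "cmod (h (complex_of_real r)) \<le> C * r powr - b" if "r > 0" for r
  proof -
    have "complex_of_real r \<in> sector \<phi>" using that assms by (simp add: mem_sector)
    from C(3)[OF this] have "cmod (h (complex_of_real r)) \<le> C * min (r powr b) (r powr - b)" using that by simp
    moreover have "C * min (r powr b) (r powr - b) \<le> C * r powr b" "C * min (r powr b) (r powr - b) \<le> C * r powr - b"
      using C(1) by (intro mult_left_mono; simp)+
    ultimately show "cmod (h (complex_of_real r)) \<le> C * r powr b" "cmod (h (complex_of_real r)) \<le> C * r powr - b" by linarith+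
  qed
  show "((\<lambda>r. h (complex_of_real r)) \<longlongrightarrow> 0) (at_right 0)"
  proof (rule Lim_null_comparison)
    show "\<forall>\<^sub>F r in at_right 0. cmod (h (complex_of_real r)) \<le> C * r powr b"
      using eventually_at_right_less[of 0] by eventually_elim (rule bd)
    show "((\<lambda>r. C * r powr b) \<longlongrightarrow> 0) (at_right 0)" using C(2) by real_asymp
  qed
  show "((\<lambda>r. h (complex_of_real r)) \<longlongrightarrow> 0) at_top"
  proof (rule Lim_null_comparison)
    show "\<forall>\<^sub>F r in at_top. cmod (h (complex_of_real r)) \<le> C * r powr - b"
      using eventually_gt_at_top[of 0] by eventually_elim (rule bd)
    show "((\<lambda>r. C * r powr - b) \<longlongrightarrow> 0) at_top" using C(2) by real_asymp
  qed
qed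

text \<open>On the positive half-line the \<open>holo_H\<close> part vanishes at both ends, so the
  limit at infinity is \<open>c\<close> and the limit at \<open>0\<close> is \<open>c + d\<close>.
  Uniqueness makes the \<open>THE\<close> in \<open>calc_E\<close> determinate.\<close>

lemma holo_E_unique:
  assumes "holo_H \<phi> \<psi>" "holo_H \<phi> \<psi>'" "0 < \<phi>" "\<phi> < pi"
    and eq: "\<And>z. z \<in> sector \<phi> \<Longrightarrow> \<psi> z + c + d / (1 + z) = \<psi>' z + c' + d' / (1 + z)"
  shows "c = c'" "d = d'" "\<And>z. z \<in> sector \<phi> \<Longrightarrow> \<psi> z = \<psi>' z"
proof -
  define g where "g r = (\<psi>' (complex_of_real r) - \<psi> (complex_of_real r)) + (d' - d) * complex_of_real (1 / (1 + r))" for r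
  have g: "g r = c - c'" if "r > 0" for r
  proof -
    have "complex_of_real r \<in> sector \<phi>" using that assms by (simp add: mem_sector)
    from eq[OF this] show ?thesis by (simp add: g_def diff_divide_distrib algebra_simps)
  qed
  have "(g \<longlongrightarrow> (0 - 0) + (d' - d) * complex_of_real 0) at_top" unfolding g_def
    by (intro tendsto_intros holo_H_limits(2)[OF assms(1,3,4)] holo_H_limits(2)[OF assms(2-4)]) real_asymp
  moreover have "(g \<longlongrightarrow> c - c') at_top"
    by (rule tendsto_eventually, rule eventually_mono[OF eventually_gt_at_top[of 0]], rule g)
  ultimately have "c - c' = 0" using tendsto_unique[OF _ _ \<open>(g \<longlongrightarrow> c - c') at_top\<close>] by fastforce
  then show c: "c = c'" by simp
  have "(g \<longlongrightarrow> (0 - 0) + (d' - d) * complex_of_real 1) (at_right 0)" unfolding g_def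
    by (intro tendsto_intros holo_H_limits(1)[OF assms(1,3,4)] holo_H_limits(1)[OF assms(2-4)]) real_asymp
  moreover have "(g \<longlongrightarrow> c - c') (at_right 0)"
    by (rule tendsto_eventually, rule eventually_mono[OF eventually_at_right_less[of 0]], rule g)
  ultimately have "c - c' = d' - d" using tendsto_unique[OF _ _ \<open>(g \<longlongrightarrow> c - c') (at_right 0)\<close>] by fastforce
  then show "d = d'" using c by simp
  then show "\<psi> z = \<psi>' z" if "z \<in> sector \<phi>" for z using eq[OF that] c by simp
qed

lemma holo_E_diff_1:
  assumes "holo_E \<phi> f" shows "holo_E \<phi> (\<lambda>z. f z - 1)"
proof -
  obtain \<psi> c d where "holo_H \<phi> \<psi>" "\<And>z. z \<in> sector \<phi> \<Longrightarrow> f z = \<psi> z + c + d / (1 + z)"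
    using assms unfolding holo_E_def by blast
  then show ?thesis unfolding holo_E_def by (intro exI[of _ \<psi>] exI[of _ "c - 1"] exI[of _ d]) auto
qed

lemma holo_H_E: "holo_H \<phi> f \<Longrightarrow> holo_E \<phi> f"
  unfolding holo_E_def by (rule exI[of _ f], rule exI[of _ 0], rule exI[of _ 0]) simp

lemma holo_E_inverse: "holo_E \<phi> (\<lambda>z. 1 / (1 + z))"
  unfolding holo_E_def
  by (rule exI[of _ "\<lambda>_. 0"], rule exI[of _ 0], rule exI[of _ 1]) (auto simp: holo_H_def intro!: exI[of _ 1])

lemma holo_E_bounded:
  assumes "holo_E \<phi> f" "0 < \<phi>" "\<phi> < pi"
  shows "f holomorphic_on sector \<phi>" "\<exists>B. \<forall>z\<in>sector \<phi>. cmod (f z) \<le> B"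
proof -
  obtain \<psi> c d where \<psi>: "holo_H \<phi> \<psi>" "\<And>z. z \<in> sector \<phi> \<Longrightarrow> f z = \<psi> z + c + d / (1 + z)"
    using assms unfolding holo_E_def by blast
  obtain C where C: "C > 0" "\<And>z. z \<in> sector \<phi> \<Longrightarrow> cmod (\<psi> z) \<le> C" by (rule holo_H_bounded[OF \<psi>(1)], rule that)
  obtain k where k: "k > 0" "\<And>z. \<bar>Arg z\<bar> \<le> \<phi> \<Longrightarrow> k * (1 + cmod z) \<le> cmod (1 + z)"
    using one_plus_bound[of \<phi>] assms by auto
  have nz: "1 + z \<noteq> 0" if "z \<in> sector \<phi>" for z using one_plus_nz that assms by (auto simp: mem_sector)
  have "(\<lambda>z. \<psi> z + c + d / (1 + z)) holomorphic_on sector \<phi>"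
    using \<psi>(1) nz by (auto intro!: holomorphic_intros simp: holo_H_def)
  then show "f holomorphic_on sector \<phi>" by (rule holomorphic_transform) (simp add: \<psi>(2))
  have "cmod (f z) \<le> C + cmod c + cmod d / k" if z: "z \<in> sector \<phi>" for z
  proof -
    have "k * (1 + 0) \<le> k * (1 + cmod z)" using k(1) by (intro mult_left_mono) auto
    then have "k \<le> cmod (1 + z)" using k(2)[of z] z assms by (auto simp: mem_sector)
    then have "cmod (d / (1 + z)) \<le> cmod d / k" using k(1) unfolding norm_divide by (intro frac_le) auto
    then show ?thesis using C(2)[OF z] norm_triangle_ineq[of "\<psi> z + c" "d / (1 + z)"] norm_triangle_ineq[of "\<psi> z" c]
      unfolding \<psi>(2)[OF z] by linarith
  qed
  then show "\<exists>B. \<forall>z\<in>sector \<phi>. cmod (f z) \<le> B" by blast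
qed

section \<open>The calculus of the dilated operator \<open>tA\<close>\<close>

context sectorial_calculus begin

lemma Q_angle': "\<omega> < \<beta> \<Longrightarrow> \<beta> < \<phi> \<Longrightarrow> holo_H \<phi> h \<Longrightarrow> Q \<beta> h x = Q \<alpha> h x"
  by (cases "\<beta> \<le> \<alpha>") (blast intro: Q_angle angles angle_pos, metis Q_angle angles(1) angle_pos(3) linear)

lemma resolvent_scale:
  assumes "t > 0" "complex_of_real (1 / t) * z \<in> \<rho>"
  shows "resolvent (\<lambda>x. t *\<^sub>R A x) V z x = complex_of_real (1 / t) *\<^sub>C R (complex_of_real (1 / t) * z) x"
proof -
  define s where "s = complex_of_real (1 / t)"
  have ts: "complex_of_real t * s = 1" "s * complex_of_real t = 1" using assms(1) by (simp_all add: s_def)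
  note sz = assms(2)[folded s_def]
  show ?thesis unfolding resolvent_def s_def[symmetric]
  proof (rule the_equality, intro conjI)
    show V: "s *\<^sub>C R (s * z) x \<in> V" by (intro V_scaleC R_in_V sz)
    have "z *\<^sub>C s *\<^sub>C R (s * z) x - t *\<^sub>R A (s *\<^sub>C R (s * z) x) = (s * z) *\<^sub>C R (s * z) x - (complex_of_real t * s) *\<^sub>C A (R (s * z) x)"
      by (simp only: A_scaleC[OF R_in_V[OF sz]] scaleR_scaleC scaleC_scaleC mult.commute[of z])
    then show "z *\<^sub>C s *\<^sub>C R (s * z) x - t *\<^sub>R A (s *\<^sub>C R (s * z) x) = x" using R_eq[OF sz, of x] ts by simp
  next
    fix y assume y: "y \<in> V \<and> z *\<^sub>C y - t *\<^sub>R A y = x"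
    have "s *\<^sub>C x = (s * z) *\<^sub>C y - (s * complex_of_real t) *\<^sub>C A y"
      using y by (auto simp only: scaleR_scaleC scaleC_scaleC scaleC.diff_right)
    then have "R (s * z) (s *\<^sub>C x) = y" using y ts by (intro resolvent_eqI[OF sz]) auto
    then show "y = s *\<^sub>C R (s * z) x" by (simp only: R_scaleC[OF sz])
  qed
qed

text \<open>The resolvent of \<open>tA\<close> at \<open>z\<close> is \<open>1 / t\<close> times the
  resolvent of \<open>A\<close> at \<open>z / t\<close>. Substitution on each ray moves the dilation
  from the operator to the function, after which the contour is rotated to
  \<open>\<alpha>\<close>.\<close>

lemma calc_H_scale:
  assumes t: "t > 0" and h: "holo_H \<phi> h"
  shows "calc_H \<omega> \<phi> (\<lambda>x. t *\<^sub>R A x) V h x = Q \<alpha> (\<lambda>z. h (complex_of_real t * z)) x"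
proof -
  define \<beta> where "\<beta> = (\<omega> + \<phi>) / 2"
  have \<beta>: "\<omega> < \<beta>" "\<beta> < \<phi>" using angles by (auto simp: \<beta>_def)
  define g where "g z = h (complex_of_real t * z) *\<^sub>C R z x" for z
  have sc: "integral {0..} (\<lambda>r. (h (complex_of_real r * cis b) * cis b) *\<^sub>C resolvent (\<lambda>x. t *\<^sub>R A x) V (complex_of_real r * cis b) x) = ray b g"
    if b: "b = \<beta> \<or> b = -\<beta>" for b
  proof -
    have bb: "\<omega> < \<bar>b\<bar>" "\<bar>b\<bar> < \<phi>" "\<bar>b\<bar> < pi" using b \<beta> \<omega> angles by auto
    have ok: "ray_ok b g" unfolding g_def by (rule Q_ray_ok[OF holo_H_scale[OF h t angle_pos(2)] bb(1,2) angle_pos(3)])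
    have "integral {0..} (\<lambda>r. (h (complex_of_real r * cis b) * cis b) *\<^sub>C resolvent (\<lambda>x. t *\<^sub>R A x) V (complex_of_real r * cis b) x)
       = ray b (\<lambda>z. h z *\<^sub>C resolvent (\<lambda>x. t *\<^sub>R A x) V z x)"
      unfolding ray_def scaleC_scaleC mult.commute[of "cis b"]
      by (rule integral_spike_set; rule negligible_subset[of "{0}"]) auto
    also have "\<dots> = ray b (\<lambda>z. complex_of_real (1 / t) *\<^sub>C g (complex_of_real (1 / t) * z))"
    proof (rule ray_cong)
      fix z assume z: "z \<in> rayset b"
      have "complex_of_real (1 / t) * z \<in> rayset b"
      proof -
        obtain r where r: "r > 0" "z = complex_of_real r * cis b" using z by (auto simp: rayset_def)
        then have "complex_of_real (1 / t) * z = complex_of_real (r / t) * cis b" by simp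
        then show ?thesis using r t raysetI[of "r / t" b] by simp
      qed
      then have "complex_of_real (1 / t) * z \<in> \<rho>" using rayset_\<rho>[OF bb(1,3)] by blast
      then have "resolvent (\<lambda>x. t *\<^sub>R A x) V z x = complex_of_real (1 / t) *\<^sub>C R (complex_of_real (1 / t) * z) x"
        by (rule resolvent_scale[OF t])
      moreover have "complex_of_real t * (complex_of_real (1 / t) * z) = z" using t by simp
      ultimately show "h z *\<^sub>C resolvent (\<lambda>x. t *\<^sub>R A x) V z x = complex_of_real (1 / t) *\<^sub>C g (complex_of_real (1 / t) * z)"
        by (simp only: g_def scaleC_scaleC mult.commute[of "h z"])
    qed
    also have "\<dots> = ray b g" by (rule ray_ok_D(3)[OF ok]) (use t in simp)
    finally show ?thesis .
  qed
  have "calc_H \<omega> \<phi> (\<lambda>x. t *\<^sub>R A x) V h x = Q \<beta> (\<lambda>z. h (complex_of_real t * z)) x"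
    unfolding calc_H_def Let_def Q_def g_def[symmetric] \<beta>_def[symmetric]
    using sc[of \<beta>] sc[of "-\<beta>"] by simp
  then show ?thesis using Q_angle'[OF \<beta> holo_H_scale[OF h t angle_pos(2)]] by simp
qed

abbreviation EA :: "(complex \<Rightarrow> complex) \<Rightarrow> real \<Rightarrow> 'x \<Rightarrow> 'x" where
  "EA f t x \<equiv> calc_E \<omega> \<phi> (\<lambda>x. t *\<^sub>R A x) V f x"

text \<open>By uniqueness of the decomposition any convenient one computes
  \<open>f(tA)\<close>.\<close>

lemma EA_eq:
  assumes "holo_H \<phi> \<psi>" "\<And>z. z \<in> sector \<phi> \<Longrightarrow> f z = \<psi> z + c + d / (1 + z)" "t > 0"
  shows "EA f t x = Q \<alpha> (\<lambda>z. \<psi> (complex_of_real t * z)) x + c *\<^sub>C x + d *\<^sub>C S t x"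
  unfolding calc_E_def
proof (rule the_equality)
  show "\<exists>\<psi>' c1 c2. holo_H \<phi> \<psi>' \<and> (\<forall>z\<in>sector \<phi>. f z = \<psi>' z + c1 + c2 / (1 + z)) \<and>
      Q \<alpha> (\<lambda>z. \<psi> (complex_of_real t * z)) x + c *\<^sub>C x + d *\<^sub>C S t x
       = calc_H \<omega> \<phi> (\<lambda>x. t *\<^sub>R A x) V \<psi>' x + c1 *\<^sub>C x + c2 *\<^sub>C inv_id_plus (\<lambda>x. t *\<^sub>R A x) V x"
    using assms by (intro exI[of _ \<psi>] exI[of _ c] exI[of _ d]) (simp add: calc_H_scale inv_id_plus_S)
  fix y assume "\<exists>\<psi>' c1 c2. holo_H \<phi> \<psi>' \<and> (\<forall>z\<in>sector \<phi>. f z = \<psi>' z + c1 + c2 / (1 + z)) \<and>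
      y = calc_H \<omega> \<phi> (\<lambda>x. t *\<^sub>R A x) V \<psi>' x + c1 *\<^sub>C x + c2 *\<^sub>C inv_id_plus (\<lambda>x. t *\<^sub>R A x) V x"
  then obtain \<psi>' c' d' where y: "holo_H \<phi> \<psi>'" "\<And>z. z \<in> sector \<phi> \<Longrightarrow> f z = \<psi>' z + c' + d' / (1 + z)"
    "y = Q \<alpha> (\<lambda>z. \<psi>' (complex_of_real t * z)) x + c' *\<^sub>C x + d' *\<^sub>C S t x"
    using assms(3) by (auto simp: calc_H_scale inv_id_plus_S)
  have "\<psi>' z + c' + d' / (1 + z) = \<psi> z + c + d / (1 + z)" if "z \<in> sector \<phi>" for z
    using assms(2)[OF that] y(2)[OF that] by simp
  note u = holo_E_unique[OF y(1) assms(1) angle_pos(2) angles(3) this]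
  have "Q \<alpha> (\<lambda>z. \<psi>' (complex_of_real t * z)) x = Q \<alpha> (\<lambda>z. \<psi> (complex_of_real t * z)) x"
    by (rule Q_cong) (simp add: u(3) sector_scale[OF assms(3) angle_pos(2)])
  then show "y = Q \<alpha> (\<lambda>z. \<psi> (complex_of_real t * z)) x + c *\<^sub>C x + d *\<^sub>C S t x"
    using y(3) u(1,2) by simp
qed

lemma EA_diff_1:
  assumes "holo_E \<phi> f" "t > 0" shows "EA (\<lambda>z. f z - 1) t x = EA f t x - x"
proof -
  obtain \<psi> c d where f: "holo_H \<phi> \<psi>" "\<And>z. z \<in> sector \<phi> \<Longrightarrow> f z = \<psi> z + c + d / (1 + z)"
    using assms unfolding holo_E_def by blast
  then have "\<And>z. z \<in> sector \<phi> \<Longrightarrow> f z - 1 = \<psi> z + (c - 1) + d / (1 + z)" by simp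
  from EA_eq[OF f(1) this assms(2)] EA_eq[OF f assms(2)] show ?thesis by (simp add: scaleC_algebra)
qed

lemma EA_bound:
  assumes "holo_E \<phi> f"
  obtains K where "K \<ge> 0" "\<And>t x. t > 0 \<Longrightarrow> norm (EA f t x) \<le> K * norm x"
proof -
  obtain \<psi> c d where f: "holo_H \<phi> \<psi>" "\<And>z. z \<in> sector \<phi> \<Longrightarrow> f z = \<psi> z + c + d / (1 + z)"
    using assms unfolding holo_E_def by blast
  obtain K where K: "K \<ge> 0" "\<And>t x. t > 0 \<Longrightarrow> norm (Q \<alpha> (\<lambda>z. \<psi> (complex_of_real t * z)) x) \<le> K * norm x"
    by (rule Q_estimate[OF f(1) angles(1,2) angle_pos(3)], rule that)
  obtain M where M: "M > 0" "\<And>t x. t > 0 \<Longrightarrow> norm (S t x) \<le> M * norm x" by (rule S_bound, rule that)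
  have "norm (EA f t x) \<le> (K + cmod c + cmod d * M) * norm x" if t: "t > 0" for t x
  proof -
    have "cmod d * norm (S t x) \<le> cmod d * (M * norm x)" using M(2)[OF t] by (intro mult_left_mono) auto
    moreover have "EA f t x = Q \<alpha> (\<lambda>z. \<psi> (complex_of_real t * z)) x + c *\<^sub>C x + d *\<^sub>C S t x"
      by (rule EA_eq[OF f t])
    ultimately show ?thesis
      using K(2)[OF t, of x] norm_triangle_ineq[of "Q \<alpha> (\<lambda>z. \<psi> (complex_of_real t * z)) x + c *\<^sub>C x" "d *\<^sub>C S t x"]
        norm_triangle_ineq[of "Q \<alpha> (\<lambda>z. \<psi> (complex_of_real t * z)) x" "c *\<^sub>C x"]
      by (simp add: norm_scaleC distrib_right mult.assoc)
  qed
  moreover have "K + cmod c + cmod d * M \<ge> 0" using K M by simp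
  ultimately show ?thesis using that by blast
qed

text \<open>As \<open>f\<close> is bounded on the sector, its product with a function in
  \<open>holo_H\<close> stays in \<open>holo_H\<close>: constants and \<open>1 / (1 + z)\<close> are
  absorbed, and the product formula for \<open>holo_H\<close> suffices.\<close>

lemma Q_EA:
  assumes f: "holo_E \<phi> f" and h: "holo_H \<phi> h" and t: "t > 0"
  shows "Q \<alpha> h (EA f t x) = Q \<alpha> (\<lambda>z. f (complex_of_real t * z) * h z) x" (is ?a)
    "EA f t (Q \<alpha> h x) = Q \<alpha> (\<lambda>z. f (complex_of_real t * z) * h z) x" (is ?b)
    "holo_H \<phi> (\<lambda>z. f (complex_of_real t * z) * h z)" (is ?c)
proof -
  obtain \<psi> c d where \<psi>: "holo_H \<phi> \<psi>" "\<And>z. z \<in> sector \<phi> \<Longrightarrow> f z = \<psi> z + c + d / (1 + z)"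
    using f unfolding holo_E_def by blast
  note hol = holo_E_bounded[OF f angle_pos(2) angles(3)]
  obtain B where B: "\<And>z. z \<in> sector \<phi> \<Longrightarrow> cmod (f z) \<le> B" using hol(2) by blast
  show ?c by (rule holo_H_bounded_mult[OF h holomorphic_scale[OF hol(1) t angle_pos(2)]]) (rule B, rule sector_scale[OF t angle_pos(2)])
  note s = holo_E_bounded[OF holo_E_inverse angle_pos(2) angles(3)]
  obtain D where D: "\<And>z. z \<in> sector \<phi> \<Longrightarrow> cmod (1 / (1 + z)) \<le> D" using s(2) by blast
  have H2: "holo_H \<phi> (\<lambda>z. 1 / (1 + complex_of_real t * z) * h z)"
    by (rule holo_H_bounded_mult[OF h holomorphic_scale[OF s(1) t angle_pos(2)]]) (rule D, rule sector_scale[OF t angle_pos(2)])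
  have H1: "holo_H \<phi> (\<lambda>z. \<psi> (complex_of_real t * z))" by (rule holo_H_scale[OF \<psi>(1) t angle_pos(2)])
  have "Q \<alpha> (\<lambda>z. f (complex_of_real t * z) * h z) x
      = Q \<alpha> (\<lambda>z. (\<psi> (complex_of_real t * z) * h z + c * h z) + d * (1 / (1 + complex_of_real t * z) * h z)) x"
    by (rule Q_cong) (simp add: \<psi>(2)[OF sector_scale[OF t angle_pos(2)]] distrib_right)
  also have "\<dots> = Q \<alpha> (\<lambda>z. \<psi> (complex_of_real t * z) * h z) x + c *\<^sub>C Q \<alpha> h x + d *\<^sub>C Q \<alpha> (\<lambda>z. 1 / (1 + complex_of_real t * z) * h z) x"
    using holo_H_mult[OF H1 h] holo_H_cmult[OF h] holo_H_cmult[OF H2]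
    by (simp only: Q_add Q_cmult[OF h] Q_cmult[OF H2] holo_H_add)
  also have "Q \<alpha> (\<lambda>z. 1 / (1 + complex_of_real t * z) * h z) x = S t (Q \<alpha> h x)" by (simp add: S_Q[OF t h])
  finally have e: "Q \<alpha> (\<lambda>z. f (complex_of_real t * z) * h z) x
      = Q \<alpha> (\<lambda>z. \<psi> (complex_of_real t * z) * h z) x + c *\<^sub>C Q \<alpha> h x + d *\<^sub>C S t (Q \<alpha> h x)" .
  have EA: "EA f t y = Q \<alpha> (\<lambda>z. \<psi> (complex_of_real t * z)) y + c *\<^sub>C y + d *\<^sub>C S t y" for y
    by (rule EA_eq[OF \<psi> t])
  show ?b unfolding e EA by (simp add: Q_mult[OF H1 h])
  have "Q \<alpha> h (Q \<alpha> (\<lambda>z. \<psi> (complex_of_real t * z)) x) = Q \<alpha> (\<lambda>z. \<psi> (complex_of_real t * z) * h z) x"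
    unfolding Q_mult[OF h H1] by (simp add: mult.commute)
  then show ?a unfolding e EA by (simp add: Q_linear(1,2)[OF h] Q_S[OF t h])
qed

lemma holo_H_reg_fun_powr: "\<bar>s\<bar> < real k \<Longrightarrow> holo_H \<phi> (\<lambda>z. reg_fun k z * z powr complex_of_real s)"
  by (rule holo_H_reg_powr) (use angle_pos angles in auto)

text \<open>All identities between \<open>x\<close> and \<open>w = A^\<theta> x\<close> are reduced to identities between functions
  by applying the injective operator \<open>e_k(A)\<close>.\<close>

lemma transfer:
  assumes k: "k > 0" "\<bar>\<theta>\<bar> < real k"
    and w: "Q \<alpha> (reg_fun k) w = Q \<alpha> (\<lambda>z. reg_fun k z * z powr complex_of_real \<theta>) x"
    and pq: "holo_E \<phi> p" "holo_E \<phi> q" "holo_H \<phi> h1" "holo_H \<phi> h2" and t: "t > 0"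
    and eq: "\<And>z. z \<in> sector \<phi> \<Longrightarrow> h1 z * p (complex_of_real t * z) * z powr complex_of_real \<theta> = c * h2 z * q (complex_of_real t * z)"
  shows "Q \<alpha> h1 (EA p t w) = c *\<^sub>C Q \<alpha> h2 (EA q t x)"
proof (rule Q_reg_inj[OF k(1)])
  note e = holo_H_reg_fun[OF k(1)] and e\<theta> = holo_H_reg_fun_powr[OF k(2)]
  let ?t = "complex_of_real t" and ?e = "reg_fun k"
  note P1 = Q_EA(3)[OF pq(1,3) t] and P2 = Q_EA(3)[OF pq(1) e t] and P3 = Q_EA(3)[OF pq(1) e\<theta> t]
    and P4 = Q_EA(3)[OF pq(2,4) t]
  have "Q \<alpha> ?e (Q \<alpha> h1 (EA p t w)) = Q \<alpha> (\<lambda>z. ?e z * (p (?t * z) * h1 z)) w"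
    by (simp only: Q_EA(1)[OF pq(1,3) t] Q_mult[OF e P1])
  also have "\<dots> = Q \<alpha> (\<lambda>z. h1 z * (p (?t * z) * ?e z)) w" by (rule Q_cong) simp
  also have "\<dots> = Q \<alpha> h1 (EA p t (Q \<alpha> ?e w))"
    by (simp only: Q_EA(2)[OF pq(1) e t] Q_mult[OF pq(3) P2])
  also have "\<dots> = Q \<alpha> (\<lambda>z. h1 z * (p (?t * z) * (?e z * z powr complex_of_real \<theta>))) x"
    unfolding w by (simp only: Q_EA(2)[OF pq(1) e\<theta> t] Q_mult[OF pq(3) P3])
  also have "\<dots> = Q \<alpha> (\<lambda>z. c * (?e z * (q (?t * z) * h2 z))) x"
  proof (rule Q_cong)
    fix z assume "z \<in> sector \<phi>"
    from arg_cong[OF eq[OF this], of "\<lambda>u. ?e z * u"]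
    show "h1 z * (p (?t * z) * (?e z * z powr complex_of_real \<theta>)) = c * (?e z * (q (?t * z) * h2 z))"
      by (simp add: mult_ac)
  qed
  also have "\<dots> = c *\<^sub>C Q \<alpha> ?e (Q \<alpha> h2 (EA q t x))"
    by (simp only: Q_EA(1)[OF pq(2,4) t] Q_mult[OF e P4] Q_cmult[OF holo_H_mult[OF e P4]])
  finally show "Q \<alpha> (reg_fun k) (Q \<alpha> h1 (EA p t w)) = Q \<alpha> (reg_fun k) (c *\<^sub>C Q \<alpha> h2 (EA q t x))"
    by (simp add: Q_linear(2)[OF e])
qed

lemma holo_H_resolvent_power:
  assumes "holo_H \<phi> h" "t > 0" shows "holo_H \<phi> (\<lambda>z. h z / (1 + complex_of_real t * z) ^ n)"
proof (induction n)
  case (Suc n)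
  show ?case by (rule holo_H_cong[OF Q_EA(3)[OF holo_E_inverse Suc assms(2)]]) simp
qed (use assms in simp)

lemma S_power_Q:
  assumes "holo_H \<phi> h" "t > 0"
  shows "(S t ^^ n) (Q \<alpha> h x) = Q \<alpha> (\<lambda>z. h z / (1 + complex_of_real t * z) ^ n) x"
proof (induction n)
  case (Suc n)
  have "(S t ^^ Suc n) (Q \<alpha> h x) = S t (Q \<alpha> (\<lambda>z. h z / (1 + complex_of_real t * z) ^ n) x)"
    by (simp add: Suc)
  also have "\<dots> = Q \<alpha> (\<lambda>z. h z / (1 + complex_of_real t * z) ^ n / (1 + complex_of_real t * z)) x"
    by (rule S_Q[OF assms(2) holo_H_resolvent_power[OF assms]])
  also have "\<dots> = Q \<alpha> (\<lambda>z. h z / (1 + complex_of_real t * z) ^ Suc n) x" by (simp add: mult.commute)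
  finally show ?case .
qed simp

section \<open>Negative powers and interpolation\<close>

lemma Q_S_power: "holo_H \<phi> h \<Longrightarrow> t > 0 \<Longrightarrow> Q \<alpha> h ((S t ^^ n) x) = (S t ^^ n) (Q \<alpha> h x)"
  by (induction n) (simp_all add: Q_S)

text \<open>Since \<open>A\<close> is invertible, \<open>u + A^(-1) u\<close> is mapped by
  \<open>(1 + A)^(-1) (1 - (1 + A)^(-1))\<close> to \<open>(1 + A)^(-1) u\<close>; here
  \<open>R 0\<close> is the negative of \<open>A^(-1)\<close>. Iteration puts the range of
  \<open>(1 + A)^(-k)\<close> into the range of the regulariser of order \<open>k\<close>.\<close>

lemma S_power_range: "k > 0 \<Longrightarrow> \<exists>y. Q \<alpha> (reg_fun k) y = (S 1 ^^ k) v"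
proof (induction k arbitrary: v)
  case (Suc k)
  have \<rho>0: "0 \<in> \<rho>" by (simp add: \<rho>_def)
  have step: "Q \<alpha> (reg_fun 1) (u - R 0 u) = S 1 u" for u
  proof -
    have "A (R 0 u) = - u" using R_eq[OF \<rho>0, of u] by (metis add.inverse_inverse diff_0 scaleC.zero_left)
    moreover have "A (0 - R 0 u) = A 0 - A (R 0 u)" using \<rho>0 by (intro A_diff R_in_V) (auto intro: V_scaleC[of "R 0 u" 0, simplified] R_in_V)
    moreover have "A 0 = 0" using A_scaleC[OF R_in_V[OF \<rho>0], of 0 u] by simp
    ultimately have "S 1 (u - R 0 u) = - R 0 u"
      using V_scaleC[OF R_in_V[OF \<rho>0], of "-1" u] by (intro S_unique) (auto simp: scaleC_m1)
    then show ?thesis by (simp only: Q_reg1) simp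
  qed
  show ?case
  proof (cases "k = 0")
    case True
    then show ?thesis using step[of v] by auto
  next
    case False
    then obtain y where y: "Q \<alpha> (reg_fun k) y = (S 1 ^^ k) (v - R 0 v)" using Suc.IH by blast
    have "(S 1 ^^ n) (v - R 0 v) = (S 1 ^^ n) v - R 0 ((S 1 ^^ n) v)" for n
      by (induction n) (simp_all add: S_linear S_R \<rho>0)
    then have "Q \<alpha> (reg_fun (Suc k)) y = (S 1 ^^ Suc k) v"
      using False y step by (simp add: Q_reg_Suc del: One_nat_def)
    then show ?thesis ..
  qed
qed simp

lemma reg_k_minus [simp]: "reg_k (- a) = reg_k a"
  by (simp add: reg_k_def)

text \<open>Negative powers are defined everywhere: \<open>reg_fun k z * z^(-a)\<close> is
  \<open>(1 + z)^(-k)\<close> times \<open>z^(k-a) / (1 + z)^k\<close>, so its operator maps into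
  the range of \<open>(1 + A)^(-k)\<close>, hence into that of the regulariser. For
  \<open>a = 0\<close> the second factor does not decay at infinity, and the case is
  separate.\<close>

lemma frac_pow_neg_eq:
  assumes a: "a \<ge> 0"
  shows "Q \<alpha> (reg_fun (reg_k a)) (frac_pow \<omega> A V (- a) x)
    = Q \<alpha> (\<lambda>z. reg_fun (reg_k a) z * z powr complex_of_real (- a)) x"
proof -
  define k where "k = reg_k a"
  have k: "k > 0" "a < real k" using reg_k_gt[of a] a by (auto simp: k_def reg_k_pos)
  have "\<exists>y. Q \<alpha> (reg_fun k) y = Q \<alpha> (\<lambda>z. reg_fun k z * z powr complex_of_real (- a)) x"
  proof (cases "a = 0")
    case True
    have "Q \<alpha> (reg_fun k) x = Q \<alpha> (\<lambda>z. reg_fun k z * z powr complex_of_real (- a)) x"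
      by (rule Q_cong) (use True angle_pos in \<open>simp add: mem_sector\<close>)
    then show ?thesis by blast
  next
    case False
    define h where "h = (\<lambda>z. z powr complex_of_real (real k - a) / (1 + z) ^ k)"
    have h: "holo_H \<phi> h" unfolding h_def by (rule holo_H_powr) (use k a False angle_pos angles in auto)
    have "(S 1 ^^ k) (Q \<alpha> h x) = Q \<alpha> (\<lambda>z. h z / (1 + complex_of_real 1 * z) ^ k) x" by (rule S_power_Q[OF h]) simp
    also have "\<dots> = Q \<alpha> (\<lambda>z. reg_fun k z * z powr complex_of_real (- a)) x"
    proof (rule Q_cong)
      fix z assume "z \<in> sector \<phi>"
      then have z: "z \<noteq> 0" using angle_pos by (simp add: mem_sector)
      then have "z powr complex_of_real (real k - a) = z ^ k * z powr complex_of_real (- a)"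
        using powr_add[of z "of_nat k" "complex_of_real (- a)"] by simp
      then show "h z / (1 + complex_of_real 1 * z) ^ k = reg_fun k z * z powr complex_of_real (- a)"
        by (simp add: h_def reg_fun_def power_divide power_mult_distrib power2_eq_square)
    qed
    finally show ?thesis using S_power_range[OF k(1)] by metis
  qed
  then have "x \<in> frac_pow_dom \<omega> A V (- a)"
    unfolding frac_pow_dom_def frac_pow_calc by (simp add: k_def)
  then show ?thesis using frac_pow_dom_eq[of x "- a"] by simp
qed

lemma frac_pow_neg_diff:
  assumes a: "a \<ge> 0"
  shows "frac_pow \<omega> A V (- a) (x - y) = frac_pow \<omega> A V (- a) x - frac_pow \<omega> A V (- a) y"
proof (rule frac_pow_eqI)
  have r: "\<bar>- a\<bar> < real (reg_k a)" using reg_k_gt[of a] by simp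
  show "Q \<alpha> (reg_fun (reg_k (- a))) (frac_pow \<omega> A V (- a) x - frac_pow \<omega> A V (- a) y)
     = Q \<alpha> (\<lambda>z. reg_fun (reg_k (- a)) z * z powr complex_of_real (- a)) (x - y)"
    unfolding reg_k_minus Q_linear(3)[OF holo_H_reg_fun[OF reg_k_pos]] Q_linear(3)[OF holo_H_reg_fun_powr[OF r]] frac_pow_neg_eq[OF a] ..
qed

text \<open>Split \<open>x = (1 - (1 + tA)^{-n}) x + (1 + tA)^{-n} x\<close> with \<open>n > a\<close>.\<close>

lemma interpolation:
  assumes a: "a \<ge> 0"
  obtains K where "K > 0" "\<And>t x. t > 0 \<Longrightarrow> x \<in> V \<Longrightarrow>
    norm x \<le> K * (t * norm (A x) + t powr (- a) * norm (frac_pow \<omega> A V (- a) x))"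
proof (cases "a = 0")
  case True
  have "frac_pow \<omega> A V (- a) x = x" for x
    by (rule Q_reg_inj[OF reg_k_pos[of a]], unfold frac_pow_neg_eq[OF a], rule Q_cong)
       (use True angle_pos in \<open>simp add: mem_sector\<close>)
  then show ?thesis using that[of 1] True by simp
next
  case False
  define n where "n = reg_k a"
  have n: "n > 0" "a < real n" "\<bar>- a\<bar> < real n" using reg_k_gt[of a] a by (auto simp: n_def reg_k_pos)
  \<comment> \<open>\<open>h(tA)\<close> is \<open>t^a A^a (1 + tA)^(-n)\<close>, so
    \<open>(1 + tA)^(-n) x\<close> equals \<open>t^(-a) h(tA) A^(-a) x\<close>, with
    \<open>h(tA)\<close> bounded uniformly in \<open>t\<close>; \<open>0 < a < n\<close> places
    \<open>h\<close> in \<open>holo_H\<close>.\<close>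
  define h where "h = (\<lambda>z. z powr complex_of_real a / (1 + z) ^ n)"
  have h: "holo_H \<phi> h" unfolding h_def by (rule holo_H_powr) (use n a False angle_pos angles in auto)
  obtain K where K: "K \<ge> 0" "\<And>t x. t > 0 \<Longrightarrow> norm (Q \<alpha> (\<lambda>z. h (complex_of_real t * z)) x) \<le> K * norm x"
    by (rule Q_estimate[OF h angles(1,2) angle_pos(3)], rule that)
  obtain M where M: "M > 0" "\<And>t x. t > 0 \<Longrightarrow> norm (S t x) \<le> M * norm x" by (rule S_bound, rule that)
  \<comment> \<open>Telescoping of \<open>x - S t x = S t (t A x)\<close>; each further power of
    \<open>S t\<close> changes only the constant.\<close>
  have "\<exists>C\<ge>0. \<forall>t>0. \<forall>x\<in>V. norm (x - (S t ^^ j) x) \<le> C * (t * norm (A x))" for j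
  proof (induction j)
    case (Suc j)
    then obtain C where C: "C \<ge> 0" "\<And>t x. t > 0 \<Longrightarrow> x \<in> V \<Longrightarrow> norm (x - (S t ^^ j) x) \<le> C * (t * norm (A x))" by blast
    have "norm (x - (S t ^^ Suc j) x) \<le> (M + M * C) * (t * norm (A x))" if t: "t > 0" and x: "x \<in> V" for t x
    proof -
      have "S t (x + t *\<^sub>R A x) = x" by (rule S_unique[OF t x refl])
      then have "x - S t x = S t (t *\<^sub>R A x)" by (simp add: S_linear(1)[OF t] algebra_simps)
      then have 1: "norm (x - S t x) \<le> M * (t * norm (A x))" using M(2)[OF t, of "t *\<^sub>R A x"] t by simp
      have "norm (S t (x - (S t ^^ j) x)) \<le> M * norm (x - (S t ^^ j) x)" by (rule M(2)[OF t])
      also have "\<dots> \<le> M * (C * (t * norm (A x)))" using M(1) C(2)[OF t x] by (intro mult_left_mono) auto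
      finally have 2: "norm (S t (x - (S t ^^ j) x)) \<le> M * (C * (t * norm (A x)))" .
      have "x - (S t ^^ Suc j) x = (x - S t x) + S t (x - (S t ^^ j) x)" by (simp add: S_linear(3)[OF t])
      then have "norm (x - (S t ^^ Suc j) x) \<le> norm (x - S t x) + norm (S t (x - (S t ^^ j) x))" by (metis norm_triangle_ineq)
      then show ?thesis using 1 2 by (simp add: distrib_right mult.assoc)
    qed
    moreover have "M + M * C \<ge> 0" using M C by simp
    ultimately show ?case by blast
  qed auto
  from this[of n] obtain C where C: "C \<ge> 0" "\<And>t x. t > 0 \<Longrightarrow> x \<in> V \<Longrightarrow> norm (x - (S t ^^ n) x) \<le> C * (t * norm (A x))" by blast
  have low: "norm ((S t ^^ n) x) \<le> K * (t powr (- a) * norm (frac_pow \<omega> A V (- a) x))" if t: "t > 0" for t x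
  proof -
    let ?t = "complex_of_real t" and ?P = "frac_pow \<omega> A V (- a) x" and ?e = "reg_fun n"
    have ht: "holo_H \<phi> (\<lambda>z. h (?t * z))" by (rule holo_H_scale[OF h t angle_pos(2)])
    note e = holo_H_reg_fun[OF n(1)] and ea = holo_H_reg_fun_powr[OF n(3)]
    have "Q \<alpha> ?e (Q \<alpha> (\<lambda>z. h (?t * z)) ?P) = Q \<alpha> (\<lambda>z. h (?t * z)) (Q \<alpha> ?e ?P)"
      unfolding Q_mult[OF e ht] Q_mult[OF ht e] by (simp add: mult.commute)
    also have "\<dots> = Q \<alpha> (\<lambda>z. h (?t * z) * (?e z * z powr complex_of_real (- a))) x"
      unfolding frac_pow_neg_eq[OF a, folded n_def] by (rule Q_mult[OF ht ea])
    also have "\<dots> = Q \<alpha> (\<lambda>z. complex_of_real (t powr a) * (?e z / (1 + ?t * z) ^ n)) x"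
    proof (rule Q_cong)
      fix z assume "z \<in> sector \<phi>"
      then have "z \<noteq> 0" using angle_pos by (simp add: mem_sector)
      then have "z powr complex_of_real a * z powr complex_of_real (- a) = 1"
        using powr_add[of z "complex_of_real a" "complex_of_real (- a)"] by simp
      moreover have "h (?t * z) * (?e z * z powr complex_of_real (- a))
          = complex_of_real (t powr a) * (z powr complex_of_real a * z powr complex_of_real (- a)) * (?e z / (1 + ?t * z) ^ n)"
        unfolding h_def complex_scale_powr[OF t] by (simp add: mult_ac)
      ultimately show "h (?t * z) * (?e z * z powr complex_of_real (- a)) = complex_of_real (t powr a) * (?e z / (1 + ?t * z) ^ n)"
        by simp
    qed
    also have "\<dots> = complex_of_real (t powr a) *\<^sub>C Q \<alpha> ?e ((S t ^^ n) x)"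
      by (simp only: Q_cmult[OF holo_H_resolvent_power[OF e t]] S_power_Q[OF e t] Q_S_power[OF e t])
    finally have "Q \<alpha> (\<lambda>z. h (?t * z)) ?P = complex_of_real (t powr a) *\<^sub>C (S t ^^ n) x"
      unfolding Q_linear(2)[OF e, symmetric] by (rule Q_reg_inj[OF n(1)])
    then have "t powr a * norm ((S t ^^ n) x) \<le> K * norm ?P" using K(2)[OF t, of ?P] by (simp add: norm_scaleC)
    then have "t powr (- a) * (t powr a * norm ((S t ^^ n) x)) \<le> t powr (- a) * (K * norm ?P)" by (intro mult_left_mono) auto
    moreover have "t powr (- a) * t powr a = 1" using t by (simp add: powr_minus)
    then have "t powr (- a) * (t powr a * norm ((S t ^^ n) x)) = norm ((S t ^^ n) x)"
      by (simp only: mult.assoc[symmetric] mult_1)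
    ultimately show ?thesis by (simp only: mult.left_commute)
  qed
  define L where "L = C + K + 1"
  show ?thesis
  proof (rule that[of L])
    show "L > 0" using C K by (simp add: L_def)
    fix t :: real and x assume t: "t > 0" and x: "x \<in> V"
    define u v where "u = t * norm (A x)" and "v = t powr (- a) * norm (frac_pow \<omega> A V (- a) x)"
    have uv: "u \<ge> 0" "v \<ge> 0" using t by (auto simp: u_def v_def)
    have "norm x \<le> norm (x - (S t ^^ n) x) + norm ((S t ^^ n) x)" by (metis diff_add_cancel norm_triangle_ineq)
    also have "\<dots> \<le> C * u + K * v" using C(2)[OF t x] low[OF t, of x] by (simp add: u_def v_def)
    also have "\<dots> \<le> L * u + L * v" using uv C(1) K(1) by (intro add_mono mult_right_mono) (auto simp: L_def)
    finally show "norm x \<le> L * (t * norm (A x) + t powr (- a) * norm (frac_pow \<omega> A V (- a) x))"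
      by (simp add: u_def v_def distrib_left)
  qed
qed

text \<open>The distance of \<open>f(tA) x\<close> from \<open>x\<close> in the norm of the space
  requires the exponent \<open>\<theta>\<close>, while the assumption has
  \<open>a + \<theta>\<close>. At \<open>0\<close> the function is a bounded one times
  \<open>z^a\<close>, at infinity a bounded one times \<open>z^(-\<theta>)\<close>; for
  \<open>a > 0\<close> this is decay at both ends.\<close>

lemma holo_E_between:
  assumes f: "holo_E \<phi> f" and a: "a \<ge> 0" and \<theta>: "0 < \<theta>"
    and g: "holo_E \<phi> (\<lambda>z. z powr (- complex_of_real (a + \<theta>)) * (f z - 1))"
  shows "holo_E \<phi> (\<lambda>z. z powr (- complex_of_real \<theta>) * (f z - 1))"
proof (cases "a = 0")
  case False
  have hol: "(\<lambda>z. z powr (- complex_of_real \<theta>) * (f z - 1)) holomorphic_on sector \<phi>"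
    using holo_E_bounded(1)[OF f angle_pos(2) angles(3)] sector_not_nonpos[OF angle_pos(2,3)] by (auto intro!: holomorphic_intros)
  obtain B where B: "\<And>z. z \<in> sector \<phi> \<Longrightarrow> cmod (f z - 1) \<le> B"
    using holo_E_bounded(2)[OF holo_E_diff_1[OF f] angle_pos(2) angles(3)] by blast
  obtain C where C: "\<And>z. z \<in> sector \<phi> \<Longrightarrow> cmod (z powr (- complex_of_real (a + \<theta>)) * (f z - 1)) \<le> C"
    using holo_E_bounded(2)[OF g angle_pos(2) angles(3)] by blast
  define b where "b = min a \<theta>"
  have b: "b > 0" "b \<le> a" "b \<le> \<theta>" using a \<theta> False by (auto simp: b_def)
  define K where "K = max 0 (max B C)"
  have np: "cmod (z powr (- complex_of_real s)) = cmod z powr (- s)" for z s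
    using norm_powr_of_real[of z "- s"] by simp
  show ?thesis
  proof (rule holo_H_E, rule holo_HI[OF hol b(1), of K])
    fix z assume z: "z \<in> sector \<phi>"
    define r where "r = cmod z"
    have r: "r > 0" using z angle_pos by (simp add: mem_sector r_def)
    have K: "B \<le> K" "C \<le> K" "K \<ge> 0" by (auto simp: K_def)
    have "cmod (z powr (- complex_of_real \<theta>) * (f z - 1)) \<le> K * min (r powr b) (r powr - b)"
    proof (cases "r \<le> 1")
      case True
      have "cmod (z powr (- complex_of_real \<theta>) * (f z - 1)) = r powr a * cmod (z powr (- complex_of_real (a + \<theta>)) * (f z - 1))"
      proof -
        have "r powr (- \<theta>) = r powr a * r powr (- (a + \<theta>))" using r by (simp flip: powr_add)
        then show ?thesis unfolding norm_mult np r_def[symmetric] by simp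
      qed
      also have "\<dots> \<le> r powr b * K" using C[OF z] K True b r by (intro mult_mono powr_mono') auto
      also have "r powr b = min (r powr b) (r powr - b)"
      proof -
        have "r powr b \<le> r powr - b" using True r b by (intro powr_mono') auto
        then show ?thesis by simp
      qed
      finally show ?thesis by (simp add: mult.commute)
    next
      case False
      have "cmod (z powr (- complex_of_real \<theta>) * (f z - 1)) \<le> r powr - b * K"
        unfolding norm_mult np r_def[symmetric] using B[OF z] K False b by (intro mult_mono powr_mono) auto
      also have "r powr - b = min (r powr b) (r powr - b)"
      proof -
        have "r powr - b \<le> r powr b" using False b by (intro powr_mono) auto
        then show ?thesis by simp
      qed
      finally show ?thesis by (simp add: mult.commute)
    qed
    then show "cmod (z powr (- complex_of_real \<theta>) * (f z - 1)) \<le> K * min (cmod z powr b) (cmod z powr - b)" by (simp add: r_def)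
  qed
qed (use g in simp)

text \<open>With \<open>w\<close> the value of the power \<open>\<theta>\<close> of \<open>A\<close>
  at \<open>x\<close>, each quantity is a power of \<open>t\<close> times \<open>g(tA) w\<close> for
  some \<open>g\<close> in \<open>holo_E\<close>: the factor \<open>z^\<theta>\<close> is traded
  against the powers of \<open>z\<close> in \<open>g\<close>, and the dilation turns the balance
  into a power of \<open>t\<close>. \<open>EA_bound\<close> then supplies constants independent of
  \<open>t\<close>.\<close>

lemma smoothing_estimates:
  assumes f: "holo_E \<phi> f" and a: "a \<ge> 0" and \<theta>: "0 < \<theta>" "\<theta> < 1"
    and g: "holo_E \<phi> (\<lambda>z. z powr (- complex_of_real (a + \<theta>)) * (f z - 1))"
    and g': "holo_E \<phi> (\<lambda>z. z powr complex_of_real (1 - \<theta>) * f z)"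
    and x: "x \<in> frac_pow_dom \<omega> A V \<theta>"
  obtains K where "K > 0" "\<And>t. t > 0 \<Longrightarrow> EA f t x \<in> V"
    "\<And>t. t > 0 \<Longrightarrow> norm (A (EA f t x)) \<le> K * t powr (\<theta> - 1)"
    "\<And>t. t > 0 \<Longrightarrow> norm (EA f t x - x) \<le> K * t powr \<theta>"
    "\<And>t. t > 0 \<Longrightarrow> norm (frac_pow \<omega> A V (- a) (EA f t x - x)) \<le> K * t powr (a + \<theta>)"
proof -
  define w where "w = frac_pow \<omega> A V \<theta> x"
  define j where "j = reg_k \<theta>"
  have j: "j > 0" "\<bar>\<theta>\<bar> < real j" using reg_k_gt[of \<theta>] by (auto simp: j_def reg_k_pos)
  have w: "Q \<alpha> (reg_fun j) w = Q \<alpha> (\<lambda>z. reg_fun j z * z powr complex_of_real \<theta>) x"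
    unfolding w_def j_def by (rule frac_pow_dom_eq[OF x])
  note f1 = holo_E_diff_1[OF f]
  note g3 = holo_E_between[OF f a \<theta>(1) g]
  have pw: "z powr (- complex_of_real s) * z powr complex_of_real s = 1" if "z \<in> sector \<phi>" for z s
    using that angle_pos powr_add[of z "- complex_of_real s" "complex_of_real s"] by (simp add: mem_sector)
  obtain K1 where K1: "K1 \<ge> 0" "\<And>t x. t > 0 \<Longrightarrow> norm (EA (\<lambda>z. z powr (- complex_of_real (a + \<theta>)) * (f z - 1)) t x) \<le> K1 * norm x"
    by (rule EA_bound[OF g], rule that)
  obtain K2 where K2: "K2 \<ge> 0" "\<And>t x. t > 0 \<Longrightarrow> norm (EA (\<lambda>z. z powr complex_of_real (1 - \<theta>) * f z) t x) \<le> K2 * norm x"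
    by (rule EA_bound[OF g'], rule that)
  obtain K3 where K3: "K3 \<ge> 0" "\<And>t x. t > 0 \<Longrightarrow> norm (EA (\<lambda>z. z powr (- complex_of_real \<theta>) * (f z - 1)) t x) \<le> K3 * norm x"
    by (rule EA_bound[OF g3], rule that)
  \<comment> \<open>The summand \<open>1\<close> keeps \<open>K\<close> positive when the product
    vanishes.\<close>
  define K where "K = (K1 + K2 + K3) * norm w + 1"
  have Kpos: "K > 0" using K1(1) K2(1) K3(1) by (simp add: K_def add_nonneg_pos)
  have Kle: "K1 * norm w \<le> K" "K2 * norm w \<le> K" "K3 * norm w \<le> K"
    using K1(1) K2(1) K3(1) by (auto simp: K_def distrib_right)
  have e1: "t powr (a + \<theta>) *\<^sub>R EA (\<lambda>z. z powr (- complex_of_real (a + \<theta>)) * (f z - 1)) t w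
      = frac_pow \<omega> A V (- a) (EA f t x - x)" if t: "t > 0" for t
  proof (rule frac_pow_eqI[symmetric], unfold reg_k_minus)
    define k where "k = reg_k a"
    have k: "k > 0" "\<bar>- a\<bar> < real k" using reg_k_gt[of a] by (auto simp: k_def reg_k_pos)
    let ?t = "complex_of_real t"
    have "Q \<alpha> (reg_fun k) (EA (\<lambda>z. z powr (- complex_of_real (a + \<theta>)) * (f z - 1)) t w)
       = complex_of_real (t powr (- (a + \<theta>))) *\<^sub>C Q \<alpha> (\<lambda>z. reg_fun k z * z powr complex_of_real (- a)) (EA (\<lambda>z. f z - 1) t x)"
    proof (rule transfer[OF j w g f1 holo_H_reg_fun[OF k(1)] holo_H_reg_fun_powr[OF k(2)] t])
      fix z assume z: "z \<in> sector \<phi>"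
      then have "z powr (- complex_of_real (a + \<theta>)) * z powr complex_of_real \<theta> = z powr complex_of_real (- a)"
        using angle_pos powr_add[of z "- complex_of_real (a + \<theta>)" "complex_of_real \<theta>"] by (simp add: mem_sector)
      then show "reg_fun k z * ((?t * z) powr (- complex_of_real (a + \<theta>)) * (f (?t * z) - 1)) * z powr complex_of_real \<theta>
        = complex_of_real (t powr (- (a + \<theta>))) * (reg_fun k z * z powr complex_of_real (- a)) * (f (?t * z) - 1)"
        using complex_scale_powr[OF t, of z "- (a + \<theta>)"] by (simp add: mult_ac)
    qed
    then have "Q \<alpha> (reg_fun k) (t powr (a + \<theta>) *\<^sub>R EA (\<lambda>z. z powr (- complex_of_real (a + \<theta>)) * (f z - 1)) t w)
      = complex_of_real (t powr (a + \<theta>) * t powr (- (a + \<theta>))) *\<^sub>C Q \<alpha> (\<lambda>z. reg_fun k z * z powr complex_of_real (- a)) (EA (\<lambda>z. f z - 1) t x)"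
      unfolding scaleR_scaleC by (simp only: Q_linear(2)[OF holo_H_reg_fun[OF k(1)]] scaleC_scaleC of_real_mult)
    moreover have "t powr (a + \<theta>) * t powr (- (a + \<theta>)) = 1" using t by (simp flip: powr_add)
    ultimately show "Q \<alpha> (reg_fun (reg_k a)) (t powr (a + \<theta>) *\<^sub>R EA (\<lambda>z. z powr (- complex_of_real (a + \<theta>)) * (f z - 1)) t w)
      = Q \<alpha> (\<lambda>z. reg_fun (reg_k a) z * z powr complex_of_real (- a)) (EA f t x - x)"
      by (simp only: EA_diff_1[OF f t] k_def of_real_1 scaleC_one)
  qed
  have e3: "t powr \<theta> *\<^sub>R EA (\<lambda>z. z powr (- complex_of_real \<theta>) * (f z - 1)) t w = EA f t x - x" if t: "t > 0" for t
  proof (rule Q_reg_inj[OF j(1)])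
    let ?t = "complex_of_real t"
    have "Q \<alpha> (reg_fun j) (EA (\<lambda>z. z powr (- complex_of_real \<theta>) * (f z - 1)) t w)
       = complex_of_real (t powr (- \<theta>)) *\<^sub>C Q \<alpha> (reg_fun j) (EA (\<lambda>z. f z - 1) t x)"
    proof (rule transfer[OF j w g3 f1 holo_H_reg_fun[OF j(1)] holo_H_reg_fun[OF j(1)] t])
      fix z assume z: "z \<in> sector \<phi>"
      have "reg_fun j z * ((?t * z) powr (- complex_of_real \<theta>) * (f (?t * z) - 1)) * z powr complex_of_real \<theta>
        = complex_of_real (t powr (- \<theta>)) * reg_fun j z * (f (?t * z) - 1) * (z powr (- complex_of_real \<theta>) * z powr complex_of_real \<theta>)"
        using complex_scale_powr[OF t, of z "- \<theta>"] by (simp add: mult_ac)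
      then show "reg_fun j z * ((?t * z) powr (- complex_of_real \<theta>) * (f (?t * z) - 1)) * z powr complex_of_real \<theta>
        = complex_of_real (t powr (- \<theta>)) * reg_fun j z * (f (?t * z) - 1)"
        by (simp only: pw[OF z]) simp
    qed
    then have "Q \<alpha> (reg_fun j) (t powr \<theta> *\<^sub>R EA (\<lambda>z. z powr (- complex_of_real \<theta>) * (f z - 1)) t w)
      = complex_of_real (t powr \<theta> * t powr (- \<theta>)) *\<^sub>C Q \<alpha> (reg_fun j) (EA (\<lambda>z. f z - 1) t x)"
      unfolding scaleR_scaleC by (simp only: Q_linear(2)[OF holo_H_reg_fun[OF j(1)]] scaleC_scaleC of_real_mult)
    moreover have "t powr \<theta> * t powr (- \<theta>) = 1" using t by (simp flip: powr_add)
    ultimately show "Q \<alpha> (reg_fun j) (t powr \<theta> *\<^sub>R EA (\<lambda>z. z powr (- complex_of_real \<theta>) * (f z - 1)) t w)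
      = Q \<alpha> (reg_fun j) (EA f t x - x)"
      by (simp only: EA_diff_1[OF f t] of_real_1 scaleC_one)
  qed
  have e2: "EA f t x \<in> V \<and> A (EA f t x) = t powr (\<theta> - 1) *\<^sub>R EA (\<lambda>z. z powr complex_of_real (1 - \<theta>) * f z) t w" if t: "t > 0" for t
  proof -
    let ?t = "complex_of_real t"
    define p where "p = EA (\<lambda>z. z powr complex_of_real (1 - \<theta>) * f z) t w"
    define c where "c = complex_of_real (t powr (1 - \<theta>))"
    have \<rho>0: "0 \<in> \<rho>" by (simp add: \<rho>_def)
    \<comment> \<open>Order \<open>2\<close> is the smallest for which
      \<open>z * reg_fun k z\<close> decays at infinity. The factor \<open>z\<close> stands for the
      unbounded \<open>A\<close>; applying \<open>R 0\<close> removes it again and exhibits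
      \<open>EA f t x\<close> as a multiple of a value of \<open>R 0\<close>, which gives membership
      in \<open>V\<close>.\<close>
    define h2 where "h2 = (\<lambda>z. z * reg_fun 2 z)"
    have r: "holo_H \<phi> (\<lambda>z. reg_fun 2 z * z powr complex_of_real 1)" by (rule holo_H_reg_fun_powr) simp
    have h2: "holo_H \<phi> h2" by (rule holo_H_cong[OF r]) (use angle_pos in \<open>auto simp: h2_def mem_sector\<close>)
    have e: "holo_H \<phi> (reg_fun 2)" by (rule holo_H_reg_fun) simp
    have "Q \<alpha> (reg_fun 2) p = c *\<^sub>C Q \<alpha> h2 (EA f t x)"
      unfolding p_def
    proof (rule transfer[OF j w g' f e h2 t])
      fix z assume z: "z \<in> sector \<phi>"
      then have "z powr complex_of_real (1 - \<theta>) * z powr complex_of_real \<theta> = z"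
        using angle_pos powr_add[of z "complex_of_real (1 - \<theta>)" "complex_of_real \<theta>"] by (simp add: mem_sector)
      moreover have "reg_fun 2 z * ((?t * z) powr complex_of_real (1 - \<theta>) * f (?t * z)) * z powr complex_of_real \<theta>
        = c * (z powr complex_of_real (1 - \<theta>) * z powr complex_of_real \<theta>) * reg_fun 2 z * f (?t * z)"
        unfolding complex_scale_powr[OF t] c_def by (simp only: mult_ac)
      ultimately show "reg_fun 2 z * ((?t * z) powr complex_of_real (1 - \<theta>) * f (?t * z)) * z powr complex_of_real \<theta>
        = c * h2 z * f (?t * z)" by (simp add: h2_def)
    qed
    then have "Q \<alpha> (reg_fun 2) (R 0 p) = c *\<^sub>C R 0 (Q \<alpha> h2 (EA f t x))"
      using Q_linear(4)[OF e \<rho>0, of p] R_scaleC[OF \<rho>0] by simp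
    also have "R 0 (Q \<alpha> h2 (EA f t x)) = Q \<alpha> (\<lambda>z. (-1) * reg_fun 2 z) (EA f t x)"
      using R_Q[OF h2, of 0 "EA f t x"] by (simp, intro Q_cong) (use angle_pos in \<open>auto simp: h2_def mem_sector\<close>)
    also have "\<dots> = (-1) *\<^sub>C Q \<alpha> (reg_fun 2) (EA f t x)" by (rule Q_cmult[OF e])
    finally have "Q \<alpha> (reg_fun 2) (R 0 p) = Q \<alpha> (reg_fun 2) ((- c) *\<^sub>C EA f t x)"
      by (simp only: Q_linear(2)[OF e] scaleC_scaleC) simp
    then have "R 0 p = (- c) *\<^sub>C EA f t x" using Q_reg_inj[of 2] by simp
    then have "complex_of_real (- (t powr (\<theta> - 1))) *\<^sub>C R 0 p = (complex_of_real (- (t powr (\<theta> - 1))) * (- c)) *\<^sub>C EA f t x"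
      by (simp only: scaleC_scaleC)
    also have "complex_of_real (- (t powr (\<theta> - 1))) * (- c) = complex_of_real (t powr (\<theta> - 1) * t powr (1 - \<theta>))"
      by (simp add: c_def)
    also have "t powr (\<theta> - 1) * t powr (1 - \<theta>) = 1" using t by (simp flip: powr_add)
    finally have eq: "EA f t x = complex_of_real (- (t powr (\<theta> - 1))) *\<^sub>C R 0 p" by simp
    have "A (R 0 p) = - p" using R_eq[OF \<rho>0, of p] by (metis add.inverse_inverse diff_0 scaleC.zero_left)
    then have "A (EA f t x) = complex_of_real (- (t powr (\<theta> - 1))) *\<^sub>C (- p)"
      unfolding eq by (simp only: A_scaleC[OF R_in_V[OF \<rho>0]])
    then show ?thesis
      using V_scaleC[OF R_in_V[OF \<rho>0, of p], of "complex_of_real (- (t powr (\<theta> - 1)))"]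
      unfolding eq[symmetric] p_def[symmetric] by (simp add: scaleR_scaleC scaleC.minus_left scaleC.minus_right)
  qed
  show ?thesis
  proof (rule that[OF Kpos])
    fix t :: real assume t: "t > 0"
    have bd: "norm (t powr s *\<^sub>R u) \<le> K * t powr s" if "norm u \<le> k * norm w" "k * norm w \<le> K" for s k and u :: 'x
      using that mult_left_mono[of "norm u" K "t powr s"] by (simp add: mult.commute)
    show "EA f t x \<in> V" using e2[OF t] by simp
    show "norm (A (EA f t x)) \<le> K * t powr (\<theta> - 1)" using e2[OF t] bd[OF K2(2)[OF t] Kle(2)] by simp
    show "norm (EA f t x - x) \<le> K * t powr \<theta>" using bd[OF K3(2)[OF t] Kle(3)] unfolding e3[OF t, symmetric] .
    show "norm (frac_pow \<omega> A V (- a) (EA f t x - x)) \<le> K * t powr (a + \<theta>)"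
      using bd[OF K1(2)[OF t] Kle(1)] unfolding e1[OF t, symmetric] .
  qed
qed

end

section \<open>The convergence rate for the discrepancy principle\<close>

theorem theorem1:
  fixes F :: "'x::{complex_normed_vector,banach} \<Rightarrow> 'y::banach"
    and DF :: "'x set" and y :: 'y and xd :: 'x
    and V :: "'x set" and nV :: "'x \<Rightarrow> real"
    and \<nu> m \<delta>max CDP :: real
    and \<kappa>dp :: "real \<Rightarrow> 'y \<Rightarrow> real" and xdp :: "real \<Rightarrow> 'y \<Rightarrow> 'x"
    and A :: "'x \<Rightarrow> 'x" and \<omega> a cU CU \<phi> \<theta> E :: real
    and f :: "complex \<Rightarrow> complex"
  assumes F_wsc: "weakly_seq_continuous_on DF F"
    and DF_closed: "closed DF" and DF_convex: "convex DF"
    and xd_sol: "xd \<in> DF" "F xd = y" and xd_unique: "\<forall>x\<in>DF. F x = y \<longrightarrow> x = xd"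
    and V_norm: "norm_on V nV" and V_complete: "complete_on V nV"
    and V_emb: "\<exists>C. \<forall>x\<in>V. norm x \<le> C * nV x"
    and V_strictly_finer: "\<exists>W. open_in_norm V nV W \<and> \<not> (\<exists>G. open G \<and> W = V \<inter> G)"
    and V_precompact: "\<forall>r (xs :: nat \<Rightarrow> 'x). (\<forall>n. xs n \<in> V \<and> nV (xs n) powr m \<le> r) \<longrightarrow>
                          (\<exists>g x. strict_mono g \<and> weak_conv (\<lambda>n. xs (g n)) x)"
    and \<nu>: "\<nu> \<ge> 1" and m: "m \<ge> 1" and \<delta>max: "\<delta>max > 0" and CDP: "CDP > 1"
    and DP: "\<forall>\<delta> y\<delta>. 0 < \<delta> \<and> \<delta> \<le> \<delta>max \<and> norm (y\<delta> - y) \<le> \<delta> \<longrightarrow>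
               \<kappa>dp \<delta> y\<delta> > 0 \<and> xdp \<delta> y\<delta> \<in> DF \<inter> V \<and>
               (\<forall>z\<in>DF \<inter> V. norm (F (xdp \<delta> y\<delta>) - y\<delta>) powr \<nu> + \<kappa>dp \<delta> y\<delta> * nV (xdp \<delta> y\<delta>) powr m
                             \<le> norm (F z - y\<delta>) powr \<nu> + \<kappa>dp \<delta> y\<delta> * nV z powr m) \<and>
               norm (F (xdp \<delta> y\<delta>) - y\<delta>) = CDP * \<delta>"
    and \<omega>: "0 \<le> \<omega>" "\<omega> < pi"
    and A_sect: "sectorial \<omega> A V" and A_inv: "invertible_op A V"
    and V_equiv: "\<exists>c1 c2. c1 > 0 \<and> c2 > 0 \<and> (\<forall>x\<in>V. c1 * norm (A x) \<le> nV x \<and> nV x \<le> c2 * norm (A x))"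
    and a: "a \<ge> 0"
    and cU: "0 < cU" "cU \<le> CU"
    and stab: "\<forall>x\<in>DF. cU * norm (frac_pow \<omega> A V (-a) (x - xd)) \<le> norm (F x - F xd) \<and>
                         norm (F x - F xd) \<le> CU * norm (frac_pow \<omega> A V (-a) (x - xd))"
    and F_cont: "\<exists>B. xd \<in> interior B \<and> continuous_on (B \<inter> DF) F"
    and \<phi>: "\<omega> < \<phi>" "\<phi> < pi"
    and f_E: "holo_E \<phi> f"
    and f_1: "\<forall>s\<in>{0<..<1}. holo_E \<phi> (\<lambda>z. z powr (- complex_of_real (a + s)) * (f z - 1))"
    and f_2: "\<forall>s\<in>{0<..<1}. holo_E \<phi> (\<lambda>z. z powr complex_of_real s * f z)"
    and \<theta>: "0 < \<theta>" "\<theta> < 1" and E: "E > 0"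
    and source: "xd \<in> frac_pow_dom \<omega> A V \<theta>" "norm (frac_pow \<omega> A V \<theta> xd) \<le> E"
    and alt: "xd \<in> interior DF \<or>
              (\<exists>t0>0. \<forall>t\<in>{0<..t0}. calc_E \<omega> \<phi> (\<lambda>x. t *\<^sub>R A x) V f xd \<in> DF)"
  shows "\<exists>c>0. \<exists>\<delta>0>0. \<forall>\<delta> y\<delta>. 0 < \<delta> \<and> \<delta> \<le> \<delta>0 \<and> \<delta> \<le> \<delta>max \<and> norm (y\<delta> - y) \<le> \<delta> \<longrightarrow>
           norm (xdp \<delta> y\<delta> - xd) \<le> c * \<delta> powr (\<theta> / (a + \<theta>))"
proof -
  let ?P = "frac_pow \<omega> A V (- a)" and ?x = "\<lambda>t. calc_E \<omega> \<phi> (\<lambda>x. t *\<^sub>R A x) V f xd"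
  interpret sectorial_calculus A V \<omega> \<phi> "(\<omega> + \<phi>) / 2"
    by unfold_locales (use \<omega> \<phi> A_sect A_inv in auto)
  obtain K where K: "K > 0" "\<And>t. t > 0 \<Longrightarrow> ?x t \<in> V"
    "\<And>t. t > 0 \<Longrightarrow> norm (A (?x t)) \<le> K * t powr (\<theta> - 1)"
    "\<And>t. t > 0 \<Longrightarrow> norm (?x t - xd) \<le> K * t powr \<theta>"
    "\<And>t. t > 0 \<Longrightarrow> norm (?P (?x t - xd)) \<le> K * t powr (a + \<theta>)"
    by (rule smoothing_estimates[OF f_E a \<theta> bspec[OF f_1] bspec[OF f_2] source(1)]) (use \<theta> that in auto)
  obtain L where L: "L > 0" "\<And>t x. t > 0 \<Longrightarrow> x \<in> V \<Longrightarrow> norm x \<le> L * (t * norm (A x) + t powr (- a) * norm (?P x))"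
    by (rule interpolation[OF a], rule that)
  obtain c1 c2 where c12: "c1 > 0" "c2 > 0" "\<And>x. x \<in> V \<Longrightarrow> c1 * norm (A x) \<le> nV x" "\<And>x. x \<in> V \<Longrightarrow> nV x \<le> c2 * norm (A x)"
    using V_equiv by blast
  have "\<exists>t0>0. \<forall>t\<in>{0<..t0}. ?x t \<in> DF"
    using alt
  proof
    assume "xd \<in> interior DF"
    then obtain e where e: "e > 0" "ball xd e \<subseteq> DF" by (auto simp: mem_interior)
    \<comment> \<open>Chosen so that \<open>K * t0 powr \<theta> = e / 2\<close>, which keeps
      \<open>?x t\<close> inside the ball up to \<open>t0\<close>.\<close>
    define t0 where "t0 = (e / (2 * K)) powr (1 / \<theta>)"
    have "?x t \<in> DF" if t: "t \<in> {0<..t0}" for t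
    proof -
      have "t powr \<theta> \<le> t0 powr \<theta>" using t \<theta> by (intro powr_mono2) auto
      also have "\<dots> = e / (2 * K)" using e K(1) \<theta> by (simp add: t0_def powr_powr)
      finally have "K * t powr \<theta> \<le> K * (e / (2 * K))" using K(1) by (intro mult_left_mono) auto
      also have "\<dots> < e" using e K(1) by simp
      finally have "norm (?x t - xd) < e" using K(4)[of t] t by auto
      then show ?thesis using e(2) by (auto simp: dist_norm norm_minus_commute)
    qed
    moreover have "t0 > 0" using e K(1) by (simp add: t0_def)
    ultimately show ?thesis by blast
  qed
  then obtain t0 where t0: "t0 > 0" "\<And>t. 0 < t \<Longrightarrow> t \<le> t0 \<Longrightarrow> ?x t \<in> DF" by auto
  \<comment> \<open>Stability bounds the distance of \<open>F (?x t)\<close> from \<open>y\<close>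
    by \<open>CU * K * t^(a+\<theta>)\<close>. With \<open>t^(a+\<theta>) = b * \<delta>\<close>
    this is \<open>(CDP - 1) * \<delta>\<close>, and the noise adds the missing
    \<open>\<delta>\<close>.\<close>
  define b where "b = (CDP - 1) / (CU * K)"
  have CU: "CU > 0" using cU by simp
  have b: "b > 0" using CU K(1) CDP by (simp add: b_def)
  have a\<theta>: "a + \<theta> > 0" using a \<theta> by simp
  \<comment> \<open>\<open>c2 / c1 + 1\<close> comes from comparing penalties,
    \<open>(CDP + 1) / (cU * b) + K\<close> from the residual of the minimiser and the smoothing
    error in the weak norm, the final \<open>K\<close> from passing from \<open>?x t\<close> to
    \<open>xd\<close>.\<close>
  define C where "C = L * ((c2 / c1 + 1) * K + ((CDP + 1) / (cU * b) + K)) + K"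
  define c where "c = C * b powr (\<theta> / (a + \<theta>))"
  have "C > 0" using L(1) K(1) c12(1,2) CDP cU b
    by (auto simp: C_def intro!: add_pos_pos mult_pos_pos divide_pos_pos)
  then have "c > 0" using b by (simp add: c_def)
  \<comment> \<open>The threshold for \<open>\<delta>\<close>: below it \<open>b * \<delta>\<close>
    is at most \<open>t0 powr (a + \<theta>)\<close>, that is, \<open>t <= t0\<close>.\<close>
  moreover have "t0 powr (a + \<theta>) / b > 0" using t0 b by simp
  moreover have "norm (xdp \<delta> y\<delta> - xd) \<le> c * \<delta> powr (\<theta> / (a + \<theta>))"
    if \<delta>: "0 < \<delta>" "\<delta> \<le> t0 powr (a + \<theta>) / b" "\<delta> \<le> \<delta>max" and y\<delta>: "norm (y\<delta> - y) \<le> \<delta>" for \<delta> y\<delta>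
  proof -
    define t where "t = (b * \<delta>) powr (1 / (a + \<theta>))"
    have t: "t > 0" using b \<delta> by (simp add: t_def)
    have ta: "t powr (a + \<theta>) = b * \<delta>" using b \<delta> a\<theta> by (simp add: t_def powr_powr)
    have t\<theta>: "t powr \<theta> = b powr (\<theta> / (a + \<theta>)) * \<delta> powr (\<theta> / (a + \<theta>))"
      using b \<delta> by (simp add: t_def powr_powr powr_mult)
    have "t powr (a + \<theta>) \<le> t0 powr (a + \<theta>)" unfolding ta using \<delta>(2) b by (simp add: pos_le_divide_eq mult.commute)
    then have "t \<le> t0" using t t0(1) a\<theta> by (metis linorder_not_le powr_less_mono2 less_imp_le)
    then have xt: "?x t \<in> DF" "?x t \<in> V" using t0(2) K(2) t by auto
    define xk where "xk = xdp \<delta> y\<delta>"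
    have dp: "\<kappa>dp \<delta> y\<delta> > 0" "xk \<in> DF" "xk \<in> V" "norm (F xk - y\<delta>) = CDP * \<delta>"
      and min: "norm (F xk - y\<delta>) powr \<nu> + \<kappa>dp \<delta> y\<delta> * nV xk powr m
          \<le> norm (F (?x t) - y\<delta>) powr \<nu> + \<kappa>dp \<delta> y\<delta> * nV (?x t) powr m"
      using DP \<delta> y\<delta> xt unfolding xk_def by blast+
    have "norm (F (?x t) - F xd) \<le> CU * norm (?P (?x t - xd))" using stab xt(1) by blast
    also have "\<dots> \<le> CU * (K * (b * \<delta>))" using K(5)[OF t] CU unfolding ta by (intro mult_left_mono) auto
    also have "\<dots> = (CDP - 1) * \<delta>" using CU K(1) by (simp add: b_def)
    finally have "norm (F (?x t) - y\<delta>) \<le> CDP * \<delta>"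
      using y\<delta> norm_triangle_ineq[of "F (?x t) - y" "y - y\<delta>"] xd_sol(2) by (simp add: algebra_simps norm_minus_commute)
    then have "norm (F (?x t) - y\<delta>) powr \<nu> \<le> norm (F xk - y\<delta>) powr \<nu>"
      unfolding dp(4) using \<nu> by (intro powr_mono2) auto
    \<comment> \<open>The minimiser has the larger data term, so its penalty must be the smaller
      one.\<close>
    then have "nV xk powr m \<le> nV (?x t) powr m" using min dp(1) by (smt (verit) mult_le_cancel_left_pos)
    moreover have nn: "nV xk \<ge> 0" "nV (?x t) \<ge> 0" using V_norm dp(3) xt(2) by (auto simp: norm_on_def)
    ultimately have "nV xk \<le> nV (?x t)" using m by (smt (verit) powr_less_mono2)
    then have "c1 * norm (A xk) \<le> c2 * norm (A (?x t))" using c12(3)[OF dp(3)] c12(4)[OF xt(2)] by linarith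
    then have "norm (A xk) \<le> c2 / c1 * norm (A (?x t))" using c12(1) by (simp add: field_simps)
    then have "norm (A (xk - ?x t)) \<le> (c2 / c1 + 1) * norm (A (?x t))"
      using norm_triangle_ineq4[of "A xk" "A (?x t)"] by (simp add: A_diff[OF dp(3) xt(2)] distrib_right)
    also have "\<dots> \<le> (c2 / c1 + 1) * (K * t powr (\<theta> - 1))" using K(3)[OF t] c12(1,2) by (intro mult_left_mono) auto
    finally have "t * norm (A (xk - ?x t)) \<le> t * ((c2 / c1 + 1) * (K * t powr (\<theta> - 1)))" using t by (intro mult_left_mono) auto
    also have "\<dots> = (c2 / c1 + 1) * K * (t * t powr (\<theta> - 1))" by (simp only: mult_ac)
    also have "t * t powr (\<theta> - 1) = t powr \<theta>" using t by (simp add: powr_diff)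
    finally have 1: "t * norm (A (xk - ?x t)) \<le> (c2 / c1 + 1) * K * t powr \<theta>" .
    \<comment> \<open>The lower stability bound converts the residual against exact data into the
      weak norm; dividing by \<open>b\<close> then expresses \<open>\<delta>\<close> through
      \<open>t^(a+\<theta>)\<close>.\<close>
    have "cU * norm (?P (xk - xd)) \<le> norm (F xk - F xd)" using stab dp(2) by blast
    also have "\<dots> \<le> (CDP + 1) * \<delta>"
      using y\<delta> dp(4) norm_triangle_ineq[of "F xk - y\<delta>" "y\<delta> - y"] xd_sol(2) by (simp add: algebra_simps)
    finally have "norm (?P (xk - xd)) \<le> (CDP + 1) * \<delta> / cU" using cU by (simp add: pos_le_divide_eq mult.commute)
    also have "\<dots> = (CDP + 1) / (cU * b) * t powr (a + \<theta>)" unfolding ta using b by simp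
    finally have "norm (?P (xk - xd) - ?P (?x t - xd)) \<le> ((CDP + 1) / (cU * b) + K) * t powr (a + \<theta>)"
      using K(5)[OF t] norm_triangle_ineq4[of "?P (xk - xd)" "?P (?x t - xd)"] by (simp add: distrib_right)
    also have "?P (xk - xd) - ?P (?x t - xd) = ?P (xk - ?x t)"
      by (simp flip: frac_pow_neg_diff[OF a])
    finally have "t powr (- a) * norm (?P (xk - ?x t)) \<le> t powr (- a) * (((CDP + 1) / (cU * b) + K) * t powr (a + \<theta>))"
      by (intro mult_left_mono) auto
    also have "\<dots> = ((CDP + 1) / (cU * b) + K) * (t powr (- a) * t powr (a + \<theta>))" by (simp only: mult_ac)
    also have "t powr (- a) * t powr (a + \<theta>) = t powr \<theta>" using t by (simp flip: powr_add)
    finally have 2: "t powr (- a) * norm (?P (xk - ?x t)) \<le> ((CDP + 1) / (cU * b) + K) * t powr \<theta>" .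
    have "norm (xk - ?x t) \<le> L * (t * norm (A (xk - ?x t)) + t powr (- a) * norm (?P (xk - ?x t)))"
      by (rule L(2)[OF t V_diff[OF dp(3) xt(2)]])
    also have "\<dots> \<le> L * ((c2 / c1 + 1) * K * t powr \<theta> + ((CDP + 1) / (cU * b) + K) * t powr \<theta>)"
      using 1 2 L(1) by (intro mult_left_mono add_mono) auto
    also have "\<dots> = (C - K) * t powr \<theta>" by (simp add: C_def distrib_right)
    finally have "norm (xk - ?x t) \<le> (C - K) * t powr \<theta>" .
    moreover have "norm (xk - xd) \<le> norm (xk - ?x t) + norm (?x t - xd)"
      using norm_triangle_ineq[of "xk - ?x t" "?x t - xd"] by simp
    ultimately have "norm (xk - xd) \<le> C * t powr \<theta>" using K(4)[OF t] by (simp add: left_diff_distrib)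
    then show ?thesis by (simp add: xk_def t\<theta> c_def mult.assoc)
  qed
  ultimately show ?thesis by blast
qed

end
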